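(* Let $G$ be a group satisfying Max (i.e. every subgroup of $G$ is finitely generated) and let $H\leq \mathrm{Aut}(G)$ be any group of nil-automorphisms of $G$. Then $[G,H]$ is contained in the Fitting radical of $G$, and $H$ stabilizes a finite subnormal series in $G$. In particular $H$ is nilpotent.
   Context: For a group $G$, $g\in G$ and $x\in\mathrm{Aut}(G)$, commutators are taken in the holomorph of $G$: $[g,x]=g^{-1}g^x$, $[g,_0x]=g$ and $[g,_kx]=[[g,_{k-1}x],x]$ for $k>0$. The automorphism $x$ is a nil-automorphism if for every $g\in G$ there is $n=n(g)$ with $[g,_nx]=1$. A group of nil-automorphisms of $G$ is a subgroup $H\le\mathrm{Aut}(G)$ all of whose elements are nil-automorphisms. $[G,H]$ is the subgroup generated by all $[g,h]$, $g\in G$, $h\in H$. $H$ stabilizes a finite subnormal series $G=G_0\trianglerighteq G_1\trianglerighteq\cdots\trianglerighteq G_r=1$ (each $G_{i+1}$ normal in $G_i$) if $[G_i,H]\le G_{i+1}$ for all $i$. The Fitting radical of $G$ is the subgroup generated by all nilpotent normal subgroups of $G$. *)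

theory Defs
  imports "HOL-Algebra.Bij" "HOL-Algebra.Generated_Groups"
begin

definition satisfies_max :: "('a, 'b) monoid_scheme \<Rightarrow> bool" where
  "satisfies_max G \<longleftrightarrow>
     (\<forall>K. subgroup K G \<longrightarrow> (\<exists>S. finite S \<and> S \<subseteq> carrier G \<and> generate G S = K))"


subsection \<open>Nilpotent groups and the Fitting radical\<close>

definition commutator :: "('a, 'b) monoid_scheme \<Rightarrow> 'a \<Rightarrow> 'a \<Rightarrow> 'a" where
  "commutator G a b = inv\<^bsub>G\<^esub> a \<otimes>\<^bsub>G\<^esub> inv\<^bsub>G\<^esub> b \<otimes>\<^bsub>G\<^esub> a \<otimes>\<^bsub>G\<^esub> b"

primrec lower_central :: "('a, 'b) monoid_scheme \<Rightarrow> nat \<Rightarrow> 'a set" where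
  "lower_central G 0 = carrier G"
| "lower_central G (Suc n) =
     generate G {commutator G a b | a b. a \<in> lower_central G n \<and> b \<in> carrier G}"

definition nilpotent_group :: "('a, 'b) monoid_scheme \<Rightarrow> bool" where
  "nilpotent_group G \<longleftrightarrow> group G \<and> (\<exists>n. lower_central G n = {\<one>\<^bsub>G\<^esub>})"

definition fitting_radical :: "('a, 'b) monoid_scheme \<Rightarrow> 'a set" where
  "fitting_radical G =
     generate G (\<Union>{N. N \<lhd> G \<and> nilpotent_group (G\<lparr>carrier := N\<rparr>)})"


subsection \<open>Commutators with automorphisms\<close>

text \<open>Identifying an automorphism \<open>x\<close> with an element of the holomorph, conjugation of
  \<open>g\<close> by \<open>x\<close> is application of \<open>x\<close>, so the holomorph commutator of \<open>g\<close> and \<open>x\<close> lies in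
  \<open>G\<close> and is given by the formula below. \<^const>\<open>AutoGroup\<close> multiplies as functions acting on
  the left, i.e. it is the opposite of the group of right operators; the two have the same
  subgroups and the same lower central series.\<close>

definition aut_commutator :: "('a, 'b) monoid_scheme \<Rightarrow> 'a \<Rightarrow> ('a \<Rightarrow> 'a) \<Rightarrow> 'a" where
  "aut_commutator G g x = inv\<^bsub>G\<^esub> g \<otimes>\<^bsub>G\<^esub> x g"

primrec iter_aut_commutator ::
    "('a, 'b) monoid_scheme \<Rightarrow> 'a \<Rightarrow> nat \<Rightarrow> ('a \<Rightarrow> 'a) \<Rightarrow> 'a" where
  "iter_aut_commutator G g 0 x = g"
| "iter_aut_commutator G g (Suc k) x = aut_commutator G (iter_aut_commutator G g k x) x"

definition nil_automorphism :: "('a, 'b) monoid_scheme \<Rightarrow> ('a \<Rightarrow> 'a) \<Rightarrow> bool" where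
  "nil_automorphism G x \<longleftrightarrow>
     x \<in> auto G \<and> (\<forall>g\<in>carrier G. \<exists>n. iter_aut_commutator G g n x = \<one>\<^bsub>G\<^esub>)"

definition nil_automorphism_group :: "('a, 'b) monoid_scheme \<Rightarrow> ('a \<Rightarrow> 'a) set \<Rightarrow> bool" where
  "nil_automorphism_group G H \<longleftrightarrow>
     subgroup H (AutoGroup G) \<and> (\<forall>x\<in>H. nil_automorphism G x)"

definition aut_commutator_subgroup ::
    "('a, 'b) monoid_scheme \<Rightarrow> 'a set \<Rightarrow> ('a \<Rightarrow> 'a) set \<Rightarrow> 'a set" where
  "aut_commutator_subgroup G K H = generate G {aut_commutator G g h | g h. g \<in> K \<and> h \<in> H}"


subsection \<open>Stabilized subnormal series\<close>

definition subnormal_series :: "('a, 'b) monoid_scheme \<Rightarrow> (nat \<Rightarrow> 'a set) \<Rightarrow> nat \<Rightarrow> bool" where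
  "subnormal_series G K r \<longleftrightarrow>
     K 0 = carrier G \<and> K r = {\<one>\<^bsub>G\<^esub>} \<and>
     (\<forall>i\<le>r. subgroup (K i) G) \<and>
     (\<forall>i<r. K (Suc i) \<lhd> G\<lparr>carrier := K i\<rparr>)"

definition stabilizes_series ::
    "('a, 'b) monoid_scheme \<Rightarrow> ('a \<Rightarrow> 'a) set \<Rightarrow> (nat \<Rightarrow> 'a set) \<Rightarrow> nat \<Rightarrow> bool" where
  "stabilizes_series G H K r \<longleftrightarrow> (\<forall>i<r. aut_commutator_subgroup G (K i) H \<subseteq> K (Suc i))"

end

theory Submission
  imports Defs "HOL-Algebra.Sylow" "HOL-Algebra.Group_Action" "HOL-Algebra.Multiplicative_Group"
begin

text \<open>
  Form the holomorph of \<open>G\<close>. There \<open>G\<close> and \<open>H\<close> are subgroups, \<open>H\<close> normalizes \<open>G\<close>, and every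
  \<open>h \<in> H\<close> is an Engel element relative to \<open>G\<close>: iterated commutators of any \<open>g \<in> G\<close> with \<open>h\<close> become trivial.
  The theorem combines Baer's theorem on Engel elements in groups with the maximal condition
  and Kolchin's theorem on unipotent groups.

  \<^item> \<^emph>\<open>One automorphism (Baer).\<close> For \<open>x \<in> H\<close> the set \<open>S\<close> of all conjugates of \<open>x\<close> under \<open>G\<close> generates a
    nilpotent group. Indeed consider the nilpotent groups generated by subsets of \<open>S\<close>. If there were two
    different maximal ones, choose such a pair \<open>U\<close>, \<open>V\<close> with \<open>I = \<langle>U \<inter> V \<inter> S\<rangle>\<close> as large as
    possible; the normalizer condition in nilpotent groups and the Engel condition produce a conjugate of \<open>V\<close>
    that meets \<open>V\<close> in more than \<open>I\<close> (\<open>maxgens_unique\<close>). So there is only one maximal group,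
    and it contains \<open>S\<close>. Hence \<open>[G, x]\<close> lies in the nilpotent normal subgroup \<open>\<langle>S\<rangle> \<inter> G\<close> of \<open>G\<close>
    (\<open>nil_element_normal_nilp\<close>).

  \<^item> \<^emph>\<open>The Fitting subgroup.\<close> By Fitting's theorem (\<open>nilp_sprod\<close>) and the maximal condition there is a largest
    nilpotent normal subgroup \<open>N\<close> of \<open>G\<close>; it contains \<open>[G, H]\<close> and is \<open>H\<close>-invariant.

  \<^item> \<^emph>\<open>The group \<open>H\<close> on \<open>N\<close> (Kolchin).\<close> The factors of the lower central series of \<open>N\<close> are finitely generated
    abelian groups on which \<open>H\<close> acts by unipotent automorphisms. On such a group \<open>A \<noteq> 0\<close> the group \<open>H\<close> has a
    nonzero fixed point (\<open>nil_group_fixed_point\<close>). If \<open>A\<close> has prime exponent \<open>p\<close>, it is finite and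
    \<open>H\<close> acts as a finite \<open>p\<close>-group, so fixed points are found by counting orbits. If \<open>A\<close> has torsion, use the
    elements of order dividing some prime. If \<open>A\<close> is torsion-free, take a minimal isolated \<open>H\<close>-invariant subgroup
    \<open>B \<noteq> 0\<close>: were \<open>[B, H] \<noteq> 0\<close>, it would have finite index in \<open>B\<close>, which is refuted modulo a large prime.
    Ascending series of fixed points then show that \<open>H\<close> stabilizes a series of \<open>N\<close> (\<open>nil_group_nilact\<close>),
    and \<open>G\<close> on top of it completes the series for \<open>G\<close>.

  \<^item> \<^emph>\<open>Nilpotency of \<open>H\<close>.\<close> The series can be chosen so that \<open>N\<close> centralizes the factors below \<open>N\<close>, and then the
    lower central series of \<open>H\<close> descends along it (\<open>lc_of_stabilizer\<close>).

  Since quotients, conjugates and the holomorph itself all occur, the argument is carried out for subsets of one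
  type that is a group; quotients are replaced by pairs of subgroups \<open>L \<subseteq> K\<close> with statements modulo \<open>L\<close>.
  That type is finally taken to be the permutations of the underlying type of \<open>G\<close>, where \<open>G\<close> acts by left
  translations and \<open>H\<close> as it stands.
\<close>

section \<open>Subgroups of a type that is a group\<close>

class group_mult = monoid_mult + inverse +
  assumes gm_left_inverse: "inverse a * a = 1"
begin

lemma gm_left_cancel: "inverse a * (a * b) = b"
  by (simp add: mult.assoc[symmetric] gm_left_inverse)

lemma gm_inverse_inverse: "inverse (inverse a) = a"
  by (metis gm_left_cancel gm_left_inverse mult.right_neutral)

lemma gm_right_inverse: "a * inverse a = 1"
  by (metis gm_inverse_inverse gm_left_inverse)

lemma gm_right_cancel: "a * (inverse a * b) = b"
  by (simp add: mult.assoc[symmetric] gm_right_inverse)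

lemma gm_inverse_unique: "a * b = 1 \<Longrightarrow> inverse a = b"
  by (metis gm_left_cancel mult.right_neutral)

lemma gm_inverse_mult: "inverse (a * b) = inverse b * inverse a"
  by (rule gm_inverse_unique) (simp add: mult.assoc gm_right_cancel gm_right_inverse)

lemma gm_inverse_one: "inverse 1 = 1"
  by (rule gm_inverse_unique) simp

lemmas gm_simps = mult.assoc gm_left_inverse gm_right_inverse gm_left_cancel gm_right_cancel
  gm_inverse_inverse gm_inverse_mult gm_inverse_one

lemma gm_conj_power: "(x * k * inverse x) ^ n = x * k ^ n * inverse x"
  by (induction n) (simp_all add: gm_simps)

lemma gm_inverse_power: "inverse (a ^ n) = inverse a ^ n"
  by (induction n) (simp_all add: gm_simps, metis power_Suc power_Suc2)

end

definition subgp :: "'p::group_mult set \<Rightarrow> bool" where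
  "subgp K \<longleftrightarrow> 1 \<in> K \<and> (\<forall>a\<in>K. \<forall>b\<in>K. a * b \<in> K) \<and> (\<forall>a\<in>K. inverse a \<in> K)"

definition gen :: "'p::group_mult set \<Rightarrow> 'p set" where
  "gen S = \<Inter>{K. subgp K \<and> S \<subseteq> K}"

definition nrm :: "'p::group_mult set \<Rightarrow> 'p set" where
  "nrm K = {x. \<forall>k. x * k * inverse x \<in> K \<longleftrightarrow> k \<in> K}"

text \<open>If \<open>x\<close> acts on the left by \<open>a \<mapsto> x * a * inverse x\<close>, this is \<open>a\<close> inverse times the image of \<open>a\<close>.\<close>

definition comm :: "'p::group_mult \<Rightarrow> 'p \<Rightarrow> 'p" where
  "comm a x = inverse a * x * a * inverse x"

lemma subgpI:
  assumes "1 \<in> K" "\<And>a b. a \<in> K \<Longrightarrow> b \<in> K \<Longrightarrow> a * b \<in> K" "\<And>a. a \<in> K \<Longrightarrow> inverse a \<in> K"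
  shows "subgp K"
  using assms by (auto simp: subgp_def)

lemma subgp_one: "subgp K \<Longrightarrow> 1 \<in> K"
  and subgp_mult: "subgp K \<Longrightarrow> a \<in> K \<Longrightarrow> b \<in> K \<Longrightarrow> a * b \<in> K"
  and subgp_inv: "subgp K \<Longrightarrow> a \<in> K \<Longrightarrow> inverse a \<in> K"
  by (auto simp: subgp_def)

lemma subgp_inv_iff: "subgp K \<Longrightarrow> inverse a \<in> K \<longleftrightarrow> a \<in> K"
  by (metis subgp_inv gm_inverse_inverse)

lemma subgp_mult_left_iff: "subgp K \<Longrightarrow> a \<in> K \<Longrightarrow> a * b \<in> K \<longleftrightarrow> b \<in> K"
  by (metis subgp_inv subgp_mult gm_left_cancel)

lemma subgp_mult_right_iff: "subgp K \<Longrightarrow> b \<in> K \<Longrightarrow> a * b \<in> K \<longleftrightarrow> a \<in> K"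
  using subgp_mult[of K "a * b" "inverse b"] by (auto simp: gm_simps subgp_inv subgp_mult)

lemma subgp_power: "subgp K \<Longrightarrow> a \<in> K \<Longrightarrow> a ^ n \<in> K"
  by (induction n) (auto simp: subgp_one subgp_mult)

lemma subgp_Int: "subgp K \<Longrightarrow> subgp L \<Longrightarrow> subgp (K \<inter> L)"
  by (auto simp: subgp_def)

lemma subgp_Inter: "(\<And>K. K \<in> F \<Longrightarrow> subgp K) \<Longrightarrow> subgp (\<Inter>F)"
  by (auto simp: subgp_def)

lemma subgp_trivial: "subgp {1}"
  by (auto simp: subgp_def gm_simps)

lemma subgp_gen: "subgp (gen S)"
  unfolding gen_def by (rule subgp_Inter) auto

lemma gen_superset: "S \<subseteq> gen S"
  by (auto simp: gen_def)

lemma gen_mem: "s \<in> S \<Longrightarrow> s \<in> gen S"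
  by (auto simp: gen_def)

lemma gen_least: "subgp K \<Longrightarrow> S \<subseteq> K \<Longrightarrow> gen S \<subseteq> K"
  by (auto simp: gen_def)

lemma gen_mono: "S \<subseteq> T \<Longrightarrow> gen S \<subseteq> gen T"
  by (auto simp: gen_def)

lemma gen_subgp: "subgp K \<Longrightarrow> gen K = K"
  by (simp add: gen_least gen_superset subset_antisym)

lemma gen_empty: "gen {} = {1}"
  using gen_least[OF subgp_trivial] subgp_one[OF subgp_gen] by blast

lemma subgp_directed_Union:
  assumes "C \<noteq> {}" "\<And>K. K \<in> C \<Longrightarrow> subgp K"
    and "\<And>K L. K \<in> C \<Longrightarrow> L \<in> C \<Longrightarrow> \<exists>M\<in>C. K \<subseteq> M \<and> L \<subseteq> M"
  shows "subgp (\<Union>C)"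
proof (rule subgpI)
  show "1 \<in> \<Union>C" using assms(1,2) subgp_one by auto
  show "a * b \<in> \<Union>C" if ab: "a \<in> \<Union>C" "b \<in> \<Union>C" for a b
  proof -
    obtain K L where "K \<in> C" "a \<in> K" "L \<in> C" "b \<in> L" using ab by blast
    moreover then obtain M where "M \<in> C" "K \<subseteq> M" "L \<subseteq> M" using assms(3) by blast
    ultimately show ?thesis using subgp_mult[of M a b] assms(2) by blast
  qed
  show "inverse a \<in> \<Union>C" if "a \<in> \<Union>C" for a
    using that assms(2) subgp_inv by blast
qed

subsection \<open>Normalizers and products\<close>

lemma nrmI:
  assumes "\<And>k. k \<in> K \<Longrightarrow> x * k * inverse x \<in> K" "\<And>k. k \<in> K \<Longrightarrow> inverse x * k * x \<in> K"
  shows "x \<in> nrm K"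
proof -
  have "k \<in> K" if "x * k * inverse x \<in> K" for k
    using assms(2)[OF that] by (simp add: gm_simps)
  then show ?thesis using assms(1) unfolding nrm_def by blast
qed

lemma nrmD: "x \<in> nrm K \<Longrightarrow> k \<in> K \<Longrightarrow> x * k * inverse x \<in> K"
  by (auto simp: nrm_def)

lemma nrmD_inv:
  assumes "x \<in> nrm K" "k \<in> K"
  shows "inverse x * k * x \<in> K"
proof -
  have "x * (inverse x * k * x) * inverse x \<in> K \<longleftrightarrow> inverse x * k * x \<in> K"
    using assms(1) unfolding nrm_def by blast
  then show ?thesis using assms(2) by (simp add: gm_simps)
qed

lemma subgp_nrm: "subgp (nrm K)"
proof (rule subgpI)
  show "1 \<in> nrm K" by (simp add: nrm_def gm_simps)
  show "a * b \<in> nrm K" if "a \<in> nrm K" "b \<in> nrm K" for a b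
  proof (rule nrmI)
    fix k assume "k \<in> K"
    then show "a * b * k * inverse (a * b) \<in> K"
      using nrmD[OF that(1) nrmD[OF that(2)]] by (simp add: gm_simps)
    from \<open>k \<in> K\<close> show "inverse (a * b) * k * (a * b) \<in> K"
      using nrmD_inv[OF that(2) nrmD_inv[OF that(1)]] by (simp add: gm_simps)
  qed
  show "inverse a \<in> nrm K" if "a \<in> nrm K" for a
    by (rule nrmI) (use nrmD[OF that] nrmD_inv[OF that] in \<open>simp_all add: gm_simps\<close>)
qed

lemma subgp_nrmI:
  assumes "subgp H" "\<And>y s. y \<in> H \<Longrightarrow> s \<in> S \<Longrightarrow> y * s * inverse y \<in> S"
  shows "H \<subseteq> nrm S"
proof
  fix x assume x: "x \<in> H"
  show "x \<in> nrm S"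
    by (rule nrmI) (use assms(2)[OF x] assms(2)[OF subgp_inv[OF assms(1) x]] in \<open>simp_all add: gm_inverse_inverse\<close>)
qed

lemma subgp_sub_nrm: "subgp K \<Longrightarrow> K \<subseteq> nrm K"
  by (auto intro!: nrmI simp: subgp_mult subgp_inv)

lemma nrm_Int: "nrm K \<inter> nrm L \<subseteq> nrm (K \<inter> L)"
  by (auto simp: nrm_def)

lemma nrm_gen:
  assumes "\<And>s. s \<in> S \<Longrightarrow> x * s * inverse x \<in> gen S" "\<And>s. s \<in> S \<Longrightarrow> inverse x * s * x \<in> gen S"
  shows "x \<in> nrm (gen S)"
proof (rule nrmI)
  have "gen S \<subseteq> {k. x * k * inverse x \<in> gen S}"
  proof (rule gen_least)
    show "subgp {k. x * k * inverse x \<in> gen S}"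
    proof (rule subgpI; simp)
      show "x * inverse x \<in> gen S" by (simp add: gm_simps subgp_one[OF subgp_gen])
      show "x * (a * b) * inverse x \<in> gen S"
        if "x * a * inverse x \<in> gen S" "x * b * inverse x \<in> gen S" for a b
        using subgp_mult[OF subgp_gen that] by (simp add: gm_simps)
      show "x * inverse a * inverse x \<in> gen S" if "x * a * inverse x \<in> gen S" for a
        using subgp_inv[OF subgp_gen that] by (simp add: gm_simps)
    qed
  qed (use assms in auto)
  then show "x * k * inverse x \<in> gen S" if "k \<in> gen S" for k using that by auto
  have "gen S \<subseteq> {k. inverse x * k * x \<in> gen S}"
  proof (rule gen_least)
    show "subgp {k. inverse x * k * x \<in> gen S}"
    proof (rule subgpI; simp)
      show "inverse x * x \<in> gen S" by (simp add: gm_simps subgp_one[OF subgp_gen])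
      show "inverse x * (a * b) * x \<in> gen S"
        if "inverse x * a * x \<in> gen S" "inverse x * b * x \<in> gen S" for a b
        using subgp_mult[OF subgp_gen that] by (simp add: gm_simps)
      show "inverse x * inverse a * x \<in> gen S" if "inverse x * a * x \<in> gen S" for a
        using subgp_inv[OF subgp_gen that] by (simp add: gm_simps)
    qed
  qed (use assms in auto)
  then show "inverse x * k * x \<in> gen S" if "k \<in> gen S" for k using that by auto
qed

lemma nrm_gen_nrm: "nrm S \<subseteq> nrm (gen S)"
  by (rule subsetI, rule nrm_gen) (auto intro: gen_mem nrmD nrmD_inv)

definition sprod :: "'p::group_mult set \<Rightarrow> 'p set \<Rightarrow> 'p set" where
  "sprod K L = {k * l | k l. k \<in> K \<and> l \<in> L}"

lemma sprodI: "k \<in> K \<Longrightarrow> l \<in> L \<Longrightarrow> k * l \<in> sprod K L"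
  by (auto simp: sprod_def)

lemma sprodE: "y \<in> sprod K L \<Longrightarrow> (\<And>k l. k \<in> K \<Longrightarrow> l \<in> L \<Longrightarrow> y = k * l \<Longrightarrow> P) \<Longrightarrow> P"
  by (auto simp: sprod_def)

lemma sprod_mono: "K \<subseteq> K' \<Longrightarrow> L \<subseteq> L' \<Longrightarrow> sprod K L \<subseteq> sprod K' L'"
  by (auto simp: sprod_def)

lemma subgp_sprod:
  assumes "subgp K" "subgp L" "K \<subseteq> nrm L"
  shows "subgp (sprod K L)"
proof (rule subgpI)
  show "1 \<in> sprod K L" using assms sprodI[of 1 K 1 L] by (simp add: subgp_one)
next
  fix a b assume "a \<in> sprod K L" "b \<in> sprod K L"
  then obtain k l k' l' where *: "k \<in> K" "l \<in> L" "a = k * l" "k' \<in> K" "l' \<in> L" "b = k' * l'"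
    by (auto elim!: sprodE)
  have "a * b = (k * k') * ((inverse k' * l * k') * l')" using * by (simp add: gm_simps)
  then show "a * b \<in> sprod K L"
    using * assms by (auto intro!: sprodI subgp_mult nrmD_inv)
next
  fix a assume "a \<in> sprod K L"
  then obtain k l where *: "k \<in> K" "l \<in> L" "a = k * l" by (auto elim!: sprodE)
  have "inverse a = inverse k * (k * inverse l * inverse k)" using * by (simp add: gm_simps)
  then show "inverse a \<in> sprod K L"
    using * assms by (auto intro!: sprodI subgp_inv nrmD)
qed

lemma sprod_superset:
  assumes "subgp K" "subgp L"
  shows "K \<subseteq> sprod K L" "L \<subseteq> sprod K L"
  using assms sprodI[of _ K 1 L] sprodI[of 1 K _ L] by (auto simp: subgp_one)

lemma sprod_least: "subgp M \<Longrightarrow> K \<subseteq> M \<Longrightarrow> L \<subseteq> M \<Longrightarrow> sprod K L \<subseteq> M"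
  by (auto simp: sprod_def intro: subgp_mult)

lemma gen_union_sprod:
  assumes "subgp K" "subgp L" "K \<subseteq> nrm L"
  shows "gen (K \<union> L) = sprod K L"
proof (rule subset_antisym)
  show "gen (K \<union> L) \<subseteq> sprod K L"
    using assms by (simp add: gen_least sprod_superset subgp_sprod)
  show "sprod K L \<subseteq> gen (K \<union> L)"
    by (rule sprod_least) (auto intro: gen_mem subgp_gen)
qed

lemma gen_insert_nrm:
  assumes "subgp C" "t \<in> nrm C" "y \<in> gen (insert t C)"
  obtains z c where "z \<in> gen {t}" "c \<in> C" "y = z * c"
proof -
  have "gen {t} \<subseteq> nrm C" using assms(2) by (intro gen_least subgp_nrm) auto
  then have "gen (gen {t} \<union> C) = sprod (gen {t}) C" by (rule gen_union_sprod[OF subgp_gen assms(1)])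
  moreover have "gen (insert t C) \<subseteq> gen (gen {t} \<union> C)"
    using gen_mem[of t "{t}"] by (intro gen_mono) auto
  ultimately show ?thesis using assms(3) that by (metis sprodE subsetD)
qed

lemma nrm_sprod: "nrm K \<inter> nrm L \<subseteq> nrm (sprod K L)"
proof
  fix x assume x: "x \<in> nrm K \<inter> nrm L"
  show "x \<in> nrm (sprod K L)"
  proof (rule nrmI)
    fix y assume "y \<in> sprod K L"
    then obtain k l where *: "k \<in> K" "l \<in> L" "y = k * l" by (auto elim!: sprodE)
    have "x * y * inverse x = (x * k * inverse x) * (x * l * inverse x)"
      "inverse x * y * x = (inverse x * k * x) * (inverse x * l * x)"
      using * by (simp_all add: gm_simps)
    then show "x * y * inverse x \<in> sprod K L" "inverse x * y * x \<in> sprod K L"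
      using * x by (auto intro!: sprodI nrmD nrmD_inv)
  qed
qed

lemma gen_singleton_powers:
  assumes "z \<in> gen {t}"
  shows "\<exists>n. z = t ^ n \<or> z = inverse t ^ n"
proof -
  let ?P = "{z. \<exists>m n. z = t ^ m * inverse t ^ n}"
  have "inverse t ^ n * t = t * inverse t ^ n" for n
    by (rule power_commuting_commutes) (simp add: gm_simps)
  then have comm': "t ^ m * inverse t ^ n = inverse t ^ n * t ^ m" for m n
    by (intro power_commuting_commutes) simp
  have "subgp ?P"
  proof (rule subgpI)
    have "1 = t ^ 0 * inverse t ^ 0" by simp
    then show "1 \<in> ?P" by blast
    fix a assume "a \<in> ?P"
    then obtain m n where a: "a = t ^ m * inverse t ^ n" by auto
    have "inverse a = t ^ n * inverse t ^ m"
      unfolding a by (simp add: gm_simps gm_inverse_power)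
    then show "inverse a \<in> ?P" by blast
    fix b assume "b \<in> ?P"
    then obtain m' n' where b: "b = t ^ m' * inverse t ^ n'" by auto
    have "a * b = t ^ m * (inverse t ^ n * t ^ m') * inverse t ^ n'"
      unfolding a b by (simp add: mult.assoc)
    also have "\<dots> = t ^ (m + m') * inverse t ^ (n + n')"
      by (simp add: comm'[symmetric] power_add mult.assoc)
    finally show "a * b \<in> ?P" by blast
  qed
  moreover have "t = t ^ 1 * inverse t ^ 0" by simp
  then have "{t} \<subseteq> ?P" by blast
  ultimately obtain m n where z: "z = t ^ m * inverse t ^ n"
    using gen_least[of ?P "{t}"] assms by blast
  have cancel: "t ^ k * inverse t ^ k = 1" for k
    by (simp add: gm_simps flip: gm_inverse_power)
  show ?thesis
  proof (cases "n \<le> m")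
    case True
    then obtain d where "m = d + n" by (metis le_add_diff_inverse2)
    then have "z = t ^ d" unfolding z by (simp add: power_add mult.assoc cancel)
    then show ?thesis by blast
  next
    case False
    then obtain d where "n = m + d" by (metis less_imp_add_positive linorder_not_le)
    then have "z = inverse t ^ d"
      unfolding z by (simp add: power_add cancel flip: mult.assoc)
    then show ?thesis by blast
  qed
qed

subsection \<open>Commutators and sections\<close>

lemma comm_mult_right: "comm a (x * y) = comm a x * (x * comm a y * inverse x)"
  by (simp add: comm_def gm_simps)

lemma comm_inv_right: "comm a (inverse x) = inverse x * inverse (comm a x) * x"
  by (simp add: comm_def gm_simps)

lemma comm_mult_left: "comm (a * b) x = (inverse b * comm a x * b) * comm b x"
  by (simp add: comm_def gm_simps)

lemma comm_inv_left: "comm (inverse a) x = a * inverse (comm a x) * inverse a"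
  by (simp add: comm_def gm_simps)

lemma comm_one: "comm 1 x = 1" "comm a 1 = 1"
  by (simp_all add: comm_def gm_simps)

lemma comm_conj: "comm (g * a * inverse g) (g * x * inverse g) = g * comm a x * inverse g"
  by (simp add: comm_def gm_simps)

lemma conj_eq_comm: "x * a * inverse x = a * comm a x"
  by (simp add: comm_def gm_simps)

lemma comm_in_left:
  assumes "subgp K" "a \<in> K" "x \<in> nrm K" shows "comm a x \<in> K"
  using subgp_mult[OF assms(1) subgp_inv[OF assms(1,2)] nrmD[OF assms(3,2)]]
  by (simp add: comm_def gm_simps)

lemma comm_in_right:
  assumes "subgp K" "x \<in> K" "a \<in> nrm K" shows "comm a x \<in> K"
  using subgp_mult[OF assms(1) nrmD_inv[OF assms(3,2)] subgp_inv[OF assms(1,2)]]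
  by (simp add: comm_def gm_simps)

text \<open>By the product formulas above a commutator is, up to conjugation, multiplicative in each argument. So
  the condition \<open>comm a x \<in> L\<close> may be checked on generators that normalize \<open>L\<close>.\<close>

lemma subgp_comm_left: "subgp L \<Longrightarrow> subgp {a \<in> nrm L. comm a x \<in> L}"
  by (rule subgpI)
    (auto simp: comm_one comm_mult_left comm_inv_left
      intro: subgp_one subgp_mult subgp_inv nrmD nrmD_inv subgp_nrm)

lemma subgp_comm_right: "subgp L \<Longrightarrow> subgp {x \<in> nrm L. comm a x \<in> L}"
  by (rule subgpI)
    (auto simp: comm_one comm_mult_right comm_inv_right
      intro: subgp_one subgp_mult subgp_inv nrmD nrmD_inv subgp_nrm)

text \<open>The elements normalizing \<open>M\<close> and \<open>L\<close> that act trivially on the section \<open>M / L\<close>.\<close>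

definition sec_cent :: "'p::group_mult set \<Rightarrow> 'p set \<Rightarrow> 'p set" where
  "sec_cent M L = {x \<in> nrm M \<inter> nrm L. \<forall>a\<in>M. comm a x \<in> L}"

lemma subgp_sec_cent:
  assumes "subgp L" shows "subgp (sec_cent M L)"
proof -
  have "sec_cent M L = nrm M \<inter> (nrm L \<inter> \<Inter>((\<lambda>a. {x \<in> nrm L. comm a x \<in> L}) ` M))"
    by (auto simp: sec_cent_def)
  moreover have "subgp (\<Inter>((\<lambda>a. {x \<in> nrm L. comm a x \<in> L}) ` M))"
    by (rule subgp_Inter) (use assms in \<open>auto intro: subgp_comm_right\<close>)
  ultimately show ?thesis by (simp add: subgp_Int subgp_nrm)
qed

text \<open>Membership in \<open>sec_cent M L\<close> of a set closed under inverses follows from the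
  commutator condition alone, because \<open>x * a * inverse x = a * comm a x\<close>.\<close>

lemma sec_centI:
  assumes "subgp M" "subgp L" "L \<subseteq> M"
    and X: "\<And>x. x \<in> X \<Longrightarrow> inverse x \<in> X" "\<And>a x. a \<in> M \<Longrightarrow> x \<in> X \<Longrightarrow> comm a x \<in> L"
  shows "X \<subseteq> sec_cent M L"
proof
  fix x assume x: "x \<in> X"
  have conj: "y * a * inverse y \<in> K" if "subgp K" "a \<in> K" "K \<subseteq> M" "L \<subseteq> K" "y \<in> X" for y a K
    using that X(2) unfolding conj_eq_comm by (meson subgp_mult subsetD)
  have "x \<in> nrm K" if K: "subgp K" "K \<subseteq> M" "L \<subseteq> K" for K
  proof (rule nrmI)
    fix k assume k: "k \<in> K"
    show "x * k * inverse x \<in> K" using conj[OF K(1) k K(2,3) x] .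
    show "inverse x * k * x \<in> K"
      using conj[OF K(1) k K(2,3) X(1)[OF x]] by (simp add: gm_inverse_inverse)
  qed
  then show "x \<in> sec_cent M L"
    using assms x by (auto simp: sec_cent_def)
qed

section \<open>The maximal condition\<close>

definition max_cond :: "'p::group_mult set \<Rightarrow> bool" where
  "max_cond G \<longleftrightarrow> (\<forall>K. subgp K \<and> K \<subseteq> G \<longrightarrow> (\<exists>S. finite S \<and> gen S = K))"

lemma max_cond_subset: "max_cond G \<Longrightarrow> K \<subseteq> G \<Longrightarrow> max_cond K"
  unfolding max_cond_def by blast

lemma max_cond_maximal:
  assumes "max_cond G" "F \<noteq> {}" and F: "\<And>K. K \<in> F \<Longrightarrow> subgp K \<and> K \<subseteq> G"
  shows "\<exists>M\<in>F. \<forall>K\<in>F. M \<subseteq> K \<longrightarrow> K = M"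
proof -
  have "\<Union>C \<in> F" if C: "C \<noteq> {}" "subset.chain F C" for C
  proof -
    have CF: "C \<subseteq> F" using C(2) by (simp add: subset.chain_def)
    have lin: "K \<subseteq> L \<or> L \<subseteq> K" if "K \<in> C" "L \<in> C" for K L
      using C(2) that by (auto simp: subset.chain_def)
    have "subgp (\<Union>C)"
    proof (rule subgp_directed_Union)
      show "C \<noteq> {}" by (rule C(1))
      show "subgp K" if "K \<in> C" for K using that F CF by blast
      show "\<exists>M\<in>C. K \<subseteq> M \<and> L \<subseteq> M" if "K \<in> C" "L \<in> C" for K L
        using lin[OF that] that by blast
    qed
    moreover have "\<Union>C \<subseteq> G" using F CF by blast
    ultimately have "\<exists>S. finite S \<and> gen S = \<Union>C"
      using assms(1) by (simp add: max_cond_def)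
    then obtain S where S: "finite S" "gen S = \<Union>C" by (elim exE conjE)
    then have "S \<subseteq> \<Union>C" using gen_superset[of S] by simp
    from finite_subset_Union_chain[OF S(1) this C] obtain K where K: "K \<in> C" "S \<subseteq> K" .
    have "K \<in> F" using CF K(1) by (rule subsetD)
    then have "gen S \<subseteq> K" using F K(2) by (intro gen_least) simp_all
    with K(1) S(2) have "\<Union>C = K" by (metis Union_upper subset_antisym)
    then show ?thesis using \<open>K \<in> F\<close> by simp
  qed
  from subset_Zorn_nonempty[OF assms(2) this] show ?thesis by blast
qed

text \<open>Noetherian induction: every property that passes from a subgroup to the one obtained by
  adjoining one element climbs from \<open>L\<close> to \<open>K\<close>.\<close>

lemma max_cond_induct:
  assumes "max_cond K" "subgp K" "subgp L" "L \<subseteq> K" "P L"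
    and step: "\<And>C t. subgp C \<Longrightarrow> L \<subseteq> C \<Longrightarrow> C \<subseteq> K \<Longrightarrow> P C \<Longrightarrow> t \<in> K \<Longrightarrow> t \<notin> C \<Longrightarrow> P (gen (insert t C))"
  shows "P K"
proof -
  define F where "F = {C. subgp C \<and> L \<subseteq> C \<and> C \<subseteq> K \<and> P C}"
  have "L \<in> F" using assms(3-5) by (simp add: F_def)
  then have "\<exists>M\<in>F. \<forall>C\<in>F. M \<subseteq> C \<longrightarrow> C = M"
    by (intro max_cond_maximal[OF assms(1)]) (auto simp: F_def)
  then obtain M where "M \<in> F" and max: "\<And>C. C \<in> F \<Longrightarrow> M \<subseteq> C \<Longrightarrow> C = M" by blast
  then have M: "subgp M" "L \<subseteq> M" "M \<subseteq> K" "P M" by (auto simp: F_def)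
  have "M = K"
  proof (rule ccontr)
    assume "M \<noteq> K"
    then obtain t where t: "t \<in> K" "t \<notin> M" using M by auto
    have "gen (insert t M) \<subseteq> K" using M t by (intro gen_least[OF assms(2)]) auto
    then have "gen (insert t M) \<in> F"
      using M step[OF M t] gen_superset[of "insert t M"] by (auto simp: subgp_gen F_def)
    then have "gen (insert t M) = M" using max gen_superset[of "insert t M"] by auto
    then show False using t(2) gen_mem[of t "insert t M"] by simp
  qed
  then show ?thesis using M(4) by simp
qed

section \<open>Nilpotent action\<close>

text \<open>\<open>nilact X K L\<close> says that \<open>X\<close> stabilizes some finite series from \<open>K\<close> down to \<open>L\<close>.
  Elements of \<open>X\<close> normalize the terms, so if \<open>X\<close> contains \<open>K\<close> then each term is normal in the preceding one.\<close>

definition step :: "'p::group_mult set \<Rightarrow> 'p set \<Rightarrow> 'p set \<Rightarrow> bool" where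
  "step X M L \<longleftrightarrow> subgp M \<and> subgp L \<and> L \<subseteq> M \<and> X \<subseteq> sec_cent M L"

abbreviation nilact :: "'p::group_mult set \<Rightarrow> 'p set \<Rightarrow> 'p set \<Rightarrow> bool" where
  "nilact X \<equiv> (step X)\<^sup>*\<^sup>*"

lemma stepD:
  assumes "step X M L"
  shows "subgp M" "subgp L" "L \<subseteq> M" "X \<subseteq> nrm M" "X \<subseteq> nrm L"
    "a \<in> M \<Longrightarrow> x \<in> X \<Longrightarrow> comm a x \<in> L"
  using assms by (auto simp: step_def sec_cent_def)

lemma stepI:
  assumes "subgp M" "subgp L" "L \<subseteq> M" "X \<subseteq> nrm M" "X \<subseteq> nrm L"
    "\<And>a x. a \<in> M \<Longrightarrow> x \<in> X \<Longrightarrow> comm a x \<in> L"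
  shows "step X M L"
  using assms by (auto simp: step_def sec_cent_def)

lemma nilact_subset: "nilact X K L \<Longrightarrow> L \<subseteq> K"
  by (induction rule: rtranclp_induct) (auto dest: stepD(3))

lemma nilact_antimono:
  assumes "nilact X K L" "Y \<subseteq> X" shows "nilact Y K L"
  using assms(1)
proof (rule rtranclp_mono[THEN predicate2D, rotated])
  show "step X \<le> step Y" using assms(2) unfolding step_def by blast
qed

lemma nilact_gen:
  assumes "nilact X K L" shows "nilact (gen X) K L"
  using assms
proof (rule rtranclp_mono[THEN predicate2D, rotated])
  show "step X \<le> step (gen X)"
    unfolding step_def by (blast dest: gen_least[OF subgp_sec_cent])
qed

lemma step_Int:
  assumes "step X M L" "subgp D" "X \<subseteq> nrm D"
  shows "step X (D \<inter> M) (D \<inter> L)"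
proof (rule stepI)
  show "comm a x \<in> D \<inter> L" if "a \<in> D \<inter> M" "x \<in> X" for a x
    using that stepD(6)[OF assms(1)] comm_in_left[OF assms(2)] assms(3) by blast
  show "X \<subseteq> nrm (D \<inter> M)" "X \<subseteq> nrm (D \<inter> L)"
    using stepD[OF assms(1)] assms(3) nrm_Int by blast+
qed (use stepD[OF assms(1)] assms in \<open>auto intro: subgp_Int\<close>)

lemma step_sprod:
  assumes "step X M L" "subgp V" "X \<subseteq> nrm V" "M \<subseteq> nrm V"
  shows "step X (sprod M V) (sprod L V)"
proof (rule stepI)
  note st = stepD[OF assms(1)]
  show "comm a x \<in> sprod L V" if a: "a \<in> sprod M V" and x: "x \<in> X" for a x
  proof -
    obtain m v where m: "m \<in> M" "v \<in> V" "a = m * v" using a by (auto elim: sprodE)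
    define c where "c = comm m x"
    have c: "c \<in> L" using st(6) m x by (simp add: c_def)
    have "comm a x = c * ((inverse c * inverse v * c) * v * comm v x)"
      unfolding m c_def comm_mult_left by (simp add: gm_simps)
    moreover have "inverse c * inverse v * c \<in> V"
      using c st(3) assms m by (intro nrmD_inv subgp_inv) auto
    moreover have "comm v x \<in> V" using m x assms by (auto intro: comm_in_left)
    ultimately show ?thesis
      using c m assms(2) by (auto intro!: sprodI subgp_mult)
  qed
  show "X \<subseteq> nrm (sprod M V)" "X \<subseteq> nrm (sprod L V)"
    using st assms nrm_sprod by blast+
  show "subgp (sprod M V)" "subgp (sprod L V)"
    using st(1-3) assms(2,4) by (blast intro: subgp_sprod)+
  show "sprod L V \<subseteq> sprod M V" by (rule sprod_mono[OF st(3) order_refl])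
qed

lemma nilact_Int:
  assumes "nilact X K L" "subgp D" "X \<subseteq> nrm D"
  shows "nilact X (D \<inter> K) (D \<inter> L)"
  using assms(1)
proof (induction rule: rtranclp_induct)
  case (step M N)
  from step(3) step_Int[OF step(2) assms(2,3)] show ?case by (rule rtranclp.rtrancl_into_rtrancl)
qed simp

lemma nilact_sprod:
  assumes "nilact X K L" "subgp V" "X \<subseteq> nrm V" "K \<subseteq> nrm V"
  shows "nilact X (sprod K V) (sprod L V)"
  using assms(1)
proof (induction rule: rtranclp_induct)
  case (step M N)
  have "M \<subseteq> nrm V" using nilact_subset[OF step(1)] assms(4) by simp
  from step(3) step_sprod[OF step(2) assms(2,3) this] show ?case
    by (rule rtranclp.rtrancl_into_rtrancl)
qed simp

text \<open>A stabilized series is intersected with \<open>D\<close> and multiplied by \<open>E\<close> to refine the section \<open>D / E\<close>.\<close>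

lemma nilact_section:
  assumes "nilact X K L" "subgp D" "subgp E" "E \<subseteq> D" "D \<subseteq> K" "L \<inter> D \<subseteq> E"
    and "D \<subseteq> nrm E" "X \<subseteq> nrm D" "X \<subseteq> nrm E"
  shows "nilact X D E"
proof -
  have "nilact X (sprod (D \<inter> K) E) (sprod (D \<inter> L) E)"
    using assms by (intro nilact_sprod nilact_Int) auto
  moreover have "sprod (D \<inter> K) E = D"
    using assms sprod_superset[of D E] sprod_least[of D D E] by (simp add: Int_absorb2 subset_antisym)
  moreover have "E \<subseteq> sprod (D \<inter> L) E" if "nilact X K L" "K \<noteq> L"
    using that assms
    by (induction rule: rtranclp_induct) (auto intro!: sprod_superset(2)[THEN subsetD] subgp_Int dest: stepD(2))
  then have "E \<subseteq> sprod (D \<inter> L) E"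
    using assms sprod_superset(2)[OF assms(2,3)] by (cases "K = L") (auto simp: Int_absorb2)
  then have "sprod (D \<inter> L) E = E"
    using assms sprod_least[of E "D \<inter> L" E] by auto
  ultimately show ?thesis by simp
qed

text \<open>Whatever acts trivially on the whole section \<open>M / L\<close> acts trivially on every factor of a series
  between \<open>M\<close> and \<open>L\<close>.\<close>

lemma nilact_union:
  assumes "nilact X M L" "\<And>y. y \<in> Y \<Longrightarrow> inverse y \<in> Y" "\<And>a y. a \<in> M \<Longrightarrow> y \<in> Y \<Longrightarrow> comm a y \<in> L"
  shows "nilact (X \<union> Y) M L"
  using assms(1,3)
proof (induction rule: converse_rtranclp_induct)
  case (step M M')
  note st = stepD[OF step(1)]
  have L: "L \<subseteq> M'" by (rule nilact_subset[OF step(2)])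
  have "Y \<subseteq> sec_cent M M'"
    using st assms(2) step.prems L by (intro sec_centI) auto
  then have "step (X \<union> Y) M M'" using step(1) by (auto simp: step_def)
  moreover have "nilact (X \<union> Y) M' L" using st(3) step.prems by (intro step.IH) auto
  ultimately show ?case by (rule converse_rtranclp_into_rtranclp)
qed simp

lemma section_fixed_points:
  assumes "subgp K" "subgp L" "L \<subseteq> K" "K \<subseteq> nrm L" and X: "\<And>x. x \<in> X \<Longrightarrow> inverse x \<in> X" "X \<subseteq> nrm L"
  defines "L' \<equiv> {k \<in> K. \<forall>x\<in>X. comm k x \<in> L}"
  shows "subgp L'" "L \<subseteq> L'" "X \<subseteq> nrm L'" "step X L' L"
proof -
  have "L' = K \<inter> \<Inter>((\<lambda>x. {a \<in> nrm L. comm a x \<in> L}) ` X)"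
    using assms(4) by (auto simp: L'_def)
  moreover have "subgp (\<Inter>((\<lambda>x. {a \<in> nrm L. comm a x \<in> L}) ` X))"
    using subgp_comm_left[OF assms(2)] by (intro subgp_Inter) blast
  ultimately show L': "subgp L'" using assms(1) by (simp add: subgp_Int)
  show LL: "L \<subseteq> L'" using assms(3) X(2) comm_in_left[OF assms(2)] by (auto simp: L'_def)
  have "X \<subseteq> sec_cent L' L"
    using assms(2) L' LL X(1) by (intro sec_centI) (auto simp: L'_def)
  then show "step X L' L" "X \<subseteq> nrm L'" using assms(2) L' LL by (auto simp: step_def sec_cent_def)
qed

text \<open>If every proper \<open>X\<close>-invariant quotient of the abelian group \<open>K / M\<close> has a nontrivial fixed point
  then the ascending series of fixed points reaches \<open>K\<close> by the maximal condition.\<close>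

lemma nilact_of_fixed_points:
  assumes K: "max_cond K" "subgp K" and M: "subgp M" "M \<subseteq> K"
    and ab: "\<And>a b. a \<in> K \<Longrightarrow> b \<in> K \<Longrightarrow> comm a b \<in> M"
    and X: "\<And>x. x \<in> X \<Longrightarrow> inverse x \<in> X" "X \<subseteq> nrm K" "X \<subseteq> nrm M"
    and fp: "\<And>L. subgp L \<Longrightarrow> M \<subseteq> L \<Longrightarrow> L \<subset> K \<Longrightarrow> X \<subseteq> nrm L \<Longrightarrow> \<exists>k\<in>K - L. \<forall>x\<in>X. comm k x \<in> L"
  shows "nilact X K M"
proof -
  define F where "F = {L. subgp L \<and> M \<subseteq> L \<and> L \<subseteq> K \<and> X \<subseteq> nrm L \<and> nilact X L M}"
  have "M \<in> F" using M X(3) by (simp add: F_def)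
  then have "\<exists>L\<in>F. \<forall>C\<in>F. L \<subseteq> C \<longrightarrow> C = L"
    by (intro max_cond_maximal[OF K(1)]) (auto simp: F_def)
  then obtain L where "L \<in> F" and max: "\<And>C. C \<in> F \<Longrightarrow> L \<subseteq> C \<Longrightarrow> C = L" by blast
  then have L: "subgp L" "M \<subseteq> L" "L \<subseteq> K" "X \<subseteq> nrm L" "nilact X L M" by (auto simp: F_def)
  have "L = K"
  proof (rule ccontr)
    assume "L \<noteq> K"
    then obtain k where k: "k \<in> K" "k \<notin> L" "\<forall>x\<in>X. comm k x \<in> L"
      using fp[OF L(1,2) _ L(4)] L(3) by blast
    define L' where "L' = {k \<in> K. \<forall>x\<in>X. comm k x \<in> L}"
    have "K \<subseteq> sec_cent K L"
      using K(2) L(1-3) ab by (intro sec_centI) (auto intro: subgp_inv)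
    then have KL: "K \<subseteq> nrm L" by (auto simp: sec_cent_def)
    note fix' = section_fixed_points[OF K(2) L(1,3) KL X(1) L(4), folded L'_def]
    have LL: "L \<subseteq> L'" by (rule fix'(2))
    have st: "step X L' L" by (rule fix'(4))
    then have "nilact X L' M" using L(5) by (blast intro: converse_rtranclp_into_rtranclp)
    then have "L' \<in> F" using L(2) LL fix'(1,3) by (auto simp: L'_def F_def)
    then have "L' = L" using max LL by blast
    then show False using k by (auto simp: L'_def)
  qed
  then show ?thesis using L(5) by simp
qed

section \<open>Nilpotent subgroups\<close>

lemma nrm_trivial: "x \<in> nrm {1}"
  by (rule nrmI) (simp_all add: gm_simps)

primrec lc :: "'p::group_mult set \<Rightarrow> nat \<Rightarrow> 'p set" where
  "lc V 0 = V"
| "lc V (Suc n) = gen {comm a b | a b. a \<in> lc V n \<and> b \<in> V}"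

definition nilp :: "'p::group_mult set \<Rightarrow> bool" where
  "nilp V \<longleftrightarrow> subgp V \<and> (\<exists>n. lc V n = {1})"

lemma subgp_lc: "subgp V \<Longrightarrow> subgp (lc V n)"
  by (cases n) (auto simp: subgp_gen)

lemma lc_comm: "a \<in> lc V n \<Longrightarrow> b \<in> V \<Longrightarrow> comm a b \<in> lc V (Suc n)"
  by (auto intro!: gen_mem)

lemma nrm_lc: "x \<in> nrm V \<Longrightarrow> x \<in> nrm (lc V n)"
proof (induction n)
  case (Suc n)
  then have x: "x \<in> nrm V" "x \<in> nrm (lc V n)" by auto
  show ?case
    unfolding lc.simps
  proof (rule nrm_gen; clarsimp)
    fix a b assume ab: "a \<in> lc V n" "b \<in> V"
    show "x * comm a b * inverse x \<in> gen {comm a b |a b. a \<in> lc V n \<and> b \<in> V}"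
      unfolding comm_conj[symmetric] using x ab
      by (intro gen_mem) (auto intro: nrmD)
    show "inverse x * comm a b * x \<in> gen {comm a b |a b. a \<in> lc V n \<and> b \<in> V}"
      using comm_conj[of "inverse x" a b, symmetric] x ab
      by (auto intro!: gen_mem nrmD_inv simp: gm_inverse_inverse)
  qed
qed simp

lemma sub_nrm_lc: "X \<subseteq> nrm V \<Longrightarrow> X \<subseteq> nrm (lc V n)"
  using nrm_lc by blast

lemma lc_Suc_subset:
  assumes "subgp V" shows "lc V (Suc n) \<subseteq> lc V n"
proof -
  have "comm a b \<in> lc V n" if "a \<in> lc V n" "b \<in> V" for a b
    using comm_in_left[OF subgp_lc[OF assms] that(1)] sub_nrm_lc[OF subgp_sub_nrm[OF assms]] that(2)
    by blast
  then show ?thesis unfolding lc.simps by (intro gen_least subgp_lc assms) auto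
qed

lemma lc_subset: "subgp V \<Longrightarrow> lc V n \<subseteq> V"
proof (induction n)
  case (Suc n) then show ?case using lc_Suc_subset[of V n] by blast
qed simp

lemma lc_nrm_lc: "subgp V \<Longrightarrow> lc V i \<subseteq> nrm (lc V n)"
  using sub_nrm_lc[OF subgp_sub_nrm, of V n] lc_subset[of V i] by blast

lemma lc_step: "subgp V \<Longrightarrow> step V (lc V n) (lc V (Suc n))"
  by (rule stepI)
    (simp_all add: subgp_lc lc_Suc_subset sub_nrm_lc subgp_sub_nrm lc_comm del: lc.simps)

text \<open>The lower central series descends at least as fast as any series that \<open>V\<close> stabilizes in itself.\<close>

lemma nilp_iff_nilact:
  assumes "subgp V" shows "nilp V \<longleftrightarrow> nilact V V {1}"
proof
  have "nilact V V (lc V n)" for n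
  proof (induction n)
    case (Suc n)
    then show ?case using lc_step[OF assms] by (rule rtranclp.rtrancl_into_rtrancl)
  qed simp
  then show "nilp V \<Longrightarrow> nilact V V {1}" unfolding nilp_def by (metis (no_types))
next
  assume "nilact V V {1}"
  then have "\<exists>n. lc V n \<subseteq> {1}"
  proof (induction rule: rtranclp_induct)
    case (step M N)
    then obtain n where "lc V n \<subseteq> M" by auto
    then have "lc V (Suc n) \<subseteq> N"
      unfolding lc.simps using stepD(2,6)[OF step(2)] by (intro gen_least) blast+
    then show ?case by blast
  qed (auto intro: exI[of _ 0])
  then obtain n where "lc V n \<subseteq> {1}" by blast
  then have "lc V n = {1}" using subgp_one[OF subgp_lc[OF assms]] by blast
  then show "nilp V" using assms unfolding nilp_def by blast
qed

lemma nilp_subgroup: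
  assumes "nilp V" "subgp U" "U \<subseteq> V" shows "nilp U"
proof -
  have "nilact V V {1}" using assms(1) nilp_iff_nilact nilp_def by blast
  from nilact_antimono[OF this assms(3)] have "nilact U U {1}"
    by (rule nilact_section)
      (use assms(2,3) subgp_sub_nrm[OF assms(2)] in \<open>auto simp: subgp_trivial subgp_one nrm_trivial\<close>)
  then show ?thesis using nilp_iff_nilact[OF assms(2)] by blast
qed

text \<open>\<open>V\<close> acts trivially on the factors of its lower central series, so a nilpotent action of \<open>X\<close> on each of
  these factors yields one series for the action of both.\<close>

lemma nilact_of_lc_sections:
  assumes "nilp V" "\<And>i. nilact X (lc V i) (lc V (Suc i))"
  shows "nilact (X \<union> V) V {1}"
proof -
  have V: "subgp V" using assms(1) by (simp add: nilp_def)
  have "nilact (X \<union> V) (lc V i) (lc V (Suc i))" for i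
    by (rule nilact_union[OF assms(2)]) (simp_all add: V lc_comm subgp_inv del: lc.simps)
  then have "nilact (X \<union> V) V (lc V n)" for n
  proof (induction n)
    case (Suc n)
    then show ?case by (meson rtranclp_trans)
  qed simp
  then show ?thesis using assms(1) unfolding nilp_def by (metis (no_types))
qed

text \<open>Fitting's theorem. \<open>W\<close> acts nilpotently on \<open>V\<close>, since \<open>[V, W]\<close> lies in \<open>V \<inter> W\<close>;
  hence it acts nilpotently on the lower central factors of \<open>V\<close>, and \<open>V\<close> and \<open>W\<close> together
  act nilpotently on \<open>V\<close>.\<close>

theorem nilp_sprod:
  assumes "nilp V" "nilp W" "V \<subseteq> nrm W" "W \<subseteq> nrm V"
  shows "nilp (sprod V W)"
proof -
  have one: "nilact (B \<union> A) A {1}" if A: "nilp A" and B: "nilp B" and n: "A \<subseteq> nrm B" "B \<subseteq> nrm A" for A B :: "'a set"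
  proof (rule nilact_of_lc_sections[OF A])
    fix i
    have s: "subgp A" "subgp B" using A B by (simp_all add: nilp_def)
    have BAB: "B \<subseteq> nrm (A \<inter> B)" using n subgp_sub_nrm[OF s(2)] nrm_Int by blast
    have "step B A (A \<inter> B)"
      by (rule stepI) (use s n BAB comm_in_left[OF s(1)] comm_in_right[OF s(2)] in \<open>auto intro: subgp_Int\<close>)
    moreover have "nilact B (A \<inter> B) {1}"
    proof (rule nilact_section)
      show "nilact B B {1}" using B s nilp_iff_nilact by blast
    qed (use s BAB in \<open>auto simp: subgp_Int subgp_trivial subgp_one nrm_trivial\<close>)
    ultimately have BA: "nilact B A {1}" by (rule converse_rtranclp_into_rtranclp)
    show "nilact B (lc A i) (lc A (Suc i))"
      by (rule nilact_section[OF BA])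
        (simp_all add: s n lc_Suc_subset lc_subset sub_nrm_lc lc_nrm_lc subgp_lc subgp_one[OF subgp_lc[OF s(1)]]
         del: lc.simps)
  qed
  have s: "subgp V" "subgp W" using assms by (simp_all add: nilp_def)
  have VW: "sprod V W = gen (V \<union> W)" "sprod W V = gen (V \<union> W)"
    using gen_union_sprod[OF s(1,2) assms(3)] gen_union_sprod[OF s(2,1) assms(4)] by (simp_all add: Un_commute)
  have "nilact (V \<union> W) (sprod W V) (sprod {1} V)"
    using one[of W V] assms s subgp_sub_nrm[OF s(1)] by (intro nilact_sprod) auto
  also have "sprod {1} V = V" by (auto simp: sprod_def)
  also have "nilact (V \<union> W) V {1}" using one[of V W] assms by (simp add: Un_commute)
  finally have "nilact (V \<union> W) (gen (V \<union> W)) {1}" unfolding VW .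
  then have "nilp (gen (V \<union> W))"
    using nilp_iff_nilact[OF subgp_gen] nilact_gen by blast
  then show ?thesis by (simp add: VW)
qed

section \<open>Abelian sections of prime exponent\<close>

text \<open>Every orbit length divides the order of the group, so it is 1 or a multiple of \<open>p\<close>; as \<open>p\<close> divides
  \<open>card X\<close>, the orbit of \<open>x0\<close> cannot be the only one of length 1.\<close>

lemma prime_orbits_fixed_point:
  assumes act: "group_action A X \<phi>" and fin: "finite X" and p: "prime p" "p dvd card X"
    and ord: "\<And>q. prime q \<Longrightarrow> q dvd order A \<Longrightarrow> q = p"
    and x0: "x0 \<in> X" "\<And>g. g \<in> carrier A \<Longrightarrow> \<phi> g x0 = x0"
  shows "\<exists>x\<in>X - {x0}. \<forall>g\<in>carrier A. \<phi> g x = x"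
proof (rule ccontr)
  assume none: "\<not> ?thesis"
  interpret group_action A X \<phi> by (rule act)
  let ?O = "orbits A X \<phi>"
  have part: "partition X ?O" by (rule orbit_partition)
  have orb0: "orbit A \<phi> x0 = {x0}"
    using x0 orbit_refl[OF x0(1)] by (auto simp: orbit_def)
  have finO: "finite ?O" using fin by (simp add: orbits_def)
  have mult: "p dvd card D" if D: "D \<in> ?O - {{x0}}" for D
  proof -
    obtain x where x: "x \<in> X" "D = orbit A \<phi> x" using D unfolding orbits_def by blast
    have xD: "x \<in> D" using orbit_refl x by auto
    have DX: "D \<subseteq> X" using partition.incl[OF part] D by blast
    then have finD: "finite D" using fin finite_subset by blast
    have "x \<noteq> x0" using D x orb0 by auto
    then obtain g where g: "g \<in> carrier A" "\<phi> g x \<noteq> x" using none x by blast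
    then have "\<phi> g x \<in> D" using x by (auto simp: orbit_def)
    then have "card D \<noteq> 1" using g xD by (metis card_1_singletonE singletonD)
    then obtain q where q: "prime q" "q dvd card D" using prime_factor_nat by blast
    then have "q dvd order A" using orbit_stabilizer_theorem[OF x(1)] x(2) by (metis dvd_mult2)
    then show ?thesis using ord q by blast
  qed
  have "card X = (\<Sum>x\<in>X. 1)" by simp
  also have "\<dots> = (\<Sum>D\<in>?O. \<Sum>x\<in>D. 1)" by (rule partition.disjoint_sum[OF part fin, symmetric])
  also have "\<dots> = (\<Sum>D\<in>?O. card D)" by simp
  also have "\<dots> = card {x0} + (\<Sum>D\<in>?O - {{x0}}. card D)"
    using finO x0 orb0 by (intro sum.remove) (auto simp: orbits_def)
  finally have "card X = 1 + (\<Sum>D\<in>?O - {{x0}}. card D)" by simp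
  moreover have "p dvd (\<Sum>D\<in>?O - {{x0}}. card D)" using mult by (rule dvd_sum)
  ultimately have "p dvd 1" using p(2) by (metis dvd_add_left_iff)
  then show False using p(1) by simp
qed

definition lcos :: "'p::group_mult set \<Rightarrow> 'p \<Rightarrow> 'p set" where
  "lcos L k = (\<lambda>l. k * l) ` L"

lemma lcos_eq_iff:
  assumes "subgp L" shows "lcos L a = lcos L b \<longleftrightarrow> inverse a * b \<in> L"
proof
  assume "lcos L a = lcos L b"
  moreover have "b \<in> lcos L b" using subgp_one[OF assms] by (force simp: lcos_def)
  ultimately obtain l where "l \<in> L" "b = a * l" by (auto simp: lcos_def)
  then show "inverse a * b \<in> L" by (simp add: gm_simps)
next
  assume ab: "inverse a * b \<in> L"
  show "lcos L a = lcos L b"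
  proof (intro subset_antisym subsetI)
    fix y assume "y \<in> lcos L a"
    then obtain l where "l \<in> L" "y = a * l" by (auto simp: lcos_def)
    then have "y = b * (inverse (inverse a * b) * l)" by (simp add: gm_simps)
    moreover have "inverse (inverse a * b) * l \<in> L"
      using \<open>l \<in> L\<close> ab by (rule subgp_mult[OF assms subgp_inv[OF assms], rotated])
    ultimately show "y \<in> lcos L b" unfolding lcos_def by blast
  next
    fix y assume "y \<in> lcos L b"
    then obtain l where "l \<in> L" "y = b * l" by (auto simp: lcos_def)
    then have "y = a * ((inverse a * b) * l)" "(inverse a * b) * l \<in> L"
      using subgp_mult[OF assms ab] by (simp_all add: gm_simps)
    then show "y \<in> lcos L a" by (auto simp: lcos_def)
  qed
qed

text \<open>The sections below are abelian: \<open>comm a b \<in> L\<close> for all \<open>a\<close>, \<open>b\<close> in \<open>K\<close>. Then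
  raising to a power is a homomorphism modulo \<open>L\<close>.\<close>

lemma abelian_section_nrm:
  assumes "subgp K" "\<And>a b. a \<in> K \<Longrightarrow> b \<in> K \<Longrightarrow> comm a b \<in> L" "subgp M" "L \<subseteq> M" "M \<subseteq> K"
  shows "K \<subseteq> nrm M"
proof -
  have "K \<subseteq> sec_cent K M" using assms by (intro sec_centI) (auto intro: subgp_inv)
  then show ?thesis by (auto simp: sec_cent_def)
qed

lemma abelian_section_power_mult:
  assumes K: "subgp K" "subgp L" "L \<subseteq> K" "\<And>a b. a \<in> K \<Longrightarrow> b \<in> K \<Longrightarrow> comm a b \<in> L"
    and "a \<in> K" "b \<in> K"
  obtains l where "l \<in> L" "(a * b) ^ n = a ^ n * b ^ n * l"
proof -
  have KL: "K \<subseteq> nrm L" using abelian_section_nrm[OF K(1,4,2) _ K(3)] by simp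
  have "\<exists>l\<in>L. (a * b) ^ n = a ^ n * b ^ n * l"
  proof (induction n)
    case (Suc n)
    then obtain l where l: "l \<in> L" "(a * b) ^ n = a ^ n * b ^ n * l" by blast
    define c where "c = comm b (inverse (a ^ n))"
    have pw: "b ^ n \<in> K" "a ^ n \<in> K" using K(1) assms(5,6) by (auto intro: subgp_power)
    have c: "c \<in> L" unfolding c_def using K(1) pw assms(6) by (intro K(4) subgp_inv)
    have "b * a ^ n = a ^ n * b * c" by (simp add: c_def comm_def gm_simps)
    then have "(a * b) ^ Suc n = a * (a ^ n * b * c) * b ^ n * l"
      using l(2) by (simp add: mult.assoc) (metis mult.assoc)
    also have "\<dots> = a ^ Suc n * b ^ Suc n * ((inverse (b ^ n) * c * b ^ n) * l)"
      by (simp add: gm_simps)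
    finally have "(a * b) ^ Suc n = a ^ Suc n * b ^ Suc n * ((inverse (b ^ n) * c * b ^ n) * l)" .
    moreover have "(inverse (b ^ n) * c * b ^ n) * l \<in> L"
      using KL pw c l(1) by (intro subgp_mult[OF K(2)] nrmD_inv) auto
    ultimately show ?case by blast
  qed (auto intro: subgp_one[OF K(2)] bexI[of _ 1])
  then show ?thesis using that by blast
qed

lemma subgp_power_preimage:
  assumes K: "subgp K" "subgp L" "L \<subseteq> K" "\<And>a b. a \<in> K \<Longrightarrow> b \<in> K \<Longrightarrow> comm a b \<in> L"
    and M: "subgp M" "L \<subseteq> M"
  shows "subgp {k \<in> K. k ^ n \<in> M}"
proof (rule subgpI; clarsimp)
  show "1 \<in> K \<and> 1 \<in> M" using K M by (simp add: subgp_one)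
  show "a * b \<in> K \<and> (a * b) ^ n \<in> M" if ab: "a \<in> K" "a ^ n \<in> M" "b \<in> K" "b ^ n \<in> M" for a b
  proof -
    obtain l where "l \<in> L" "(a * b) ^ n = a ^ n * b ^ n * l"
      using abelian_section_power_mult[OF K ab(1,3)] .
    then show ?thesis using ab M K(1) by (auto intro!: subgp_mult)
  qed
  show "inverse a \<in> K \<and> inverse a ^ n \<in> M" if "a \<in> K" "a ^ n \<in> M" for a
    using that K(1) M(1) by (simp add: subgp_inv flip: gm_inverse_power)
qed

lemma nrm_power_preimage:
  assumes "x \<in> nrm K" "x \<in> nrm M" shows "x \<in> nrm {k \<in> K. k ^ n \<in> M}"
proof (rule nrmI; clarsimp)
  fix k assume k: "k \<in> K" "k ^ n \<in> M"
  show "x * k * inverse x \<in> K \<and> (x * k * inverse x) ^ n \<in> M"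
    using k assms by (simp add: gm_conj_power nrmD)
  show "inverse x * k * x \<in> K \<and> (inverse x * k * x) ^ n \<in> M"
    using k assms gm_conj_power[of "inverse x" k n] by (simp add: gm_inverse_inverse nrmD_inv)
qed

lemma coprime_powers_in_subgp:
  assumes "subgp M" "y ^ m \<in> M" "y ^ n \<in> M" "coprime m n"
  shows "y \<in> M"
proof (cases "m = 0")
  case True then show ?thesis using assms by simp
next
  case False
  then obtain a b where ab: "m * a = n * b + 1"
    using bezout_nat[of m n] assms(4) by auto
  have "(y ^ n) ^ b * y = (y ^ m) ^ a"
    by (simp add: ab flip: power_mult power_add power_Suc2)
  moreover have "(y ^ m) ^ a \<in> M" "(y ^ n) ^ b \<in> M" using assms by (auto intro: subgp_power)
  ultimately show ?thesis using subgp_mult_left_iff[OF assms(1)] by metis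
qed

text \<open>Adjoining one element to \<open>C\<close> multiplies the number of cosets of \<open>L\<close> by \<open>p\<close>.\<close>

lemma prime_exponent_section_card:
  assumes K: "subgp K" "subgp L" "L \<subseteq> K" "\<And>a b. a \<in> K \<Longrightarrow> b \<in> K \<Longrightarrow> comm a b \<in> L"
    and p: "prime (p::nat)" "\<And>k. k \<in> K \<Longrightarrow> k ^ p \<in> L" and "max_cond K"
  shows "finite (lcos L ` K)" "K \<noteq> L \<Longrightarrow> p dvd card (lcos L ` K)"
proof -
  define P where "P C \<longleftrightarrow> finite (lcos L ` C) \<and> (C \<noteq> L \<longrightarrow> p dvd card (lcos L ` C))" for C
  have "P K"
  proof (rule max_cond_induct[OF \<open>max_cond K\<close> K(1-3)])
    have "lcos L a = lcos L 1" if "a \<in> L" for a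
      using that by (simp add: lcos_eq_iff[OF K(2)] subgp_inv[OF K(2)])
    then have "lcos L ` L \<subseteq> {lcos L 1}" by blast
    then show "P L" by (auto simp: P_def intro: finite_subset)
  next
    fix C t assume C: "subgp C" "L \<subseteq> C" "C \<subseteq> K" "P C" and t: "t \<in> K" "t \<notin> C"
    have KC: "K \<subseteq> nrm C" by (rule abelian_section_nrm[OF K(1,4) C(1-3)])
    have p0: "p > 0" using p(1) prime_gt_0_nat by blast
    have tp: "t ^ p \<in> C" using p(2)[OF t(1)] C(2) by blast
    have red: "\<exists>i c'. i < p \<and> c' \<in> C \<and> t ^ j * c = t ^ i * c'" if "c \<in> C" for j c
    proof -
      have "t ^ j = t ^ (j mod p) * (t ^ p) ^ (j div p)"
        by (simp flip: power_mult power_add)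
      then have "t ^ j * c = t ^ (j mod p) * ((t ^ p) ^ (j div p) * c)"
        by (simp only: mult.assoc)
      moreover have "(t ^ p) ^ (j div p) * c \<in> C"
        using subgp_power[OF C(1) tp] that by (intro subgp_mult[OF C(1)])
      ultimately show ?thesis using p0 mod_less_divisor by blast
    qed
    have elem: "\<exists>i c. i < p \<and> c \<in> C \<and> y = t ^ i * c" if y: "y \<in> gen (insert t C)" for y
    proof -
      have "t \<in> nrm C" using KC t(1) by blast
      from gen_insert_nrm[OF C(1) this y] obtain z c where z: "z \<in> gen {t}" "c \<in> C" "y = z * c" .
      from gen_singleton_powers[OF z(1)] obtain n where "z = t ^ n \<or> z = inverse t ^ n" by blast
      then show ?thesis
      proof
        assume "z = t ^ n" then show ?thesis using red z by blast
      next
        assume n: "z = inverse t ^ n"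
        have "p * n = n + (p - 1) * n" using p0 by (cases p) auto
        then have e: "inverse ((t ^ p) ^ n) = inverse (t ^ ((p - 1) * n)) * inverse (t ^ n)"
          by (simp add: power_add gm_inverse_mult flip: power_mult)
        have "z = t ^ ((p - 1) * n) * inverse ((t ^ p) ^ n)"
          unfolding n e gm_right_cancel by (rule gm_inverse_power[symmetric])
        then have "y = t ^ ((p - 1) * n) * (inverse ((t ^ p) ^ n) * c)"
          using z(3) by (simp add: mult.assoc)
        moreover have "inverse ((t ^ p) ^ n) * c \<in> C"
          using subgp_power[OF C(1) tp] z(2) by (intro subgp_mult[OF C(1)] subgp_inv[OF C(1)])
        ultimately show ?thesis using red by metis
      qed
    qed
    have tG: "t ^ i * c \<in> gen (insert t C)" if "c \<in> C" for i c
      using that by (intro subgp_mult subgp_power subgp_gen gen_mem) auto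
    define f where "f = (\<lambda>(j, E). (\<lambda>d. t ^ j * d) ` E)"
    have f: "f (j, lcos L c) = lcos L (t ^ j * c)" for j c
      by (auto simp: f_def lcos_def image_image mult.assoc)
    have inj1: "i = j \<and> lcos L c = lcos L c'"
      if ij: "i \<le> j" "j < p" "c \<in> C" "c' \<in> C" "lcos L (t ^ i * c) = lcos L (t ^ j * c')" for i j c c'
    proof -
      obtain d where d: "j = i + d" using ij(1) le_Suc_ex by blast
      have L: "inverse c * (t ^ d * c') \<in> L"
        using ij(5) by (simp add: lcos_eq_iff[OF K(2)] d power_add gm_simps)
      then have "inverse c * (t ^ d * c') \<in> C" using C(2) by blast
      then have td: "t ^ d \<in> C"
        using ij(3,4) C(1) by (simp add: subgp_mult_left_iff subgp_mult_right_iff subgp_inv)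
      have "d = 0"
      proof (rule ccontr)
        assume "d \<noteq> 0"
        then have "\<not> p dvd d" using ij(2) d by (auto dest: dvd_imp_le)
        then have "coprime d p"
          using prime_imp_coprime[OF p(1), of d] by (simp add: coprime_commute)
        then show False using coprime_powers_in_subgp[OF C(1) td tp] t(2) by blast
      qed
      then show ?thesis using L d by (simp add: lcos_eq_iff[OF K(2)])
    qed
    have "inj_on f ({..<p} \<times> lcos L ` C)"
    proof (rule inj_onI; clarsimp simp: f)
      fix i j c c' assume *: "i < p" "j < p" "c \<in> C" "c' \<in> C" "lcos L (t ^ i * c) = lcos L (t ^ j * c')"
      show "i = j \<and> lcos L c = lcos L c'"
        using inj1[of i j c c'] inj1[of j i c' c] * by (metis nat_le_linear)
    qed
    moreover have "f ` ({..<p} \<times> lcos L ` C) = lcos L ` gen (insert t C)"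
    proof (intro subset_antisym subsetI)
      fix y assume "y \<in> f ` ({..<p} \<times> lcos L ` C)"
      then show "y \<in> lcos L ` gen (insert t C)" using tG by (auto simp: f)
    next
      fix y assume "y \<in> lcos L ` gen (insert t C)"
      then obtain i c where *: "i < p" "c \<in> C" "y = lcos L (t ^ i * c)" using elem by blast
      then have "y = f (i, lcos L c)" by (simp add: f)
      then show "y \<in> f ` ({..<p} \<times> lcos L ` C)" using * by blast
    qed
    ultimately have b: "bij_betw f ({..<p} \<times> lcos L ` C) (lcos L ` gen (insert t C))"
      by (simp add: bij_betw_def)
    have "finite ({..<p} \<times> lcos L ` C)" using C(4) by (simp add: P_def)
    then show "P (gen (insert t C))"
      using bij_betw_finite[OF b] bij_betw_same_card[OF b, symmetric]
      by (simp add: P_def card_cartesian_product)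
  qed
  then show "finite (lcos L ` K)" "K \<noteq> L \<Longrightarrow> p dvd card (lcos L ` K)"
    by (auto simp: P_def)
qed

section \<open>Nil actions\<close>

definition nil_on :: "'p::group_mult \<Rightarrow> 'p set \<Rightarrow> bool" where
  "nil_on x K \<longleftrightarrow> (\<forall>k\<in>K. \<exists>n. ((\<lambda>a. comm a x) ^^ n) k = 1)"

lemma nil_on_subset: "nil_on x K \<Longrightarrow> L \<subseteq> K \<Longrightarrow> nil_on x L"
  unfolding nil_on_def by blast

lemma funpow_comm_in: "subgp K \<Longrightarrow> x \<in> nrm K \<Longrightarrow> k \<in> K \<Longrightarrow> ((\<lambda>a. comm a x) ^^ n) k \<in> K"
  by (induction n) (auto intro: comm_in_left)

text \<open>The iterated commutators of \<open>k\<close> with \<open>x\<close> reach 1, hence \<open>L\<close>; the one just before the first in \<open>L\<close>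
  is a fixed point of \<open>x\<close> modulo \<open>L\<close>.\<close>

lemma nil_on_last:
  assumes "nil_on x K" "subgp L" "k \<in> K" "k \<notin> L"
  obtains n where "((\<lambda>a. comm a x) ^^ n) k \<notin> L" "((\<lambda>a. comm a x) ^^ Suc n) k \<in> L"
proof -
  let ?c = "\<lambda>n. ((\<lambda>a. comm a x) ^^ n) k"
  obtain m where "?c m = 1" using assms(1,3) by (auto simp: nil_on_def)
  then have m: "?c m \<in> L" using subgp_one[OF assms(2)] by simp
  define j where "j = (LEAST n. ?c n \<in> L)"
  have j: "?c j \<in> L" unfolding j_def by (rule LeastI[of "\<lambda>n. ?c n \<in> L", OF m])
  have "j \<noteq> 0" using j assms(4) by (metis funpow_0)
  then obtain i where i: "j = Suc i" using not0_implies_Suc by blast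
  then have "?c i \<notin> L" using not_less_Least[of i "\<lambda>n. ?c n \<in> L"] unfolding j_def by (metis lessI)
  then show ?thesis using j i that by blast
qed

lemma nil_on_fixed_point:
  assumes "nil_on x K" "subgp K" "x \<in> nrm K" "subgp L" "L \<subset> K"
  shows "\<exists>k\<in>K - L. comm k x \<in> L"
proof -
  obtain k where k: "k \<in> K" "k \<notin> L" using assms by blast
  obtain n where "((\<lambda>a. comm a x) ^^ n) k \<notin> L" "((\<lambda>a. comm a x) ^^ Suc n) k \<in> L"
    using nil_on_last[OF assms(1,4) k] .
  then show ?thesis using funpow_comm_in[OF assms(2,3) k(1), of n] by auto
qed

text \<open>Modulo \<open>L\<close>, \<open>k\<close> conjugated by \<open>y ^ m\<close> is \<open>k * c ^ m\<close> if \<open>c = comm k y\<close> is fixed by \<open>y\<close>. Hence \<open>y ^ m\<close>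
  acting trivially forces \<open>c ^ m \<in> L\<close>, and \<open>c \<in> L\<close> if \<open>m\<close> is prime to the exponent.\<close>

lemma nil_on_coprime_power_trivial:
  assumes K: "subgp K" "subgp L" "L \<subseteq> K"
    and y: "nil_on y K" "y \<in> nrm K" "y \<in> nrm L"
    and KL: "K \<subseteq> nrm L"
    and p: "\<And>k. k \<in> K \<Longrightarrow> k ^ p \<in> L" "coprime m p"
    and triv: "\<And>k. k \<in> K \<Longrightarrow> comm k (y ^ m) \<in> L"
    and k: "k \<in> K"
  shows "comm k y \<in> L"
proof (rule ccontr)
  assume "comm k y \<notin> L"
  moreover have "comm k y \<in> K" using comm_in_left[OF K(1) k y(2)] .
  ultimately obtain n where n: "((\<lambda>a. comm a y) ^^ n) (comm k y) \<notin> L"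
    "((\<lambda>a. comm a y) ^^ Suc n) (comm k y) \<in> L"
    using nil_on_last[OF y(1) K(2)] by blast
  define b where "b = ((\<lambda>a. comm a y) ^^ n) k"
  define c where "c = comm b y"
  have b: "b \<in> K" unfolding b_def using funpow_comm_in[OF K(1) y(2) k] .
  have c: "c \<in> K" unfolding c_def using comm_in_left[OF K(1) b y(2)] .
  have cb: "((\<lambda>a. comm a y) ^^ n) (comm k y) = c" using funpow_swap1[of "\<lambda>a. comm a y" n k] by (simp add: c_def b_def)
  have cL: "c \<notin> L" "comm c y \<in> L" using n unfolding funpow.simps o_def cb by auto
  have ex: "\<exists>l\<in>L. comm b (y ^ j) = c ^ j * l" for j
  proof (induction j)
    case 0 then show ?case using subgp_one[OF K(2)] by (auto simp: comm_one intro: bexI[of _ 1])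
  next
    case (Suc j)
    then obtain l where l: "l \<in> L" "comm b (y ^ j) = c ^ j * l" by blast
    have "y * c * inverse y = c * comm c y" by (rule conj_eq_comm)
    have pw: "\<exists>l\<in>L. y * c ^ j * inverse y = c ^ j * l"
    proof -
      have "\<exists>l\<in>L. (c * comm c y) ^ i = c ^ i * l" for i
      proof (induction i)
        case 0 then show ?case using subgp_one[OF K(2)] by (auto intro: bexI[of _ 1])
      next
        case (Suc i)
        then obtain l where l: "l \<in> L" "(c * comm c y) ^ i = c ^ i * l" by blast
        have "(c * comm c y) ^ Suc i = c ^ Suc i * ((inverse (c ^ i) * comm c y * c ^ i) * l)"
          using l by (simp add: gm_simps)
        moreover have "(inverse (c ^ i) * comm c y * c ^ i) * l \<in> L"
          using l KL c K cL by (intro subgp_mult[OF K(2)] nrmD_inv) (auto intro: subgp_power)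
        ultimately show ?case by blast
      qed
      moreover have "y * c ^ j * inverse y = (c * comm c y) ^ j"
        by (simp only: gm_conj_power[symmetric] conj_eq_comm[of y c])
      ultimately show ?thesis by simp
    qed
    then obtain l' where l': "l' \<in> L" "y * c ^ j * inverse y = c ^ j * l'" by blast
    have "comm b (y ^ Suc j) = c * (y * (c ^ j * l) * inverse y)"
      by (simp add: comm_mult_right c_def l(2))
    also have "\<dots> = c * ((y * c ^ j * inverse y) * (y * l * inverse y))" by (simp add: gm_simps)
    also have "\<dots> = c ^ Suc j * (l' * (y * l * inverse y))" unfolding l'(2) by (simp add: mult.assoc)
    finally show ?case using l l' nrmD[OF y(3) l(1)] subgp_mult[OF K(2)] by blast
  qed
  then obtain l where "l \<in> L" "comm b (y ^ m) = c ^ m * l" by blast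
  then have "c ^ m \<in> L" using triv[OF b] by (simp add: subgp_mult_right_iff[OF K(2)])
  then show False using coprime_powers_in_subgp[OF K(2) _ p(1)[OF c] p(2)] cL by blast
qed

section \<open>Fixed points on sections of prime exponent\<close>

definition coset_conj :: "'p::group_mult set \<Rightarrow> 'p set \<Rightarrow> 'p \<Rightarrow> 'p set \<Rightarrow> 'p set" where
  "coset_conj K L h = (\<lambda>D\<in>lcos L ` K. (\<lambda>d. h * d * inverse h) ` D)"

lemma coset_conj_lcos:
  assumes "k \<in> K" "h \<in> nrm L"
  shows "coset_conj K L h (lcos L k) = lcos L (h * k * inverse h)"
proof -
  have "(\<lambda>d. h * d * inverse h) ` lcos L k = lcos L (h * k * inverse h)"
  proof (intro subset_antisym subsetI)
    fix y assume "y \<in> (\<lambda>d. h * d * inverse h) ` lcos L k"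
    then obtain l where l: "l \<in> L" "y = h * (k * l) * inverse h" by (auto simp: lcos_def)
    then have "y = (h * k * inverse h) * (h * l * inverse h)" by (simp add: gm_simps)
    then show "y \<in> lcos L (h * k * inverse h)" using nrmD[OF assms(2) l(1)] by (auto simp: lcos_def)
  next
    fix y assume "y \<in> lcos L (h * k * inverse h)"
    then obtain l where l: "l \<in> L" "y = h * k * inverse h * l" by (auto simp: lcos_def)
    then have "y = h * (k * (inverse h * l * h)) * inverse h" by (simp add: gm_simps)
    moreover have "k * (inverse h * l * h) \<in> lcos L k"
      using nrmD_inv[OF assms(2) l(1)] by (auto simp: lcos_def)
    ultimately show "y \<in> (\<lambda>d. h * d * inverse h) ` lcos L k" by blast
  qed
  then show ?thesis using assms(1) by (simp add: coset_conj_def)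
qed

lemma group_of_subgp:
  assumes "subgp H" shows "group \<lparr>carrier = H, monoid.mult = (*), one = 1\<rparr>"
proof (rule groupI; simp)
  show "\<exists>y\<in>H. y * x = 1" if "x \<in> H" for x
    using that subgp_inv[OF assms] gm_left_inverse by blast
qed (auto simp: assms subgp_one subgp_mult mult.assoc)

lemma pow_of_subgp:
  "(x::'p::group_mult) [^]\<^bsub>\<lparr>carrier = H, monoid.mult = (*), one = 1\<rparr>\<^esub> (n::nat) = x ^ n"
  by (induction n) (simp_all add: nat_pow_def power_commutes)

lemma coset_conj_hom:
  assumes H: "subgp H" "H \<subseteq> nrm K" "H \<subseteq> nrm L"
  shows "group_hom \<lparr>carrier = H, monoid.mult = (*), one = 1\<rparr> (BijGroup (lcos L ` K)) (coset_conj K L)"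
proof -
  let ?X = "lcos L ` K"
  have val: "coset_conj K L h (lcos L k) = lcos L (h * k * inverse h)" "h * k * inverse h \<in> K"
    if "h \<in> H" "k \<in> K" for h k
    using coset_conj_lcos[of k K h L] nrmD[of h K k] H that by auto
  have comp: "coset_conj K L (g * h) = compose ?X (coset_conj K L g) (coset_conj K L h)"
    if "g \<in> H" "h \<in> H" for g h
  proof
    fix D
    show "coset_conj K L (g * h) D = compose ?X (coset_conj K L g) (coset_conj K L h) D"
    proof (cases "D \<in> ?X")
      case True
      then obtain k where "k \<in> K" "D = lcos L k" by blast
      then show ?thesis
        using that val subgp_mult[OF H(1)] by (simp add: compose_def gm_simps)
    qed (simp add: coset_conj_def compose_def)
  qed
  have one: "coset_conj K L 1 D = D" if "D \<in> ?X" for D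
    using that by (simp add: coset_conj_def gm_simps)
  have bij: "coset_conj K L h \<in> Bij ?X" if "h \<in> H" for h
  proof -
    have to: "coset_conj K L g \<in> ?X \<rightarrow> ?X" if "g \<in> H" for g using val that by auto
    have inv: "coset_conj K L g' (coset_conj K L g D) = D" if "g \<in> H" "g' \<in> H" "g' * g = 1" "D \<in> ?X" for g g' D
      using comp[OF that(2,1)] one[OF that(4)] that by (simp add: compose_def fun_eq_iff)
    have ih: "inverse h \<in> H" using subgp_inv[OF H(1) that] .
    have "bij_betw (coset_conj K L h) ?X ?X"
      by (rule bij_betwI[OF to[OF that] to[OF ih]])
        (use inv that ih in \<open>simp_all add: gm_simps\<close>)
    moreover have "coset_conj K L h \<in> extensional ?X" by (simp add: coset_conj_def)
    ultimately show ?thesis by (simp add: Bij_def)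
  qed
  show ?thesis
  proof (rule group_hom.intro[OF group_of_subgp[OF H(1)] group_BijGroup])
    show "group_hom_axioms \<lparr>carrier = H, monoid.mult = (*), one = 1\<rparr> (BijGroup ?X) (coset_conj K L)"
      by (rule group_hom_axioms.intro) (auto simp: hom_def BijGroup_def bij comp)
  qed
qed

text \<open>The group \<open>H\<close> permutes the cosets of \<open>L\<close> in \<open>K\<close>, a finite set whose size is a multiple of \<open>p\<close>. By Sylow's
  theorem a prime \<open>q \<noteq> p\<close> dividing the order of the image of \<open>H\<close> would give an element of \<open>H\<close> that has order \<open>q\<close>
  as a permutation, which \<open>nil_on_coprime_power_trivial\<close> excludes. So a second coset is fixed besides \<open>L\<close>.\<close>

lemma nil_group_fixed_point_prime_exponent:
  assumes K: "subgp K" "subgp L" "L \<subset> K" "\<And>a b. a \<in> K \<Longrightarrow> b \<in> K \<Longrightarrow> comm a b \<in> L"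
    and p: "prime (p::nat)" "\<And>k. k \<in> K \<Longrightarrow> k ^ p \<in> L" and mx: "max_cond K"
    and H: "subgp H" "H \<subseteq> nrm K" "H \<subseteq> nrm L" "\<And>h. h \<in> H \<Longrightarrow> nil_on h K"
  shows "\<exists>k\<in>K - L. \<forall>h\<in>H. comm k h \<in> L"
proof -
  let ?X = "lcos L ` K"
  let ?act = "coset_conj K L"
  let ?R = "\<lparr>carrier = H, monoid.mult = (*), one = 1\<rparr>"
  let ?A = "(BijGroup ?X)\<lparr>carrier := ?act ` H\<rparr>"
  \<comment> \<open>\<open>H\<close> may be infinite; its image \<open>?A\<close> in the permutations of the cosets is finite.\<close>
  have LK: "L \<subseteq> K" using K(3) by blast
  have KL: "K \<subseteq> nrm L" using abelian_section_nrm[OF K(1,4,2) _ LK] by simp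
  interpret hom: group_hom ?R "BijGroup ?X" ?act by (rule coset_conj_hom[OF H(1-3)])
  have sub: "subgroup (?act ` H) (BijGroup ?X)" using hom.img_is_subgroup by simp
  have A: "group ?A" by (rule subgroup.subgroup_is_group[OF sub group_BijGroup])
  have fX: "finite ?X" "p dvd card ?X"
    using prime_exponent_section_card[OF K(1,2) LK K(4) p mx] K(3) by auto
  have "Bij ?X \<subseteq> ?X \<rightarrow>\<^sub>E ?X"
    using Bij_imp_funcset[of _ ?X] Bij_imp_extensional[of _ ?X] unfolding PiE_def by blast
  then have "?act ` H \<subseteq> ?X \<rightarrow>\<^sub>E ?X"
    using subgroup.subset[OF sub] by (simp add: BijGroup_def)
  then have fA: "finite (carrier ?A)" using fX finite_PiE[OF fX(1), of "\<lambda>_. ?X"] by (auto intro: finite_subset)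
  have fixed_iff: "?act h (lcos L k) = lcos L k \<longleftrightarrow> comm k h \<in> L" if "h \<in> H" "k \<in> K" for h k
  proof -
    have "?act h (lcos L k) = lcos L (h * k * inverse h)"
      using coset_conj_lcos[of k K h L] that H by auto
    then have "?act h (lcos L k) = lcos L k \<longleftrightarrow> lcos L k = lcos L (h * k * inverse h)" by auto
    then show ?thesis by (simp add: lcos_eq_iff[OF K(2)] comm_def mult.assoc)
  qed
  have ord: "q = p" if q: "prime q" "q dvd order ?A" for q
  proof (rule ccontr)
    assume "q \<noteq> p"
    then have cop: "coprime q p" using q(1) p(1) primes_coprime by blast
    obtain m where "order ?A = q ^ 1 * m" using q(2) by auto
    from sylow_thm[OF q(1) A this fA] obtain P where P: "subgroup P ?A" "card P = q" by auto
    have "P \<noteq> {\<one>\<^bsub>?A\<^esub>}" using P(2) q(1) by auto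
    moreover have "\<one>\<^bsub>?A\<^esub> \<in> P" by (rule subgroup.one_closed[OF P(1)])
    ultimately obtain y where y: "y \<in> P" "y \<noteq> \<one>\<^bsub>?A\<^esub>" by blast
    then obtain h where h: "h \<in> H" "y = ?act h" using subgroup.subset[OF P(1)] by auto
    have gP: "group (?A\<lparr>carrier := P\<rparr>)" by (rule subgroup.subgroup_is_group[OF P(1) A])
    have "y [^]\<^bsub>?A\<lparr>carrier := P\<rparr>\<^esub> order (?A\<lparr>carrier := P\<rparr>) = \<one>\<^bsub>?A\<lparr>carrier := P\<rparr>\<^esub>"
      using group.pow_order_eq_1[OF gP] y(1) by simp
    then have "y [^]\<^bsub>BijGroup ?X\<^esub> q = \<one>\<^bsub>BijGroup ?X\<^esub>"
      by (simp add: order_def P(2) nat_pow_def)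
    then have "?act (h ^ q) = \<one>\<^bsub>BijGroup ?X\<^esub>"
      using hom.hom_nat_pow[of h q] h by (simp add: pow_of_subgp)
    then have "?act (h ^ q) (lcos L k) = lcos L k" if "k \<in> K" for k
      using that by (simp add: BijGroup_def)
    then have "comm k (h ^ q) \<in> L" if "k \<in> K" for k
      using fixed_iff[OF subgp_power[OF H(1) h(1)] that] that by blast
    then have triv: "comm k h \<in> L" if "k \<in> K" for k
      using nil_on_coprime_power_trivial[OF K(1,2) LK H(4)[OF h(1)] _ _ KL p(2) cop _ that] H h(1)
      by blast
    have "y = (\<lambda>D\<in>?X. D)"
    proof
      fix D show "y D = (\<lambda>D\<in>?X. D) D"
      proof (cases "D \<in> ?X")
        case True
        then show ?thesis using fixed_iff[OF h(1)] triv h(2) by auto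
      qed (simp add: h(2) coset_conj_def)
    qed
    then show False using y(2) by (simp add: BijGroup_def)
  qed
  have act: "group_action ?A ?X (\<lambda>f. f)"
  proof (rule group_action.intro, rule group_hom.intro[OF A group_BijGroup], rule group_hom_axioms.intro)
    show "(\<lambda>f. f) \<in> hom ?A (BijGroup ?X)"
      using subgroup.subset[OF sub] by (auto simp: hom_def)
  qed
  have x0: "lcos L 1 \<in> ?X" using subgp_one[OF K(1)] by blast
  have "\<exists>D\<in>?X - {lcos L 1}. \<forall>f\<in>carrier ?A. f D = D"
  proof (rule prime_orbits_fixed_point[OF act fX(1) p(1) fX(2) ord x0])
    show "f (lcos L 1) = lcos L 1" if "f \<in> carrier ?A" for f
      using that fixed_iff[OF _ subgp_one[OF K(1)]] subgp_one[OF K(2)] by (auto simp: comm_one)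
  qed
  then obtain D where D: "D \<in> ?X" "D \<noteq> lcos L 1" "\<And>h. h \<in> H \<Longrightarrow> ?act h D = D" by auto
  then obtain k where k: "k \<in> K" "D = lcos L k" by blast
  have "k \<notin> L" using D(2) k by (auto simp: lcos_eq_iff[OF K(2)] subgp_inv[OF K(2)])
  then show ?thesis using k D(3) fixed_iff[OF _ k(1)] by auto
qed

section \<open>Isolated subgroups of abelian sections\<close>

definition isolator :: "'p::group_mult set \<Rightarrow> 'p set \<Rightarrow> 'p set" where
  "isolator K D = {k \<in> K. \<exists>n>0. k ^ n \<in> D}"

lemma isolator_superset: "D \<subseteq> K \<Longrightarrow> D \<subseteq> isolator K D"
  by (auto simp: isolator_def intro!: exI[of _ 1])

lemma isolator_mono: "D \<subseteq> E \<Longrightarrow> isolator K D \<subseteq> isolator K E"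
  by (auto simp: isolator_def)

lemma isolator_power_closed:
  assumes "k \<in> K" "n > 0" "k ^ n \<in> isolator K D" shows "k \<in> isolator K D"
proof -
  obtain m where m: "m > 0" "(k ^ n) ^ m \<in> D" using assms(3) by (auto simp: isolator_def)
  then have "n * m > 0" "k ^ (n * m) \<in> D" using assms(2) by (simp_all add: power_mult)
  then show ?thesis using assms(1) unfolding isolator_def by blast
qed

lemma nrm_isolator:
  assumes "x \<in> nrm K" "x \<in> nrm D" shows "x \<in> nrm (isolator K D)"
proof (rule nrmI)
  fix k assume "k \<in> isolator K D"
  then obtain n where k: "k \<in> K" "n > 0" "k ^ n \<in> D" by (auto simp: isolator_def)
  have "k \<in> {k \<in> K. k ^ n \<in> D}" using k by simp
  from nrmD[OF nrm_power_preimage[OF assms] this] nrmD_inv[OF nrm_power_preimage[OF assms] this]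
  show "x * k * inverse x \<in> isolator K D" "inverse x * k * x \<in> isolator K D"
    using k(2) by (auto simp: isolator_def)
qed

context
  fixes K L :: "'p::group_mult set"
  assumes K: "subgp K" "subgp L" "L \<subseteq> K" "\<And>a b. a \<in> K \<Longrightarrow> b \<in> K \<Longrightarrow> comm a b \<in> L"
begin

lemma subgp_isolator:
  assumes "subgp D" "L \<subseteq> D"
  shows "subgp (isolator K D)"
proof -
  let ?C = "{{k \<in> K. k ^ n \<in> D} | n. n > 0}"
  have "isolator K D = \<Union>?C" by (auto simp: isolator_def)
  moreover have "subgp (\<Union>?C)"
  proof (rule subgp_directed_Union)
    show "subgp M" if "M \<in> ?C" for M using that subgp_power_preimage[OF K assms] by auto
    show "\<exists>M''\<in>?C. M \<subseteq> M'' \<and> M' \<subseteq> M''" if MM: "M \<in> ?C" "M' \<in> ?C" for M M'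
    proof -
      obtain m n where mn: "m > 0" "M = {k \<in> K. k ^ m \<in> D}" "n > 0" "M' = {k \<in> K. k ^ n \<in> D}"
        using MM by auto
      have "k ^ (m * n) \<in> D" if "k ^ m \<in> D \<or> k ^ n \<in> D" for k
        using that subgp_power[OF assms(1)] by (metis power_mult mult.commute)
      then have "M \<subseteq> {k \<in> K. k ^ (m * n) \<in> D}" "M' \<subseteq> {k \<in> K. k ^ (m * n) \<in> D}"
        using mn by auto
      moreover have "{k \<in> K. k ^ (m * n) \<in> D} \<in> ?C" using mn by (auto intro!: exI[of _ "m * n"])
      ultimately show ?thesis by blast
    qed
  qed (auto intro: exI[of _ 1])
  ultimately show ?thesis by simp
qed

text \<open>By the maximal condition the union of the subgroups \<open>{k \<in> K. k ^ n \<in> D}\<close> is one of them.\<close>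

lemma isolator_exponent:
  assumes "subgp D" "L \<subseteq> D" "max_cond K"
  shows "\<exists>m>0. \<forall>k\<in>isolator K D. k ^ m \<in> D"
proof -
  define C where "C = {{k \<in> K. k ^ n \<in> D} | n. n > 0}"
  have "\<exists>M\<in>C. \<forall>N\<in>C. M \<subseteq> N \<longrightarrow> N = M"
  proof (rule max_cond_maximal[OF assms(3)])
    show "subgp M \<and> M \<subseteq> K" if "M \<in> C" for M
      using that subgp_power_preimage[OF K assms(1,2)] by (auto simp: C_def)
  qed (auto simp: C_def intro: exI[of _ 1])
  then obtain m where m: "m > 0" and max: "\<And>N. N \<in> C \<Longrightarrow> {k \<in> K. k ^ m \<in> D} \<subseteq> N \<Longrightarrow> N = {k \<in> K. k ^ m \<in> D}"
    unfolding C_def by blast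
  have "k ^ m \<in> D" if k: "k \<in> isolator K D" for k
  proof -
    obtain n where n: "k \<in> K" "n > 0" "k ^ n \<in> D" using k by (auto simp: isolator_def)
    have "{k \<in> K. k ^ (m * n) \<in> D} \<in> C" using m n unfolding C_def by force
    moreover have "{k \<in> K. k ^ m \<in> D} \<subseteq> {k \<in> K. k ^ (m * n) \<in> D}"
      using subgp_power[OF assms(1)] by (auto simp: power_mult)
    ultimately have "{k \<in> K. k ^ (m * n) \<in> D} = {k \<in> K. k ^ m \<in> D}" by (rule max)
    moreover have "k ^ (m * n) \<in> D"
      using subgp_power[OF assms(1) n(3), of m] by (simp add: mult.commute flip: power_mult)
    ultimately show ?thesis using n(1) by blast
  qed
  then show ?thesis using m by blast
qed

lemma subgp_power_image: "subgp {y ^ n * l | y l. y \<in> K \<and> l \<in> L}"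
proof -
  have KL: "K \<subseteq> nrm L" using abelian_section_nrm[OF K(1,4,2) _ K(3)] by simp
  show ?thesis
  proof (rule subgpI)
    have "1 = 1 ^ n * (1::'p)" by simp
    then show "1 \<in> {y ^ n * l | y l. y \<in> K \<and> l \<in> L}"
      using subgp_one[OF K(1)] subgp_one[OF K(2)] by blast
  next
    fix a b assume "a \<in> {y ^ n * l | y l. y \<in> K \<and> l \<in> L}" "b \<in> {y ^ n * l | y l. y \<in> K \<and> l \<in> L}"
    then obtain y l z l' where *: "y \<in> K" "l \<in> L" "a = y ^ n * l" "z \<in> K" "l' \<in> L" "b = z ^ n * l'"
      by blast
    obtain l'' where l'': "l'' \<in> L" "(y * z) ^ n = y ^ n * z ^ n * l''"
      using abelian_section_power_mult[OF K *(1,4)] .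
    have zn: "z ^ n \<in> nrm L" using KL subgp_power[OF K(1) *(4)] by blast
    have "a * b = (y * z) ^ n * (inverse l'' * (inverse (z ^ n) * l * z ^ n) * l')"
      unfolding *(3,6) l''(2) by (simp add: gm_simps)
    moreover have "inverse l'' * (inverse (z ^ n) * l * z ^ n) * l' \<in> L"
      using * l''(1) zn by (intro subgp_mult[OF K(2)] subgp_inv[OF K(2)] nrmD_inv)
    ultimately show "a * b \<in> {y ^ n * l | y l. y \<in> K \<and> l \<in> L}" using subgp_mult[OF K(1) *(1,4)] by blast
  next
    fix a assume "a \<in> {y ^ n * l | y l. y \<in> K \<and> l \<in> L}"
    then obtain y l where *: "y \<in> K" "l \<in> L" "a = y ^ n * l" by blast
    have yn: "y ^ n \<in> nrm L" using KL subgp_power[OF K(1) *(1)] by blast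
    have "inverse a = inverse (y ^ n) * (y ^ n * inverse l * inverse (y ^ n))"
      unfolding *(3) by (simp add: gm_simps)
    also have "inverse (y ^ n) = inverse y ^ n" by (rule gm_inverse_power)
    finally have "inverse a = inverse y ^ n * (y ^ n * inverse l * inverse y ^ n)" .
    moreover have "y ^ n * inverse l * inverse y ^ n \<in> L"
      using nrmD[OF yn subgp_inv[OF K(2) *(2)]] by (simp add: gm_inverse_power)
    ultimately show "inverse a \<in> {y ^ n * l | y l. y \<in> K \<and> l \<in> L}" using subgp_inv[OF K(1) *(1)] by blast
  qed
qed

text \<open>In the cyclic group \<open>\<langle>C, t\<rangle> / C\<close> every nontrivial element \<open>b\<close> generates a subgroup of finite index.\<close>

lemma cyclic_extension_power:
  assumes C: "subgp C" "L \<subseteq> C" "C \<subseteq> K" and t: "t \<in> K"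
    and b: "b \<in> gen (insert t C)" "b \<notin> C" and a: "a \<in> gen (insert t C)"
  obtains n where "n > 0" "a ^ n \<in> gen (insert b C)"
proof -
  let ?D = "gen (insert b C)"
  have KC: "K \<subseteq> nrm C" by (rule abelian_section_nrm[OF K(1,4) C])
  have CD: "C \<subseteq> ?D" "b \<in> ?D" using gen_superset[of "insert b C"] by auto
  have "t \<in> nrm C" using KC t by blast
  from gen_insert_nrm[OF C(1) this b(1)] obtain z c where z: "z \<in> gen {t}" "c \<in> C" "b = z * c" .
  have zD: "z \<in> ?D" using CD z subgp_mult_right_iff[OF subgp_gen, of c] by blast
  obtain n where n: "z = t ^ n \<or> z = inverse t ^ n" using gen_singleton_powers[OF z(1)] by blast
  have "n \<noteq> 0" using n z b(2) by (cases n) auto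
  have "t ^ n \<in> ?D"
    using n zD subgp_inv_iff[OF subgp_gen, of "t ^ n"] by (auto simp: gm_inverse_power)
  then have "t \<in> isolator K ?D" using t \<open>n \<noteq> 0\<close> by (auto simp: isolator_def)
  moreover have "C \<subseteq> isolator K ?D" using CD C(3) by (auto simp: isolator_def intro!: exI[of _ 1])
  moreover have "subgp (isolator K ?D)" using C(2) CD by (intro subgp_isolator subgp_gen) auto
  ultimately have "gen (insert t C) \<subseteq> isolator K ?D" by (intro gen_least) auto
  then show ?thesis using a that by (auto simp: isolator_def)
qed

text \<open>The descending chain condition for isolated subgroups, by Noetherian induction on the subgroup \<open>C\<close> on which
  the traces of the members of \<open>F\<close> are compared. A descending chain can change its trace on
  \<open>\<langle>C, t\<rangle>\<close> without changing it on \<open>C\<close> only once, when the image in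
  \<open>\<langle>C, t\<rangle> / C\<close> becomes trivial.\<close>

lemma isolated_minimal:
  assumes mx: "max_cond K" and F: "F \<noteq> {}"
    "\<And>B. B \<in> F \<Longrightarrow> subgp B \<and> L \<subseteq> B \<and> B \<subseteq> K \<and> isolator K B \<subseteq> B"
  shows "\<exists>B\<in>F. \<forall>B'\<in>F. B' \<subseteq> B \<longrightarrow> B' = B"
proof -
  define good where "good F \<longleftrightarrow> F \<noteq> {} \<and> (\<forall>B\<in>F. subgp B \<and> L \<subseteq> B \<and> B \<subseteq> K \<and> isolator K B \<subseteq> B)" for F
  define P where "P C \<longleftrightarrow> (\<forall>F. good F \<longrightarrow> (\<exists>B\<in>F. \<forall>B'\<in>F. B' \<subseteq> B \<longrightarrow> B' \<inter> C = B \<inter> C))" for C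
  have "P K"
  proof (rule max_cond_induct[OF mx K(1-3)])
    have "B \<inter> L = L" if "good F" "B \<in> F" for F B
      using that unfolding good_def by (meson Int_absorb1)
    then show "P L" unfolding P_def by (metis all_not_in_conv good_def)
  next
    fix C t assume C: "subgp C" "L \<subseteq> C" "C \<subseteq> K" and PC: "P C" and t: "t \<in> K" "t \<notin> C"
    let ?C' = "gen (insert t C)"
    have CC': "C \<subseteq> ?C'" using gen_superset[of "insert t C"] by auto
    show "P ?C'"
      unfolding P_def
    proof (intro allI impI)
      fix F assume gF: "good F"
      from PC[unfolded P_def, rule_format, OF gF] obtain B0 where B0: "B0 \<in> F"
        and tr': "\<forall>B\<in>F. B \<subseteq> B0 \<longrightarrow> B \<inter> C = B0 \<inter> C" by (elim bexE)
      have tr: "B \<inter> C = B0 \<inter> C" if "B \<in> F" "B \<subseteq> B0" for B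
        using tr'[rule_format, OF that] .
      show "\<exists>B\<in>F. \<forall>B'\<in>F. B' \<subseteq> B \<longrightarrow> B' \<inter> ?C' = B \<inter> ?C'"
      proof (cases "\<exists>B1\<in>F. B1 \<subseteq> B0 \<and> B1 \<inter> ?C' \<subseteq> C")
        case True
        then obtain B1 where B1: "B1 \<in> F" "B1 \<subseteq> B0" "B1 \<inter> ?C' \<subseteq> C" by blast
        have "B \<inter> ?C' = B1 \<inter> ?C'" if B: "B \<in> F" "B \<subseteq> B1" for B
          using tr[OF B(1) subset_trans[OF B(2) B1(2)]] tr[OF B1(1,2)] B(2) B1(3) CC' by blast
        then show ?thesis using B1(1) by blast
      next
        case False
        have "B \<inter> ?C' = B0 \<inter> ?C'" if B: "B \<in> F" "B \<subseteq> B0" for B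
        proof -
          obtain b where b: "b \<in> B" "b \<in> ?C'" "b \<notin> C" using False B by blast
          have gB: "subgp B" "isolator K B \<subseteq> B" and gB0: "subgp B0" "B0 \<subseteq> K"
            using gF B(1) B0 unfolding good_def by blast+
          have "b \<in> K" using b(1) B(2) gB0 by blast
          have "a \<in> B" if a: "a \<in> B0" "a \<in> ?C'" for a
          proof -
            obtain n where n: "n > 0" "a ^ n \<in> gen (insert b C)"
              using cyclic_extension_power[OF C t(1) b(2,3) a(2)] .
            have "b \<in> nrm C" using abelian_section_nrm[OF K(1,4) C] \<open>b \<in> K\<close> by blast
            from gen_insert_nrm[OF C(1) this n(2)] obtain z c where z: "z \<in> gen {b}" "c \<in> C" "a ^ n = z * c" .
            have "z \<in> B" using z(1) gen_least[OF gB(1), of "{b}"] b(1) by blast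
            moreover have "a ^ n \<in> B0" using subgp_power[OF gB0(1) a(1)] .
            ultimately have "c \<in> B0" using z(3) B(2) subgp_mult_left_iff[OF gB0(1)] by (metis subsetD)
            then have "c \<in> B" using tr[OF B] z(2) by blast
            then have "a ^ n \<in> B" using z(3) \<open>z \<in> B\<close> subgp_mult[OF gB(1)] by simp
            then show ?thesis using gB(2) n(1) a(1) gB0(2) unfolding isolator_def by blast
          qed
          then show ?thesis using B(2) by blast
        qed
        then show ?thesis using B0 by blast
      qed
    qed
  qed
  moreover have "good F" using F unfolding good_def by blast
  ultimately have "\<exists>B\<in>F. \<forall>B'\<in>F. B' \<subseteq> B \<longrightarrow> B' \<inter> K = B \<inter> K"
    by (rule P_def[THEN iffD1, rule_format])
  then obtain B where B: "B \<in> F" "\<forall>B'\<in>F. B' \<subseteq> B \<longrightarrow> B' \<inter> K = B \<inter> K" by (elim bexE)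
  have "B' = B" if "B' \<in> F" "B' \<subseteq> B" for B'
    using B(2)[rule_format, OF that] F(2)[OF that(1)] F(2)[OF B(1)] by (simp add: Int_absorb2)
  then show ?thesis using B(1) by blast
qed

lemma torsion_free_power_eq:
  assumes tf: "\<And>k n. k \<in> K \<Longrightarrow> n > 0 \<Longrightarrow> k ^ n \<in> L \<Longrightarrow> k \<in> L"
    and b: "b \<in> K" "inverse (b ^ i) * b ^ j \<in> L" "b \<notin> L"
  shows "i = j"
proof (rule ccontr)
  assume "i \<noteq> j"
  then consider d where "d > 0" "j = i + d" | d where "d > 0" "i = j + d"
    by (metis less_imp_add_positive linorder_neqE_nat)
  then show False
  proof cases
    case (1 d)
    then have "b ^ d \<in> L" using b(2) by (simp add: power_add gm_simps)
    then show False using tf b 1 by blast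
  next
    case (2 d)
    then have "inverse (b ^ d) \<in> L" using b(2) by (simp add: power_add gm_simps)
    then have "b ^ d \<in> L" using subgp_inv_iff[OF K(2)] by blast
    then show False using tf b 2 by blast
  qed
qed

text \<open>A nontrivial element \<open>b\<close> of a torsion-free finitely generated abelian group is not divisible by
  large primes: the roots of its powers form a group that some fixed exponent \<open>m\<close> maps into \<open>\<langle>b\<rangle>\<close>, and
  \<open>y ^ p = b\<close> with \<open>y ^ m = b ^ k\<close> would give \<open>m = p * k\<close>, impossible for \<open>0 < m < p\<close>.\<close>

lemma torsion_free_not_divisible:
  assumes mx: "max_cond K" and tf: "\<And>k n. k \<in> K \<Longrightarrow> n > 0 \<Longrightarrow> k ^ n \<in> L \<Longrightarrow> k \<in> L"
    and b: "b \<in> K" "b \<notin> L"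
  shows "\<exists>m. \<forall>p>m. \<forall>y\<in>K. \<forall>l\<in>L. b \<noteq> y ^ p * l"
proof -
  let ?E = "gen (insert b L)"
  have KL: "K \<subseteq> nrm L" using abelian_section_nrm[OF K(1,4,2) _ K(3)] by simp
  have E: "subgp ?E" "L \<subseteq> ?E" "b \<in> ?E" using gen_superset[of "insert b L"] by (auto simp: subgp_gen)
  obtain m where m: "m > 0" "\<forall>k\<in>isolator K ?E. k ^ m \<in> ?E" using isolator_exponent[OF E(1,2) mx] by blast
  have "b \<noteq> y ^ p * l" if p: "p > m" and y: "y \<in> K" and l: "l \<in> L" for p y l
  proof
    assume eq: "b = y ^ p * l"
    then have yp: "y ^ p = b * inverse l" by (simp add: gm_simps)
    have il: "inverse l \<in> L" using subgp_inv[OF K(2) l] .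
    have "y ^ p \<in> ?E" unfolding yp using E il by (intro subgp_mult[OF E(1)]) auto
    then have "y \<in> isolator K ?E" using y p by (auto simp: isolator_def intro!: exI[of _ p])
    then have ym: "y ^ m \<in> ?E" using m(2) by blast
    have bL: "b \<in> nrm L" using KL b(1) by blast
    obtain z l1 where z: "z \<in> gen {b}" "l1 \<in> L" "y ^ m = z * l1"
      using gen_insert_nrm[OF K(2) bL ym] .
    have zK: "z \<in> K" using z(1) gen_least[OF K(1), of "{b}"] b(1) by blast
    obtain l2 where l2: "l2 \<in> L" "(b * inverse l) ^ m = b ^ m * (inverse l) ^ m * l2"
      using abelian_section_power_mult[OF K b(1)] il K(3) by blast
    obtain l3 where l3: "l3 \<in> L" "(z * l1) ^ p = z ^ p * l1 ^ p * l3"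
      using abelian_section_power_mult[OF K zK] z(2) K(3) by blast
    have "b ^ m * ((inverse l) ^ m * l2) = z ^ p * (l1 ^ p * l3)"
      using l2(2) l3(2) unfolding yp[symmetric] z(3)[symmetric]
      by (simp add: mult.assoc mult.commute[of p m] flip: power_mult)
    then have "inverse (b ^ m) * (b ^ m * ((inverse l) ^ m * l2) * inverse (l1 ^ p * l3)) = inverse (b ^ m) * z ^ p"
      by (simp add: gm_simps)
    then have "inverse (b ^ m) * z ^ p = ((inverse l) ^ m * l2) * inverse (l1 ^ p * l3)"
      by (simp add: gm_simps)
    moreover have "((inverse l) ^ m * l2) * inverse (l1 ^ p * l3) \<in> L"
      using l2(1) l3(1) subgp_power[OF K(2) z(2), of p] subgp_power[OF K(2) il, of m]
      by (meson subgp_mult subgp_inv K(2))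
    ultimately have zL: "inverse (b ^ m) * z ^ p \<in> L" by simp
    obtain k where "z = b ^ k \<or> z = inverse b ^ k" using gen_singleton_powers[OF z(1)] by blast
    then show False
    proof
      assume "z = b ^ k"
      then have "inverse (b ^ m) * b ^ (k * p) \<in> L" using zL by (simp add: power_mult)
      from torsion_free_power_eq[OF tf b(1) this b(2)] have "m = k * p" .
      then show False using m(1) p by (cases k) auto
    next
      assume "z = inverse b ^ k"
      then have "z ^ p = inverse (b ^ (k * p))" by (simp add: gm_inverse_power flip: power_mult)
      then have "inverse (b ^ (k * p + m)) * b ^ 0 \<in> L" using zL by (simp add: power_add gm_simps)
      from torsion_free_power_eq[OF tf b(1) this b(2)] have "k * p + m = 0" .
      then show False using m(1) by simp
    qed
  qed
  then show ?thesis by blast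
qed

end

section \<open>Nil groups of automorphisms act nilpotently on nilpotent groups\<close>

text \<open>A minimal isolated invariant \<open>B\<close> consists of fixed points modulo \<open>L\<close>. Otherwise the invariant subgroup \<open>D\<close>
  generated by \<open>L\<close> and \<open>[B, H]\<close> has isolator \<open>B\<close>, so that \<open>b ^ m \<in> D\<close> for all \<open>b \<in> B\<close> and one \<open>m > 0\<close>.
  For a prime \<open>p\<close> large enough, the \<open>p\<close>-th powers together with \<open>L\<close> form a proper subgroup of \<open>B\<close>, and the result
  for exponent \<open>p\<close> yields a proper subgroup \<open>P\<close> containing them and also \<open>[B, H]\<close>. Then \<open>P\<close>
  contains all \<open>m\<close>-th and all \<open>p\<close>-th powers, hence everything.\<close>

lemma nil_group_fixed_point_torsion_free:
  assumes K: "subgp K" "subgp L" "L \<subset> K" "\<And>a b. a \<in> K \<Longrightarrow> b \<in> K \<Longrightarrow> comm a b \<in> L"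
    and mx: "max_cond K"
    and H: "subgp H" "H \<subseteq> nrm K" "H \<subseteq> nrm L" "\<And>h. h \<in> H \<Longrightarrow> nil_on h K"
    and tf: "\<And>k n. k \<in> K \<Longrightarrow> n > 0 \<Longrightarrow> k ^ n \<in> L \<Longrightarrow> k \<in> L"
  shows "\<exists>k\<in>K - L. \<forall>h\<in>H. comm k h \<in> L"
proof -
  have LK: "L \<subseteq> K" using K(3) by blast
  define F where "F = {B. subgp B \<and> L \<subset> B \<and> B \<subseteq> K \<and> H \<subseteq> nrm B \<and> isolator K B \<subseteq> B}"
  have "K \<in> F" using K H(2) by (auto simp: F_def isolator_def)
  then have "\<exists>B\<in>F. \<forall>B'\<in>F. B' \<subseteq> B \<longrightarrow> B' = B"
    by (intro isolated_minimal[OF K(1,2) LK K(4) mx]) (auto simp: F_def)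
  then obtain B where "B \<in> F" and min: "\<And>B'. B' \<in> F \<Longrightarrow> B' \<subseteq> B \<Longrightarrow> B' = B" by blast
  then have B: "subgp B" "L \<subset> B" "B \<subseteq> K" "H \<subseteq> nrm B" "isolator K B \<subseteq> B" by (simp_all add: F_def)
  have abB: "comm a b \<in> L" if "a \<in> B" "b \<in> B" for a b using K(4) that B(3) by blast
  have mxB: "max_cond B" by (rule max_cond_subset[OF mx B(3)])
  define S where "S = L \<union> {comm b h | b h. b \<in> B \<and> h \<in> H}"
  define D where "D = gen S"
  have D: "subgp D" "L \<subseteq> D" using gen_superset[of S] by (auto simp: D_def subgp_gen S_def)
  have DB: "D \<subseteq> B"
    unfolding D_def using B(1,2,4) comm_in_left[OF B(1)] by (intro gen_least) (auto simp: S_def)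
  have "H \<subseteq> nrm S"
  proof (rule subgp_nrmI[OF H(1)])
    show "y * s * inverse y \<in> S" if y: "y \<in> H" and s: "s \<in> S" for y s
    proof (cases "s \<in> L")
      case True
      then show ?thesis using nrmD H(3) y by (auto simp: S_def)
    next
      case False
      then obtain b h where "b \<in> B" "h \<in> H" "s = comm b h" using s by (auto simp: S_def)
      moreover then have "y * b * inverse y \<in> B" "y * h * inverse y \<in> H"
        using B(4) y H(1) by (auto intro: nrmD subgp_mult subgp_inv)
      ultimately show ?thesis by (auto simp: S_def simp flip: comm_conj)
    qed
  qed
  then have HD: "H \<subseteq> nrm D" unfolding D_def using nrm_gen_nrm by blast
  have "D = L"
  proof (rule ccontr)
    assume "D \<noteq> L"
    then have LD: "L \<subset> D" using D by blast
    have DK: "D \<subseteq> K" using DB B(3) by blast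
    have "isolator K D \<in> F"
    proof -
      have "subgp (isolator K D)" by (rule subgp_isolator[OF K(1,2) LK K(4) D])
      moreover have "L \<subset> isolator K D" using LD isolator_superset[OF DK] by blast
      moreover have "H \<subseteq> nrm (isolator K D)" using nrm_isolator HD H(2) by blast
      moreover have "isolator K (isolator K D) \<subseteq> isolator K D"
        using isolator_power_closed by (auto simp: isolator_def[of K "isolator K D"])
      ultimately show ?thesis by (simp add: F_def isolator_def)
    qed
    moreover have "isolator K D \<subseteq> B" using isolator_mono[OF DB, of K] B(5) by blast
    ultimately have isoD: "isolator K D = B" by (rule min)
    obtain m where m: "m > 0" "\<forall>k\<in>B. k ^ m \<in> D"
      using isolator_exponent[OF K(1,2) LK K(4) D mx] unfolding isoD by blast
    obtain b where b: "b \<in> B" "b \<notin> L" using B(2) by blast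
    obtain m' where m': "\<forall>p>m'. \<forall>y\<in>B. \<forall>l\<in>L. b \<noteq> y ^ p * l"
      using torsion_free_not_divisible[OF B(1) K(2) _ abB mxB _ b] tf B(2,3) by blast
    \<comment> \<open>\<open>p > m'\<close> makes the \<open>p\<close>-th powers proper, \<open>p > m\<close> makes \<open>p\<close> prime to \<open>m\<close>.\<close>
    obtain p where p: "prime p" "p > m + m'" using bigger_prime by blast
    have cop: "coprime m p"
      using p m(1) prime_imp_coprime[OF p(1), of m] nat_dvd_not_less[of m p] by (simp add: coprime_commute)
    define P0 where "P0 = {y ^ p * l | y l. y \<in> B \<and> l \<in> L}"
    have P0: "subgp P0" unfolding P0_def using subgp_power_image[OF B(1) K(2) _ abB] B(2) by blast
    have powP0: "y ^ p \<in> P0" if "y \<in> B" for y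
    proof -
      have "y ^ p = y ^ p * 1" by simp
      then show ?thesis unfolding P0_def using that subgp_one[OF K(2)] by blast
    qed
    have LP0: "L \<subseteq> P0"
    proof
      fix l assume "l \<in> L"
      moreover have "l = 1 ^ p * l" by simp
      ultimately show "l \<in> P0" unfolding P0_def using subgp_one[OF B(1)] by blast
    qed
    have P0B: "P0 \<subset> B"
    proof -
      have "P0 \<subseteq> B" using subgp_power[OF B(1)] subgp_mult[OF B(1)] B(2) by (auto simp: P0_def)
      moreover have "b \<notin> P0"
      proof
        assume "b \<in> P0"
        then obtain y l where "y \<in> B" "l \<in> L" "b = y ^ p * l" by (auto simp: P0_def)
        moreover have "p > m'" using p(2) by simp
        ultimately show False using m' by blast
      qed
      ultimately show ?thesis using b(1) by blast
    qed
    have HP0: "H \<subseteq> nrm P0"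
    proof (rule subgp_nrmI[OF H(1)])
      show "z * s * inverse z \<in> P0" if z: "z \<in> H" and s: "s \<in> P0" for z s
      proof -
        obtain y l where yl: "y \<in> B" "l \<in> L" "s = y ^ p * l" using s by (auto simp: P0_def)
        have "z * s * inverse z = (z * y * inverse z) ^ p * (z * l * inverse z)"
          by (simp add: yl(3) gm_conj_power) (simp add: gm_simps)
        moreover have "z * y * inverse z \<in> B" "z * l * inverse z \<in> L"
          using z yl B(4) H(3) by (auto intro: nrmD)
        ultimately show ?thesis unfolding P0_def by blast
      qed
    qed
    \<comment> \<open>For \<open>P\<close> maximal the fixed points modulo \<open>P\<close>, which exceed \<open>P\<close>, are all of \<open>B\<close>.\<close>
    define F' where "F' = {P. subgp P \<and> P0 \<subseteq> P \<and> P \<subset> B \<and> H \<subseteq> nrm P}"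
    have "P0 \<in> F'" using P0 P0B HP0 by (simp add: F'_def)
    then have "\<exists>P\<in>F'. \<forall>Q\<in>F'. P \<subseteq> Q \<longrightarrow> Q = P"
      by (intro max_cond_maximal[OF mxB]) (auto simp: F'_def)
    then obtain P where "P \<in> F'" and max: "\<And>Q. Q \<in> F' \<Longrightarrow> P \<subseteq> Q \<Longrightarrow> Q = P" by blast
    then have P: "subgp P" "P0 \<subseteq> P" "P \<subset> B" "H \<subseteq> nrm P" by (simp_all add: F'_def)
    have LP: "L \<subseteq> P" using LP0 P(2) by blast
    have "\<exists>k\<in>B - P. \<forall>h\<in>H. comm k h \<in> P"
    proof (rule nil_group_fixed_point_prime_exponent[OF B(1) P(1,3) _ p(1) _ mxB H(1) B(4) P(4)])
      show "nil_on h B" if "h \<in> H" for h using nil_on_subset[OF H(4)[OF that] B(3)] .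
    qed (use abB LP powP0 P(2) in auto)
    then obtain k where k: "k \<in> B" "k \<notin> P" "\<forall>h\<in>H. comm k h \<in> P" by blast
    define Q where "Q = {k \<in> B. \<forall>h\<in>H. comm k h \<in> P}"
    have BP: "B \<subseteq> nrm P" using abelian_section_nrm[OF B(1) abB P(1) LP] P(3) by blast
    have "P \<subseteq> B" using P(3) by blast
    note fp = section_fixed_points[OF B(1) P(1) this BP subgp_inv[OF H(1)] P(4), folded Q_def]
    have "Q = B"
    proof (rule ccontr)
      assume "Q \<noteq> B"
      then have "Q \<in> F'" using fp(1-3) P(2) by (auto simp: F'_def Q_def)
      then have "Q = P" using fp(2) by (rule max)
      then show False using k by (auto simp: Q_def)
    qed
    then have "comm c h \<in> P" if "c \<in> B" "h \<in> H" for c h using that by (auto simp: Q_def)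
    then have "D \<subseteq> P" unfolding D_def using P(1) LP by (intro gen_least) (auto simp: S_def)
    then have "k ^ m \<in> P" using m(2) k(1) by blast
    moreover have "k ^ p \<in> P" using powP0[OF k(1)] P(2) by blast
    ultimately have "k \<in> P" using coprime_powers_in_subgp[OF P(1)] cop by blast
    then show False using k(2) by simp
  qed
  moreover obtain b where "b \<in> B" "b \<notin> L" using B(2) by blast
  moreover have "comm b h \<in> D" if "b \<in> B" "h \<in> H" for b h
    unfolding D_def using that by (intro gen_mem) (auto simp: S_def)
  ultimately show ?thesis using B(3) by blast
qed

lemma prime_power_into_subgp:
  assumes "(k::'p::group_mult) \<notin> L" "k ^ n \<in> L" "n > 0"
  obtains p j where "prime p" "k ^ j \<notin> L" "(k ^ j) ^ p \<in> L"
proof -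
  define d where "d = (LEAST d. d > 0 \<and> k ^ d \<in> L)"
  have d: "d > 0 \<and> k ^ d \<in> L" unfolding d_def by (rule LeastI[of _ n]) (use assms in simp)
  then have "d \<noteq> 1" using assms(1) by auto
  then obtain p where p: "prime p" "p dvd d" using prime_factor_nat by blast
  then obtain j where j: "d = j * p" by (metis dvd_div_mult_self)
  have "0 < j" "j < d" using d j prime_gt_1_nat[OF p(1)] by auto
  then have "k ^ j \<notin> L" using not_less_Least[of j "\<lambda>d. d > 0 \<and> k ^ d \<in> L"] by (simp add: d_def)
  moreover have "(k ^ j) ^ p \<in> L" using d j by (simp add: power_mult)
  ultimately show ?thesis using that p(1) by blast
qed

text \<open>This is Kolchin's theorem for finitely generated abelian groups. In the presence of torsion modulo \<open>L\<close>, the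
  elements whose \<open>p\<close>-th power lies in \<open>L\<close> form a larger group than \<open>L\<close> for some prime \<open>p\<close>.\<close>

theorem nil_group_fixed_point:
  assumes K: "subgp K" "subgp L" "L \<subset> K" "\<And>a b. a \<in> K \<Longrightarrow> b \<in> K \<Longrightarrow> comm a b \<in> L"
    and mx: "max_cond K"
    and H: "subgp H" "H \<subseteq> nrm K" "H \<subseteq> nrm L" "\<And>h. h \<in> H \<Longrightarrow> nil_on h K"
  shows "\<exists>k\<in>K - L. \<forall>h\<in>H. comm k h \<in> L"
proof (cases "\<exists>k n. k \<in> K \<and> n > 0 \<and> k ^ n \<in> L \<and> k \<notin> L")
  case False
  then show ?thesis by (intro nil_group_fixed_point_torsion_free[OF K mx H]) auto
next
  case True
  then obtain k n where "k \<in> K" "k \<notin> L" "k ^ n \<in> L" "n > 0" by blast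
  then obtain p j where p: "prime p" "k ^ j \<notin> L" "(k ^ j) ^ p \<in> L"
    using prime_power_into_subgp by blast
  have LK: "L \<subseteq> K" using K(3) by blast
  define T where "T = {k \<in> K. k ^ p \<in> L}"
  have T: "subgp T" unfolding T_def using subgp_power_preimage[OF K(1,2) LK K(4,2)] by simp
  have TK: "T \<subseteq> K" by (simp add: T_def)
  have "L \<subseteq> T" using LK subgp_power[OF K(2)] by (auto simp: T_def)
  moreover have "k ^ j \<in> T" using p(3) subgp_power[OF K(1) \<open>k \<in> K\<close>] by (simp add: T_def)
  ultimately have LT: "L \<subset> T" using p(2) by blast
  have HT: "H \<subseteq> nrm T" unfolding T_def using nrm_power_preimage H(2,3) by blast
  have "\<exists>k\<in>T - L. \<forall>h\<in>H. comm k h \<in> L"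
  proof (rule nil_group_fixed_point_prime_exponent[OF T K(2) LT _ p(1) _ max_cond_subset[OF mx TK] H(1) HT H(3)])
    show "comm a b \<in> L" if "a \<in> T" "b \<in> T" for a b using K(4) that TK by blast
    show "k ^ p \<in> L" if "k \<in> T" for k using that by (simp add: T_def)
    show "nil_on h T" if "h \<in> H" for h using nil_on_subset[OF H(4)[OF that] TK] .
  qed
  then show ?thesis using TK by blast
qed

theorem nil_group_nilact:
  assumes V: "nilp V" "max_cond V"
    and H: "subgp H" "H \<subseteq> nrm V" "\<And>h. h \<in> H \<Longrightarrow> nil_on h V"
  shows "nilact (H \<union> V) V {1}"
proof (rule nilact_of_lc_sections[OF V(1)])
  fix i
  have s: "subgp V" using V(1) by (simp add: nilp_def)
  let ?K = "lc V i" let ?M = "lc V (Suc i)"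
  have KV: "?K \<subseteq> V" by (rule lc_subset[OF s])
  show "nilact H ?K ?M"
  proof (rule nilact_of_fixed_points)
    show "max_cond ?K" by (rule max_cond_subset[OF V(2) KV])
    show "subgp ?K" "subgp ?M" by (rule subgp_lc[OF s])+
    show "?M \<subseteq> ?K" by (rule lc_Suc_subset[OF s])
    show ab: "comm a b \<in> ?M" if "a \<in> ?K" "b \<in> ?K" for a b using lc_comm that KV by blast
    show "H \<subseteq> nrm ?K" "H \<subseteq> nrm ?M" by (rule sub_nrm_lc[OF H(2)])+
    show "inverse h \<in> H" if "h \<in> H" for h using subgp_inv[OF H(1) that] .
    fix L assume L: "subgp L" "?M \<subseteq> L" "L \<subset> ?K" "H \<subseteq> nrm L"
    show "\<exists>k\<in>?K - L. \<forall>h\<in>H. comm k h \<in> L"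
    proof (rule nil_group_fixed_point[OF subgp_lc[OF s] L(1,3) _ max_cond_subset[OF V(2) KV] H(1) sub_nrm_lc[OF H(2)] L(4)])
      show "comm a b \<in> L" if "a \<in> ?K" "b \<in> ?K" for a b using ab[OF that] L(2) by blast
      show "nil_on h ?K" if "h \<in> H" for h using nil_on_subset[OF H(3)[OF that] KV] .
    qed
  qed
qed

text \<open>The group \<open>G\<close> contains all commutators, so \<open>t\<close> acts trivially on \<open>V / (G \<inter> V)\<close>, and the maximal condition
  in \<open>G\<close> makes the nil element \<open>t\<close> act nilpotently on the sections of \<open>G \<inter> V\<close> cut out by the lower
  central series of \<open>V\<close>. Together with \<open>V\<close>, which centralizes these sections, it stabilizes a series of \<open>\<langle>t, V\<rangle>\<close>.\<close>

lemma nilp_adjoin: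
  assumes G: "subgp G" "max_cond G"
    and V: "nilp V" "V \<subseteq> nrm G" "\<And>a b. a \<in> V \<Longrightarrow> b \<in> V \<Longrightarrow> comm a b \<in> G"
    and t: "t \<in> nrm V" "t \<in> nrm G" "nil_on t G" "\<And>a. a \<in> V \<Longrightarrow> comm a t \<in> G"
  shows "nilp (gen (insert t V))"
proof -
  have s: "subgp V" using V(1) by (simp add: nilp_def)
  \<comment> \<open>The inverse is included because series are refined for sets closed under inverses.\<close>
  define T where "T = {t, inverse t}"
  have Tinv: "x \<in> T \<Longrightarrow> inverse x \<in> T" for x by (auto simp: T_def gm_inverse_inverse)
  have Tn: "T \<subseteq> nrm B" if "t \<in> nrm B" for B using that subgp_inv[OF subgp_nrm] by (auto simp: T_def)
  have Tcomm: "comm k x \<in> B" if "subgp B" "t \<in> nrm B" "comm k t \<in> B" "x \<in> T" for k B x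
    using that(3,4) nrmD_inv[OF that(2) subgp_inv[OF that(1,3)]] by (auto simp: T_def comm_inv_right)
  let ?D = "\<lambda>i. G \<inter> lc V i"
  have sD: "subgp (?D i)" for i by (intro subgp_Int G subgp_lc s)
  have tD: "t \<in> nrm (?D i)" for i using t(1,2) nrm_lc[of t V i] nrm_Int by blast
  have VD: "comm a b \<in> ?D (Suc i)" if "a \<in> ?D i" "b \<in> V" for a b i
    using that lc_comm[of a V i b] V(2) comm_in_left[OF G(1)] by blast
  have DV: "?D i \<subseteq> V" for i using lc_subset[OF s] by blast
  have sec: "nilact (T \<union> V) (?D i) (?D (Suc i))" for i
  proof (rule nilact_union[OF _ subgp_inv[OF s] VD])
    show "nilact T (?D i) (?D (Suc i))"
    proof (rule nilact_of_fixed_points)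
      show "max_cond (?D i)" by (rule max_cond_subset[OF G(2)]) simp
      show "subgp (?D i)" "subgp (?D (Suc i))" by (rule sD)+
      show "?D (Suc i) \<subseteq> ?D i" using lc_Suc_subset[OF s] by blast
      show "comm a b \<in> ?D (Suc i)" if "a \<in> ?D i" "b \<in> ?D i" for a b
        using that(2) DV by (intro VD[OF that(1)]) blast
      show "T \<subseteq> nrm (?D i)" "T \<subseteq> nrm (?D (Suc i))" by (rule Tn[OF tD])+
      show "x \<in> T \<Longrightarrow> inverse x \<in> T" for x by (rule Tinv)
      fix L assume L: "subgp L" "?D (Suc i) \<subseteq> L" "L \<subset> ?D i" "T \<subseteq> nrm L"
      have "nil_on t (?D i)" by (rule nil_on_subset[OF t(3)]) simp
      from nil_on_fixed_point[OF this sD tD L(1,3)]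
      obtain k where k: "k \<in> ?D i - L" "comm k t \<in> L" by blast
      have "t \<in> nrm L" using L(4) by (simp add: T_def)
      then show "\<exists>k\<in>?D i - L. \<forall>x\<in>T. comm k x \<in> L" using k Tcomm[OF L(1)] by blast
    qed
  qed
  have chain: "nilact (T \<union> V) (?D 0) (?D n)" for n
  proof (induction n)
    case (Suc n)
    then show ?case using sec[of n] by (rule rtranclp_trans)
  qed simp
  obtain n where "lc V n = {1}" using V(1) by (auto simp: nilp_def)
  then have "?D n = {1}" using subgp_one[OF G(1)] by auto
  then have 1: "nilact (T \<union> V) (G \<inter> V) {1}" using chain[of n] by simp
  have GV: "subgp (G \<inter> V)" using subgp_Int[OF G(1) s] .
  have inv: "x \<in> T \<union> V \<Longrightarrow> inverse x \<in> T \<union> V" for x using Tinv subgp_inv[OF s] by blast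
  let ?U = "gen (insert t V)"
  have VU: "V \<subseteq> ?U" using gen_superset[of "insert t V"] by blast
  have Unrm: "?U \<subseteq> nrm V" using t(1) subgp_sub_nrm[OF s] by (intro gen_least subgp_nrm) auto
  have "T \<union> V \<subseteq> sec_cent V (G \<inter> V)"
  proof (rule sec_centI[OF s GV _ inv])
    fix a x assume a: "a \<in> V" and x: "x \<in> T \<union> V"
    show "comm a x \<in> G \<inter> V"
    proof (cases "x \<in> V")
      case True
      then show ?thesis using a V(3) comm_in_left[OF s a] subgp_sub_nrm[OF s] by blast
    next
      case False
      then show ?thesis
        using x Tcomm[OF G(1) t(2) t(4)[OF a]] Tcomm[OF s t(1) comm_in_left[OF s a t(1)]] by blast
    qed
  qed auto
  then have 2: "step (T \<union> V) V (G \<inter> V)" using s GV by (auto simp: step_def)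
  have "?U \<subseteq> {a \<in> nrm V. comm a t \<in> V}"
  proof (rule gen_least[OF subgp_comm_left[OF s]])
    have "comm t t = 1" by (simp add: comm_def gm_simps)
    then show "insert t V \<subseteq> {a \<in> nrm V. comm a t \<in> V}"
      using t(1) subgp_sub_nrm[OF s] comm_in_left[OF s] subgp_one[OF s] by auto
  qed
  then have "comm a x \<in> V" if "a \<in> ?U" "x \<in> T \<union> V" for a x
    using that Tcomm[OF s t(1)] comm_in_right[OF s] Unrm by blast
  then have "T \<union> V \<subseteq> sec_cent ?U V" by (intro sec_centI[OF subgp_gen s VU inv])
  then have 3: "step (T \<union> V) ?U V" using s VU by (auto simp: step_def subgp_gen)
  have "nilact (T \<union> V) ?U {1}"
    using 3 2 1 by (meson converse_rtranclp_into_rtranclp)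
  then have "nilact (insert t V) ?U {1}" by (rule nilact_antimono) (auto simp: T_def)
  then show ?thesis using nilact_gen nilp_iff_nilact[OF subgp_gen] by blast
qed

section \<open>Baer's theorem for a single nil automorphism\<close>

subsection \<open>Homomorphic images\<close>

lemma hom_gen:
  assumes hom: "\<And>a b. \<phi> (a * b) = \<phi> a * (\<phi> b :: 'q::group_mult)"
  shows "\<phi> ` gen (T :: 'p::group_mult set) = gen (\<phi> ` T)"
proof (rule subset_antisym)
  have one: "\<phi> 1 = 1"
    using hom[of 1 1] gm_left_cancel[of "\<phi> 1" "\<phi> 1"] by (simp add: gm_left_inverse)
  have inv: "\<phi> (inverse a) = inverse (\<phi> a)" for a
    by (rule gm_inverse_unique[symmetric]) (simp add: gm_right_inverse one flip: hom)
  have "gen T \<subseteq> {a. \<phi> a \<in> gen (\<phi> ` T)}"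
    by (intro gen_least subgpI) (auto simp: one hom inv gen_mem intro: subgp_one subgp_mult subgp_inv subgp_gen)
  then show "\<phi> ` gen T \<subseteq> gen (\<phi> ` T)" by auto
  have "subgp (\<phi> ` gen T)"
  proof (rule subgpI)
    show "1 \<in> \<phi> ` gen T" using one subgp_one[OF subgp_gen] by (metis image_eqI)
    show "a * b \<in> \<phi> ` gen T" if ab: "a \<in> \<phi> ` gen T" "b \<in> \<phi> ` gen T" for a b
    proof -
      obtain c d where "c \<in> gen T" "d \<in> gen T" "a = \<phi> c" "b = \<phi> d" using ab by blast
      then show ?thesis using subgp_mult[OF subgp_gen, of c T d] by (auto simp flip: hom)
    qed
    show "inverse a \<in> \<phi> ` gen T" if a: "a \<in> \<phi> ` gen T" for a
    proof -
      obtain c where "c \<in> gen T" "a = \<phi> c" using a by blast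
      then show ?thesis using subgp_inv[OF subgp_gen, of c T] by (auto simp flip: inv)
    qed
  qed
  then show "gen (\<phi> ` T) \<subseteq> \<phi> ` gen T" by (rule gen_least) (auto intro: gen_mem)
qed

definition cj :: "'p::group_mult \<Rightarrow> 'p \<Rightarrow> 'p" where
  "cj g a = g * a * inverse g"

lemma cj_mult: "cj g (a * b) = cj g a * cj g b"
  by (simp add: cj_def gm_simps)

lemma cj_cj: "cj (inverse g) (cj g a) = a" "cj g (cj (inverse g) a) = a"
  by (simp_all add: cj_def gm_simps)

lemma cj_gen: "cj g ` gen T = gen (cj g ` T)"
  by (rule hom_gen) (rule cj_mult)

lemma cj_comm: "cj g (comm a b) = comm (cj g a) (cj g b)"
  by (simp add: cj_def comm_def gm_simps)

lemma cj_lc: "cj g ` lc V n = lc (cj g ` V) n"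
proof (induction n)
  case (Suc n)
  have "cj g ` {comm a b | a b. a \<in> lc V n \<and> b \<in> V} =
      {comm a b | a b. a \<in> cj g ` lc V n \<and> b \<in> cj g ` V}"
    by (force simp: cj_comm)
  then show ?case by (simp add: cj_gen Suc)
qed simp

lemma cj_nilp: "nilp V \<Longrightarrow> nilp (cj g ` V)"
proof -
  assume V: "nilp V"
  then obtain n where n: "lc V n = {1}" by (auto simp: nilp_def)
  have "cj g ` V = gen (cj g ` V)"
    using cj_gen[of g V] V by (simp add: nilp_def gen_subgp)
  then have "subgp (cj g ` V)" using subgp_gen by metis
  moreover have "lc (cj g ` V) n = {1}"
    unfolding cj_lc[symmetric] n by (simp add: cj_def gm_simps)
  ultimately show ?thesis unfolding nilp_def by blast
qed

lemma nrm_iff_cj: "g \<in> nrm V \<longleftrightarrow> cj g ` V = V"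
proof
  assume g: "g \<in> nrm V"
  have "a \<in> cj g ` V" if "a \<in> V" for a
    using nrmD_inv[OF g that] cj_cj(2)[of g a] by (metis cj_def gm_inverse_inverse image_eqI)
  then show "cj g ` V = V" using nrmD[OF g] by (auto simp: cj_def)
next
  assume eq: "cj g ` V = V"
  show "g \<in> nrm V"
  proof (rule nrmI)
    fix k assume k: "k \<in> V"
    then show "g * k * inverse g \<in> V" using eq by (auto simp: cj_def)
    obtain k' where "k' \<in> V" "k = cj g k'" using k eq by blast
    then show "inverse g * k * g \<in> V" by (simp add: cj_def gm_simps)
  qed
qed

subsection \<open>Normalizers in nilpotent groups\<close>

text \<open>This is the normalizer condition relative to an invariant set \<open>S\<close> of generators. One climbs from \<open>I\<close> to \<open>U\<close> along the groups \<open>I \<gamma>\<^sub>j(U)\<close>, each of which normalizes the next one, and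
  stops where elements of \<open>S\<close> outside \<open>I\<close> first appear.\<close>

lemma nilp_normalizer_growth:
  assumes U: "nilp U" "U = gen (U \<inter> S)" "U \<subseteq> nrm S"
    and I: "I = gen (I \<inter> S)" "I \<subseteq> U" "I \<noteq> U"
  obtains u where "u \<in> U" "u \<in> S" "u \<notin> I" "u \<in> nrm I"
proof -
  have sU: "subgp U" using U(1) by (simp add: nilp_def)
  have sI: "subgp I" by (subst I(1)) (rule subgp_gen)
  define J where "J j = gen (I \<union> lc U j)" for j
  have IJ: "I \<subseteq> J j" "lc U j \<subseteq> J j" for j using gen_superset[of "I \<union> lc U j"] by (auto simp: J_def)
  have JU: "J j \<subseteq> U" for j unfolding J_def using I(2) lc_subset[OF sU] by (intro gen_least[OF sU]) blast
  have sJ: "subgp (J j)" for j by (simp add: J_def subgp_gen)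
  obtain n where n: "lc U n = {1}" using U(1) by (auto simp: nilp_def)
  have "J n = I"
    unfolding J_def n using gen_subgp[OF sI] subgp_one[OF sI] by (simp add: insert_absorb)
  then have Pn: "S \<inter> J n \<subseteq> I" by simp
  define j where "j = (LEAST j. S \<inter> J j \<subseteq> I)"
  have Pj: "S \<inter> J j \<subseteq> I" unfolding j_def by (rule LeastI[of "\<lambda>j. S \<inter> J j \<subseteq> I", OF Pn])
  have "j \<noteq> 0"
  proof
    assume "j = 0"
    moreover have "U \<subseteq> J 0" using IJ(2)[of 0] by simp
    ultimately have "U \<inter> S \<subseteq> I" using Pj by blast
    then have "U \<subseteq> I" using gen_least[OF sI] U(2) by blast
    then show False using I(2,3) by blast
  qed
  then obtain i where i: "j = Suc i" using not0_implies_Suc by blast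
  then have "\<not> S \<inter> J i \<subseteq> I" using not_less_Least[of i "\<lambda>j. S \<inter> J j \<subseteq> I"] by (simp add: j_def)
  then obtain u where u: "u \<in> S" "u \<in> J i" "u \<notin> I" by blast
  have "J i \<subseteq> nrm (J (Suc i))"
    unfolding J_def[of i]
  proof (rule gen_least[OF subgp_nrm], rule Un_least)
    show "I \<subseteq> nrm (J (Suc i))" using IJ(1) subgp_sub_nrm[OF sJ] by blast
    show "lc U i \<subseteq> nrm (J (Suc i))"
    proof
      fix a assume a: "a \<in> lc U i"
      have ia: "inverse a \<in> lc U i" using subgp_inv[OF subgp_lc[OF sU] a] .
      have conj: "b * s * inverse b \<in> J (Suc i)" if b: "b \<in> lc U i" "inverse b \<in> lc U i" and s: "s \<in> I \<union> lc U (Suc i)" for b s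
      proof (cases "s \<in> I")
        case True
        have "b * s * inverse b = comm (inverse b) s * s" by (simp add: comm_def gm_simps)
        moreover have "comm (inverse b) s \<in> J (Suc i)"
          using lc_comm[OF b(2), of s] True I(2) IJ(2) by blast
        ultimately show ?thesis using True IJ(1) subgp_mult[OF sJ] by (metis subsetD)
      next
        case False
        then have "s \<in> lc U (Suc i)" using s by blast
        then have "b * s * inverse b \<in> lc U (Suc i)" using lc_nrm_lc[OF sU] b(1) nrmD by blast
        then show ?thesis using IJ(2) by blast
      qed
      show "a \<in> nrm (J (Suc i))"
        unfolding J_def
      proof (rule nrm_gen, fold J_def)
        show "a * s * inverse a \<in> J (Suc i)" if "s \<in> I \<union> lc U (Suc i)" for s
          by (rule conj[OF a ia that])
        show "inverse a * s * a \<in> J (Suc i)" if "s \<in> I \<union> lc U (Suc i)" for s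
          using conj[OF ia _ that] a by (simp add: gm_inverse_inverse)
      qed
    qed
  qed
  then have "u \<in> nrm (J (Suc i))" using u(2) by blast
  moreover have uU: "u \<in> U" using u(2) JU by blast
  then have "u \<in> nrm S" using U(3) by blast
  ultimately have "u \<in> nrm (J (Suc i) \<inter> S)" using nrm_Int by blast
  moreover have "J (Suc i) \<inter> S = I \<inter> S" using Pj IJ(1)[of "Suc i"] i by blast
  ultimately have "u \<in> nrm (gen (I \<inter> S))" using nrm_gen_nrm by auto
  then have "u \<in> nrm I" using I(1) by simp
  then show ?thesis using that u(1,3) uU by blast
qed

subsection \<open>The conjugates of a nil element\<close>

context
  fixes G :: "'p::group_mult set" and x :: 'p
  assumes G: "subgp G" "max_cond G" and x: "x \<in> nrm G" "nil_on x G"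
begin

definition conjs :: "'p set" where
  "conjs = {g * x * inverse g | g. g \<in> G}"

definition ext :: "'p set" where
  "ext = gen (insert x G)"

lemma subgp_ext: "subgp ext"
  by (simp add: ext_def subgp_gen)

lemma G_ext: "G \<subseteq> ext" "x \<in> ext"
  unfolding ext_def by (auto intro: gen_mem)

lemma ext_nrm: "ext \<subseteq> nrm G"
  unfolding ext_def using x(1) subgp_sub_nrm[OF G(1)] by (intro gen_least subgp_nrm) auto

text \<open>The quotient of \<open>ext\<close> by \<open>G\<close> is cyclic.\<close>

lemma ext_comm:
  assumes "a \<in> ext" "b \<in> ext" shows "comm a b \<in> G"
proof -
  have 1: "ext \<subseteq> {a \<in> nrm G. comm a x \<in> G}"
    unfolding ext_def
  proof (rule gen_least[OF subgp_comm_left[OF G(1)]])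
    have "comm x x = 1" by (simp add: comm_def gm_simps)
    then show "insert x G \<subseteq> {a \<in> nrm G. comm a x \<in> G}"
      using x(1) subgp_sub_nrm[OF G(1)] comm_in_left[OF G(1)] subgp_one[OF G(1)] by auto
  qed
  have "ext \<subseteq> {b \<in> nrm G. comm a b \<in> G}"
    unfolding ext_def
  proof (rule gen_least[OF subgp_comm_right[OF G(1)]])
    show "insert x G \<subseteq> {b \<in> nrm G. comm a b \<in> G}"
      using 1 assms(1) x(1) subgp_sub_nrm[OF G(1)] comm_in_right[OF G(1)] ext_nrm by auto
  qed
  then show ?thesis using assms(2) by blast
qed

lemma conjs_ext: "conjs \<subseteq> ext"
  unfolding conjs_def using G_ext subgp_ext by (auto intro!: subgp_mult subgp_inv)

lemma x_conjs: "x \<in> conjs"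
  unfolding conjs_def using subgp_one[OF G(1)] by (force simp: gm_simps)

lemma ext_nrm_conjs: "ext \<subseteq> nrm conjs"
proof -
  have "G \<subseteq> nrm conjs"
  proof (rule subgp_nrmI[OF G(1)])
    fix y s assume y: "y \<in> G" and "s \<in> conjs"
    then obtain g where g: "g \<in> G" "s = g * x * inverse g" by (auto simp: conjs_def)
    have "y * s * inverse y = (y * g) * x * inverse (y * g)" by (simp add: g gm_simps)
    then show "y * s * inverse y \<in> conjs"
      unfolding conjs_def using subgp_mult[OF G(1) y g(1)] by blast
  qed
  moreover have "x \<in> nrm conjs"
  proof (rule nrmI)
    fix s assume "s \<in> conjs"
    then obtain g where g: "g \<in> G" "s = g * x * inverse g" by (auto simp: conjs_def)
    have "x * s * inverse x = (x * g * inverse x) * x * inverse (x * g * inverse x)"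
      "inverse x * s * x = (inverse x * g * x) * x * inverse (inverse x * g * x)"
      by (simp_all add: g gm_simps)
    then show "x * s * inverse x \<in> conjs" "inverse x * s * x \<in> conjs"
      unfolding conjs_def using nrmD[OF x(1) g(1)] nrmD_inv[OF x(1) g(1)] by blast+
  qed
  ultimately show ?thesis unfolding ext_def by (intro gen_least subgp_nrm) auto
qed

lemma conjs_nil:
  assumes "t \<in> conjs" shows "nil_on t G" "nil_on t ext"
proof -
  obtain g where g: "g \<in> G" "t = g * x * inverse g" using assms by (auto simp: conjs_def)
  have it: "((\<lambda>a. comm a t) ^^ n) a = cj g (((\<lambda>a. comm a x) ^^ n) (cj (inverse g) a))" for n a
    by (induction n) (simp_all add: cj_cj cj_comm, simp add: g cj_def)
  show 1: "nil_on t G"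
    unfolding nil_on_def
  proof
    fix a assume "a \<in> G"
    then have "cj (inverse g) a \<in> G"
      unfolding cj_def using g(1) G(1) by (auto intro!: subgp_mult subgp_inv)
    then obtain n where "((\<lambda>a. comm a x) ^^ n) (cj (inverse g) a) = 1" using x(2) by (auto simp: nil_on_def)
    then have "((\<lambda>a. comm a t) ^^ n) a = 1" unfolding it by (simp add: cj_def gm_simps)
    then show "\<exists>n. ((\<lambda>a. comm a t) ^^ n) a = 1" by blast
  qed
  show "nil_on t ext"
    unfolding nil_on_def
  proof
    fix a assume "a \<in> ext"
    then have "comm a t \<in> G" using ext_comm conjs_ext assms by blast
    then obtain n where "((\<lambda>a. comm a t) ^^ n) (comm a t) = 1" using 1 by (auto simp: nil_on_def)
    then have "((\<lambda>a. comm a t) ^^ Suc n) a = 1" by (simp only: funpow_Suc_right o_def)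
    then show "\<exists>n. ((\<lambda>a. comm a t) ^^ n) a = 1" by blast
  qed
qed

text \<open>The maximal condition of \<open>G\<close> passes to the subgroups generated by elements of \<open>conjs\<close>: two elements of
  \<open>conjs\<close> differ by an element of \<open>G\<close>, so two such subgroups, one inside the other, coincide once they share an
  element of \<open>conjs\<close> and have the same intersection with \<open>G\<close>.\<close>

lemma conjs_maximal:
  assumes F: "F \<noteq> {}" "\<And>U. U \<in> F \<Longrightarrow> \<exists>T\<subseteq>conjs. U = gen T"
  shows "\<exists>M\<in>F. \<forall>U\<in>F. M \<subseteq> U \<longrightarrow> U = M"
proof (cases "\<forall>U\<in>F. U \<inter> conjs = {}")
  case True
  have "U = {1}" if "U \<in> F" for U
  proof -
    obtain T where "T \<subseteq> conjs" "U = gen T" using F(2) \<open>U \<in> F\<close> by blast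
    moreover then have "T = {}" using True \<open>U \<in> F\<close> gen_superset by blast
    ultimately show ?thesis by (simp add: gen_empty)
  qed
  then show ?thesis using F(1) by blast
next
  case False
  define C where "C = {U \<inter> G | U. U \<in> F \<and> U \<inter> conjs \<noteq> {}}"
  have "\<exists>M\<in>C. \<forall>K\<in>C. M \<subseteq> K \<longrightarrow> K = M"
  proof (rule max_cond_maximal[OF G(2)])
    show "subgp K \<and> K \<subseteq> G" if "K \<in> C" for K
      using that F(2) subgp_gen subgp_Int[OF _ G(1)] unfolding C_def by blast
  qed (use False in \<open>auto simp: C_def\<close>)
  then obtain M where "M \<in> C" and max: "\<And>K. K \<in> C \<Longrightarrow> M \<subseteq> K \<Longrightarrow> K = M" by blast
  then obtain U where U: "U \<in> F" "U \<inter> conjs \<noteq> {}" "M = U \<inter> G" unfolding C_def by blast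
  have "W = U" if W: "W \<in> F" "U \<subseteq> W" for W
  proof -
    obtain s where s: "s \<in> U" "s \<in> conjs" using U(2) by blast
    have sU: "subgp U" using F(2)[OF U(1)] subgp_gen by blast
    obtain T where T: "T \<subseteq> conjs" "W = gen T" using F(2) W(1) by blast
    have "W \<inter> G \<in> C" using W U(2) unfolding C_def by blast
    then have eq: "W \<inter> G = U \<inter> G" using max W(2) U(3) by blast
    have "t \<in> U" if t: "t \<in> T" for t
    proof -
      have tx: "t * inverse x \<in> G" if "t \<in> conjs" for t
      proof -
        obtain g where g: "g \<in> G" "t = g * x * inverse g" using \<open>t \<in> conjs\<close> by (auto simp: conjs_def)
        have "t * inverse x = g * (x * inverse g * inverse x)" by (simp add: g gm_simps)
        then show ?thesis using subgp_mult[OF G(1) g(1) nrmD[OF x(1) subgp_inv[OF G(1) g(1)]]] by simp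
      qed
      have "t \<in> conjs" using t T(1) by blast
      from subgp_mult[OF G(1) tx[OF this] subgp_inv[OF G(1) tx[OF s(2)]]]
      have "(t * inverse x) * inverse (s * inverse x) \<in> G" .
      then have "t * inverse s \<in> G" by (simp add: gm_simps)
      moreover have "t * inverse s \<in> W"
      proof -
        have "s \<in> gen T" using s(1) W(2) T(2) by blast
        from subgp_mult[OF subgp_gen gen_mem[OF t] subgp_inv[OF subgp_gen this]]
        show ?thesis using T(2) by simp
      qed
      ultimately have "t * inverse s \<in> U" using eq by blast
      then show ?thesis using subgp_mult_right_iff[OF sU subgp_inv[OF sU s(1)]] by blast
    qed
    then have "W \<subseteq> U" unfolding T(2) by (intro gen_least[OF sU]) blast
    then show ?thesis using W(2) by blast
  qed
  then show ?thesis using U(1) by blast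
qed

definition nilgens :: "'p set set" where
  "nilgens = {U. nilp U \<and> (\<exists>T\<subseteq>conjs. U = gen T)}"

definition maxgens :: "'p set set" where
  "maxgens = {U \<in> nilgens. \<forall>W\<in>nilgens. U \<subseteq> W \<longrightarrow> W = U}"

lemma nilgens_props:
  assumes "U \<in> nilgens"
  shows "nilp U" "subgp U" "U \<subseteq> ext" "U = gen (U \<inter> conjs)"
proof -
  obtain T where T: "T \<subseteq> conjs" "U = gen T" and n: "nilp U" using assms by (auto simp: nilgens_def)
  show "nilp U" by (rule n)
  show s: "subgp U" using n by (simp add: nilp_def)
  show "U \<subseteq> ext" unfolding T(2) using T(1) conjs_ext by (intro gen_least[OF subgp_ext]) blast
  show "U = gen (U \<inter> conjs)"
  proof (rule subset_antisym)
    have "T \<subseteq> U \<inter> conjs" using T gen_superset by blast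
    then show "U \<subseteq> gen (U \<inter> conjs)" unfolding T(2) by (rule gen_mono)
    show "gen (U \<inter> conjs) \<subseteq> U" by (rule gen_least[OF s]) simp
  qed
qed

lemma nilgens_adjoin:
  assumes V: "V \<in> nilgens" and t: "t \<in> conjs" "t \<in> nrm V"
  shows "gen (insert t V) \<in> nilgens"
proof -
  note Vp = nilgens_props[OF V]
  have te: "t \<in> ext" using t(1) conjs_ext by blast
  have "nilp (gen (insert t V))"
  proof (rule nilp_adjoin[OF G Vp(1)])
    show "V \<subseteq> nrm G" "t \<in> nrm G" using Vp(3) te ext_nrm by auto
    show "comm a b \<in> G" if "a \<in> V" "b \<in> V" for a b using ext_comm Vp(3) that by blast
    show "comm a t \<in> G" if "a \<in> V" for a using ext_comm Vp(3) that te by blast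
    show "nil_on t G" by (rule conjs_nil(1)[OF t(1)])
  qed (rule t(2))
  moreover have "gen (insert t V) = gen (insert t (V \<inter> conjs))"
  proof (rule subset_antisym)
    have "V \<subseteq> gen (insert t (V \<inter> conjs))" using gen_mono[of "V \<inter> conjs" "insert t (V \<inter> conjs)"] Vp(4) by blast
    then show "gen (insert t V) \<subseteq> gen (insert t (V \<inter> conjs))"
      by (intro gen_least subgp_gen) (auto intro: gen_mem)
    show "gen (insert t (V \<inter> conjs)) \<subseteq> gen (insert t V)" by (rule gen_mono) blast
  qed
  moreover have "insert t (V \<inter> conjs) \<subseteq> conjs" using t(1) by blast
  ultimately show ?thesis unfolding nilgens_def by (intro CollectI conjI exI)
qed

lemma trivial_nilgens: "{1} \<in> nilgens"
proof -
  have "nilp ({1}::'p set)" by (auto simp: nilp_def subgp_trivial intro: exI[of _ 0])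
  moreover have "{} \<subseteq> conjs" "{1} = gen ({}::'p set)" by (simp_all add: gen_empty)
  ultimately show ?thesis unfolding nilgens_def by (intro CollectI conjI exI)
qed

lemma maxgens_above:
  assumes "U \<in> nilgens" obtains V where "V \<in> maxgens" "U \<subseteq> V"
proof -
  define F where "F = {V \<in> nilgens. U \<subseteq> V}"
  have "\<exists>M\<in>F. \<forall>W\<in>F. M \<subseteq> W \<longrightarrow> W = M"
  proof (rule conjs_maximal)
    show "F \<noteq> {}" using assms unfolding F_def by blast
    show "\<exists>T\<subseteq>conjs. V = gen T" if "V \<in> F" for V using that by (simp add: F_def nilgens_def)
  qed
  then obtain M where M: "M \<in> F" and max: "\<And>W. W \<in> F \<Longrightarrow> M \<subseteq> W \<Longrightarrow> W = M" by blast
  have "M \<in> nilgens" "U \<subseteq> M" using M by (simp_all add: F_def)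
  then have "M \<in> maxgens" using max unfolding maxgens_def F_def by blast
  then show ?thesis using that \<open>U \<subseteq> M\<close> by blast
qed

lemma maxgens_adjoin:
  assumes V: "V \<in> maxgens" and t: "t \<in> conjs" "t \<in> nrm V"
  shows "t \<in> V"
proof -
  have "gen (insert t V) \<in> nilgens" using nilgens_adjoin[OF _ t] V by (simp add: maxgens_def)
  moreover have "V \<subseteq> gen (insert t V)" using gen_superset by blast
  ultimately have "gen (insert t V) = V" using V by (simp add: maxgens_def)
  then show ?thesis using gen_mem[of t "insert t V"] by simp
qed

lemma cj_nilgens:
  assumes "V \<in> nilgens" "g \<in> ext" shows "cj g ` V \<in> nilgens"
proof -
  obtain T where T: "T \<subseteq> conjs" "V = gen T" "nilp V" using assms(1) by (auto simp: nilgens_def)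
  have "cj g ` T \<subseteq> conjs" using T(1) ext_nrm_conjs assms(2) nrmD[of g conjs] by (auto simp: cj_def)
  moreover have "cj g ` V = gen (cj g ` T)" unfolding T(2) by (rule cj_gen)
  ultimately show ?thesis unfolding nilgens_def using cj_nilp[OF T(3)] by blast
qed

lemma cj_maxgens:
  assumes "V \<in> maxgens" "g \<in> ext" shows "cj g ` V \<in> maxgens"
proof -
  have V: "V \<in> nilgens" "\<And>W. W \<in> nilgens \<Longrightarrow> V \<subseteq> W \<Longrightarrow> W = V" using assms(1) by (auto simp: maxgens_def)
  have "W = cj g ` V" if W: "W \<in> nilgens" "cj g ` V \<subseteq> W" for W
  proof -
    have "V \<subseteq> cj (inverse g) ` W"
      using image_mono[OF W(2), of "cj (inverse g)"] by (simp add: image_image cj_cj)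
    then have "cj (inverse g) ` W = V"
      using V(2) cj_nilgens[OF W(1) subgp_inv[OF subgp_ext assms(2)]] by blast
    then show ?thesis by (auto simp: image_image cj_cj)
  qed
  then show ?thesis using cj_nilgens[OF V(1) assms(2)] unfolding maxgens_def by blast
qed

text \<open>The core of Baer's argument. Among pairs of distinct maximal groups take one with the largest
  \<open>I\<close>, choose \<open>u\<close> and \<open>v\<close> outside \<open>I\<close> normalizing \<open>I\<close>, and let \<open>w\<close> be the last of the
  iterated commutators of \<open>u\<close> with \<open>v\<close> that does not normalize \<open>V\<close>. Then \<open>v\<close> conjugated by \<open>w\<close> normalizes \<open>V\<close>,
  hence lies in \<open>V\<close>, and \<open>V\<close> meets its own conjugate in more than \<open>I\<close>.\<close>

lemma maxgens_unique:
  assumes "U0 \<in> maxgens" "V0 \<in> maxgens" shows "U0 = V0"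
proof (rule ccontr)
  assume ne: "U0 \<noteq> V0"
  define C where "C = {gen (U \<inter> V \<inter> conjs) | U V. U \<in> maxgens \<and> V \<in> maxgens \<and> U \<noteq> V}"
  have "\<exists>I\<in>C. \<forall>K\<in>C. I \<subseteq> K \<longrightarrow> K = I"
  proof (rule conjs_maximal)
    show "\<exists>T\<subseteq>conjs. K = gen T" if "K \<in> C" for K using that unfolding C_def by blast
    show "C \<noteq> {}" using assms ne unfolding C_def by blast
  qed
  then obtain I where "I \<in> C" and max: "\<And>K. K \<in> C \<Longrightarrow> I \<subseteq> K \<Longrightarrow> K = I" by blast
  then obtain U V where UV: "U \<in> maxgens" "V \<in> maxgens" "U \<noteq> V" and I: "I = gen (U \<inter> V \<inter> conjs)"
    unfolding C_def by blast
  have gens: "U \<in> nilgens" "V \<in> nilgens" using UV by (auto simp: maxgens_def)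
  note Up = nilgens_props[OF gens(1)] and Vp = nilgens_props[OF gens(2)]
  have IU: "I \<subseteq> U" unfolding I by (rule gen_least[OF Up(2)]) blast
  have IV: "I \<subseteq> V" unfolding I by (rule gen_least[OF Vp(2)]) blast
  have meet: "U \<inter> V \<inter> conjs \<subseteq> I" unfolding I by (rule gen_superset)
  then have "I \<inter> conjs = U \<inter> V \<inter> conjs" using IU IV by blast
  then have Igen: "I = gen (I \<inter> conjs)" using I by simp
  have "I \<noteq> U" using IV UV gens(2) unfolding maxgens_def by blast
  then obtain u where u: "u \<in> U" "u \<in> conjs" "u \<notin> I" "u \<in> nrm I"
    using nilp_normalizer_growth[OF Up(1,4) _ Igen IU] Up(3) ext_nrm_conjs by blast
  have "I \<noteq> V" using IU UV gens(1) unfolding maxgens_def by blast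
  then obtain v where v: "v \<in> V" "v \<in> conjs" "v \<notin> I" "v \<in> nrm I"
    using nilp_normalizer_growth[OF Vp(1,4) _ Igen IV] Vp(3) ext_nrm_conjs by blast
  have ue: "u \<in> ext" and ve: "v \<in> ext" using u v conjs_ext by auto
  have uV: "u \<notin> nrm V"
  proof
    assume "u \<in> nrm V"
    then have "u \<in> V" using maxgens_adjoin[OF UV(2) u(2)] by blast
    then show False using u meet by blast
  qed
  obtain n where n: "((\<lambda>a. comm a v) ^^ n) u \<notin> nrm V" "((\<lambda>a. comm a v) ^^ Suc n) u \<in> nrm V"
    using nil_on_last[OF conjs_nil(2)[OF v(2)] subgp_nrm ue uV] .
  define w where "w = ((\<lambda>a. comm a v) ^^ n) u"
  have we: "w \<in> ext" unfolding w_def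
    by (rule funpow_comm_in[OF subgp_ext _ ue]) (use ve subgp_sub_nrm[OF subgp_ext] in blast)
  have wI: "w \<in> nrm I" unfolding w_def
    by (rule funpow_comm_in[OF subgp_nrm _ u(4)]) (use v(4) subgp_sub_nrm[OF subgp_nrm] in blast)
  have wV: "w \<notin> nrm V" "comm w v \<in> nrm V" using n by (simp_all add: w_def)
  define t where "t = cj (inverse w) v"
  have iwe: "inverse w \<in> ext" using subgp_inv[OF subgp_ext we] .
  have tS: "t \<in> conjs"
    using nrmD[of "inverse w" conjs v] iwe ext_nrm_conjs v(2) by (auto simp: t_def cj_def)
  have "t = comm w v * v" by (simp add: t_def cj_def comm_def gm_simps)
  then have "t \<in> nrm V" using wV(2) v(1) subgp_sub_nrm[OF Vp(2)] subgp_mult[OF subgp_nrm] by auto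
  then have tV: "t \<in> V" using maxgens_adjoin[OF UV(2) tS] by blast
  let ?V' = "cj (inverse w) ` V"
  have V': "?V' \<in> maxgens" by (rule cj_maxgens[OF UV(2) iwe])
  have "?V' \<noteq> V"
    using wV(1) subgp_inv_iff[OF subgp_nrm, of w V] by (simp add: nrm_iff_cj[symmetric])
  then have inC: "gen (?V' \<inter> V \<inter> conjs) \<in> C" using V' UV(2) unfolding C_def by blast
  have "i \<in> ?V'" if "i \<in> I" for i
  proof -
    have "cj w i \<in> V" using nrmD[OF wI that] IV by (auto simp: cj_def)
    then show ?thesis using cj_cj(1)[of w i] by (metis image_eqI)
  qed
  then have "I \<inter> conjs \<subseteq> ?V' \<inter> V \<inter> conjs" using IV by blast
  then have "I \<subseteq> gen (?V' \<inter> V \<inter> conjs)" using gen_mono Igen by blast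
  from max[OF inC this] have eq: "gen (?V' \<inter> V \<inter> conjs) = I" .
  have "t \<in> ?V' \<inter> V \<inter> conjs" using tV tS v(1) by (auto simp: t_def)
  then have "t \<in> I" unfolding eq[symmetric] by (rule gen_mem)
  then have "w * t * inverse w \<in> I" by (rule nrmD[OF wI])
  moreover have "w * t * inverse w = v" using cj_cj(2)[of w v] by (simp add: t_def cj_def)
  ultimately show False using v(3) by simp
qed

text \<open>Each element of \<open>conjs\<close> generates a member of \<open>nilgens\<close>, which lies in the only maximal one.\<close>

theorem nilp_gen_conjs: "nilp (gen conjs)"
proof -
  obtain W where W: "W \<in> maxgens" using maxgens_above[OF trivial_nilgens] by blast
  then have Wn: "W \<in> nilgens" by (simp add: maxgens_def)
  have "t \<in> W" if t: "t \<in> conjs" for t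
  proof -
    have "gen (insert t {1}) \<in> nilgens" by (rule nilgens_adjoin[OF trivial_nilgens t nrm_trivial])
    then obtain V where V: "V \<in> maxgens" "gen (insert t {1}) \<subseteq> V" by (rule maxgens_above)
    then have "t \<in> V" using gen_mem[of t "insert t {1}"] by blast
    then show ?thesis using maxgens_unique[OF V(1) W] by simp
  qed
  then have "gen conjs \<subseteq> W" using nilgens_props(2)[OF Wn] by (intro gen_least) auto
  then show ?thesis using nilp_subgroup[OF nilgens_props(1)[OF Wn] subgp_gen] by blast
qed

text \<open>The subgroup \<open>gen conjs \<inter> G\<close> does it: \<open>comm g x\<close> is a conjugate of \<open>x\<close> times the inverse of \<open>x\<close>.\<close>

theorem nil_element_normal_nilp:
  obtains N where "nilp N" "N \<subseteq> G" "G \<subseteq> nrm N" "\<And>g. g \<in> G \<Longrightarrow> comm g x \<in> N"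
proof -
  define N where "N = gen conjs \<inter> G"
  have "nilp N" using nilp_subgroup[OF nilp_gen_conjs] subgp_Int[OF subgp_gen G(1)] by (simp add: N_def)
  moreover have "G \<subseteq> nrm (gen conjs)" using G_ext(1) ext_nrm_conjs nrm_gen_nrm by blast
  then have "G \<subseteq> nrm N" unfolding N_def using subgp_sub_nrm[OF G(1)] nrm_Int by blast
  moreover have "comm g x \<in> N" if g: "g \<in> G" for g
  proof -
    have "inverse g * x * inverse (inverse g) \<in> conjs"
      unfolding conjs_def using subgp_inv[OF G(1) g] by blast
    then have "inverse g * x * g \<in> gen conjs" using gen_mem by (simp add: gm_inverse_inverse)
    then have "inverse g * x * g * inverse x \<in> gen conjs"
      using subgp_mult[OF subgp_gen _ subgp_inv[OF subgp_gen gen_mem[OF x_conjs]]] by blast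
    then show ?thesis using comm_in_left[OF G(1) g x(1)] by (simp add: N_def comm_def)
  qed
  ultimately show ?thesis using that by (simp add: N_def)
qed

end

section \<open>Nil groups of automorphisms of groups with the maximal condition\<close>

text \<open>The Fitting subgroup arises as the largest nilpotent normal subgroup \<open>N\<close>.
  Being characteristic, it is normalized by \<open>H\<close>.\<close>

lemma nil_group_fitting:
  assumes G: "subgp G" "max_cond G"
    and H: "subgp H" "H \<subseteq> nrm G" "\<And>h. h \<in> H \<Longrightarrow> nil_on h G"
  shows "\<exists>N. nilp N \<and> N \<subseteq> G \<and> G \<subseteq> nrm N \<and> H \<subseteq> nrm N \<and> (\<forall>g\<in>G. \<forall>h\<in>H. comm g h \<in> N) \<and> nilact (H \<union> N) N {1}"
proof -
  define F where "F = {N. nilp N \<and> N \<subseteq> G \<and> G \<subseteq> nrm N}"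
  have "nilp ({1}::'a set)" by (auto simp: nilp_def subgp_trivial intro: exI[of _ 0])
  then have "{1} \<in> F" using subgp_one[OF G(1)] nrm_trivial by (auto simp: F_def)
  then have "\<exists>N\<in>F. \<forall>M\<in>F. N \<subseteq> M \<longrightarrow> M = N"
    by (intro max_cond_maximal[OF G(2)]) (auto simp: F_def nilp_def)
  then obtain N where NF: "N \<in> F" and max: "\<And>M. M \<in> F \<Longrightarrow> N \<subseteq> M \<Longrightarrow> M = N" by blast
  then have N: "nilp N" "N \<subseteq> G" "G \<subseteq> nrm N" by (simp_all add: F_def)
  have sN: "subgp N" using N(1) by (simp add: nilp_def)
  have largest: "M \<subseteq> N" if "M \<in> F" for M
  proof -
    have M: "nilp M" "M \<subseteq> G" "G \<subseteq> nrm M" using that by (simp_all add: F_def)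
    have sM: "subgp M" using M(1) by (simp add: nilp_def)
    have "nilp (sprod N M)" using N M by (intro nilp_sprod) auto
    moreover have "sprod N M \<subseteq> G" using N(2) M(2) by (intro sprod_least[OF G(1)])
    moreover have "G \<subseteq> nrm (sprod N M)" using N(3) M(3) nrm_sprod by blast
    ultimately have "sprod N M = N" using sprod_superset(1)[OF sN sM] by (intro max) (simp_all add: F_def)
    then show ?thesis using sprod_superset(2)[OF sN sM] by simp
  qed
  have cjN: "cj h ` N \<subseteq> N" if h: "h \<in> H" for h
  proof (rule largest)
    have hG: "h \<in> nrm G" using h H(2) by blast
    have "cj h ` N \<subseteq> G" using N(2) nrmD[OF hG] by (auto simp: cj_def)
    moreover have "g \<in> nrm (cj h ` N)" if g: "g \<in> G" for g
    proof -
      define g' where "g' = cj (inverse h) g"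
      have "g' \<in> G" using nrmD_inv[OF hG g] by (simp add: g'_def cj_def gm_inverse_inverse)
      then have "cj g' ` N = N" using N(3) by (auto simp flip: nrm_iff_cj)
      moreover have "cj g (cj h a) = cj h (cj g' a)" for a by (simp add: g'_def cj_def gm_simps)
      ultimately have "cj g ` (cj h ` N) = cj h ` N" by (metis (no_types, lifting) image_cong image_image)
      then show ?thesis by (simp add: nrm_iff_cj)
    qed
    ultimately show "cj h ` N \<in> F" using cj_nilp[OF N(1)] by (auto simp: F_def)
  qed
  have HN: "H \<subseteq> nrm N"
    by (rule subgp_nrmI[OF H(1)]) (use cjN in \<open>auto simp: cj_def\<close>)
  have "comm g h \<in> N" if gh: "g \<in> G" "h \<in> H" for g h
  proof -
    have "h \<in> nrm G" using gh(2) H(2) by blast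
    then obtain M where M: "nilp M" "M \<subseteq> G" "G \<subseteq> nrm M" "\<And>g. g \<in> G \<Longrightarrow> comm g h \<in> M"
      using nil_element_normal_nilp[OF G _ H(3)[OF gh(2)]] by metis
    then have "M \<subseteq> N" by (intro largest) (simp add: F_def)
    then show ?thesis using M(4)[OF gh(1)] by blast
  qed
  moreover have "nilact (H \<union> N) N {1}"
    by (rule nil_group_nilact[OF N(1) max_cond_subset[OF G(2) N(2)] H(1) HN])
      (rule nil_on_subset[OF H(3) N(2)])
  ultimately show ?thesis using N HN by blast
qed

text \<open>A central series of \<open>H\<close> is read off from the stabilized series because \<open>K 1\<close> also centralizes the factors below it.
  For \<open>d\<close> in the \<open>i\<close>-th lower central term and \<open>h \<in> H\<close>, the images of \<open>a \<in> K j\<close> under \<open>h * d\<close> and \<open>d * h\<close> differ modulo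
  \<open>K (j + i + 2)\<close> by a commutator of \<open>comm a d\<close> with \<open>comm a h\<close>. The former lies in \<open>K (j + i + 1)\<close> by induction, the
  latter in \<open>K (j + 1)\<close> and hence in \<open>K 1\<close>, so this commutator is trivial modulo \<open>K (j + i + 2)\<close> too.\<close>

lemma lc_of_stabilizer:
  assumes H: "subgp H" and K: "\<And>j. subgp (K j)" "\<And>j. K (Suc j) \<subseteq> K j" "\<And>j. H \<subseteq> nrm (K j)"
    and KH: "\<And>j a h. a \<in> K j \<Longrightarrow> h \<in> H \<Longrightarrow> comm a h \<in> K (Suc j)"
    and KN: "\<And>j a x. a \<in> K (Suc j) \<Longrightarrow> x \<in> K 1 \<Longrightarrow> comm a x \<in> K (Suc (Suc j))"
    and d: "d \<in> lc H i" "a \<in> K j"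
  shows "comm a d \<in> K (j + Suc i)"
proof -
  define C where "C i = {d \<in> H. \<forall>j. \<forall>a\<in>K j. comm a d \<in> K (j + Suc i)}" for i
  have sC: "subgp (C i)" for i
  proof -
    let ?F = "(\<lambda>(j, a). {x \<in> nrm (K (j + Suc i)). comm a x \<in> K (j + Suc i)}) ` (SIGMA j:UNIV. K j)"
    have "C i = H \<inter> \<Inter>?F"
      using K(3) by (auto simp: C_def)
    moreover have "subgp (\<Inter>?F)"
      by (rule subgp_Inter) (auto simp del: add_Suc_right intro: subgp_comm_right K(1))
    ultimately show ?thesis using subgp_Int[OF H] by simp
  qed
  have K1: "K (Suc j) \<subseteq> K 1" for j
  proof (induction j)
    case (Suc j) then show ?case using K(2)[of "Suc j"] by blast
  qed simp
  have step: "comm d h \<in> C (Suc i)" if d: "d \<in> C i" and h: "h \<in> H" for d h i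
  proof -
    have dH: "d \<in> H" and dC: "\<And>j a. a \<in> K j \<Longrightarrow> comm a d \<in> K (j + Suc i)"
      using d by (auto simp: C_def)
    have "comm a (comm d h) \<in> K (j + Suc (Suc i))" if a: "a \<in> K j" for j a
    proof -
      let ?M = "K (j + Suc (Suc i))"
      \<comment> \<open>Passing from \<open>a\<close> to \<open>a0\<close> turns the action of \<open>comm d h\<close> into a comparison of \<open>h * d\<close> with \<open>d * h\<close>.\<close>
      define a0 where "a0 = inverse h * a * h"
      define p where "p = comm a0 d"
      define q where "q = comm a0 h"
      have a0: "a0 \<in> K j" unfolding a0_def using nrmD_inv[OF _ a] K(3) h by blast
      have p: "p \<in> K (Suc (j + i))" using dC[OF a0] by (simp add: p_def)
      have q: "q \<in> K (Suc j)" unfolding q_def by (rule KH[OF a0 h])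
      have ph: "comm p h \<in> ?M" using KH[OF p h] by simp
      have qd: "comm q d \<in> ?M" using dC[OF q] by simp
      have "inverse q \<in> K 1" using subgp_inv[OF K(1) q] K1 by blast
      then have pq: "comm p (inverse q) \<in> ?M" using KN[OF p] by simp
      have hd: "h * d * a0 * inverse (h * d) = a0 * q * p * comm p h"
        by (simp add: p_def q_def comm_def gm_simps)
      have dh: "d * h * a0 * inverse (d * h) = a0 * p * q * comm q d"
        by (simp add: p_def q_def comm_def gm_simps)
      have "inverse (comm q d) * inverse (comm p (inverse q)) * comm p h \<in> ?M"
        using ph qd pq by (intro subgp_mult[OF K(1)] subgp_inv[OF K(1)])
      also have "inverse (comm q d) * inverse (comm p (inverse q)) * comm p h =
          inverse (a0 * p * q * comm q d) * (a0 * q * p * comm p h)"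
        by (simp add: comm_def[of p "inverse q"] gm_simps)
      finally have "inverse (d * h * a0 * inverse (d * h)) * (h * d * a0 * inverse (h * d)) \<in> ?M"
        unfolding hd dh .
      then have "inverse d * (inverse (d * h * a0 * inverse (d * h)) * (h * d * a0 * inverse (h * d))) * d \<in> ?M"
        using dH K(3) nrmD_inv by blast
      also have "inverse d * (inverse (d * h * a0 * inverse (d * h)) * (h * d * a0 * inverse (h * d))) * d = comm a (comm d h)"
        by (simp add: a0_def comm_def gm_simps)
      finally show ?thesis .
    qed
    moreover have "comm d h \<in> H" using dH h comm_in_left[OF H] subgp_sub_nrm[OF H] by blast
    ultimately show ?thesis by (simp add: C_def)
  qed
  have "lc H i \<subseteq> C i" for i
  proof (induction i)
    case 0
    then show ?case using KH by (auto simp: C_def)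
  next
    case (Suc i)
    then show ?case
      unfolding lc.simps using step by (intro gen_least[OF sC]) blast
  qed
  then show ?thesis using d by (auto simp: C_def)
qed

text \<open>The series continues with \<open>{1}\<close> beyond its last term, so that it is indexed by all natural numbers.\<close>

theorem nil_group_series:
  assumes G: "subgp G" "max_cond G"
    and H: "subgp H" "H \<subseteq> nrm G" "\<And>h. h \<in> H \<Longrightarrow> nil_on h G"
  shows "\<exists>K r. nilp (K 1) \<and> G \<subseteq> nrm (K 1) \<and> K 0 = G \<and> (\<forall>j>r. K j = {1}) \<and>
    (\<forall>j. subgp (K j) \<and> K (Suc j) \<subseteq> K j \<and> H \<subseteq> nrm (K j) \<and> K j \<subseteq> nrm (K (Suc j))) \<and>
    (\<forall>j. \<forall>a\<in>K j. \<forall>h\<in>H. comm a h \<in> K (Suc j)) \<and>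
    (\<forall>j. \<forall>a\<in>K (Suc j). \<forall>x\<in>K 1. comm a x \<in> K (Suc (Suc j)))"
proof -
  obtain N where N: "nilp N" "N \<subseteq> G" "G \<subseteq> nrm N" "H \<subseteq> nrm N"
    "\<forall>g\<in>G. \<forall>h\<in>H. comm g h \<in> N" "nilact (H \<union> N) N {1}"
    using nil_group_fitting[OF assms] by blast
  have sN: "subgp N" using N(1) by (simp add: nilp_def)
  obtain r where "(step (H \<union> N) ^^ r) N {1}" using rtranclp_imp_relpowp[OF N(6)] by blast
  then obtain f where f: "f 0 = N" "f r = {1}" "\<forall>i<r. step (H \<union> N) (f i) (f (Suc i))"
    unfolding relpowp_fun_conv by blast
  define K where "K j = (case j of 0 \<Rightarrow> G | Suc i \<Rightarrow> f (min i r))" for j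
  have K0: "K 0 = G" "K 1 = N" using f(1) by (simp_all add: K_def)
  have st: "step (H \<union> N) (K (Suc i)) (K (Suc (Suc i)))" for i
  proof (cases "i < r")
    case True
    then show ?thesis using f(3) by (simp add: K_def min_def)
  next
    case False
    then have "K (Suc i) = {1}" "K (Suc (Suc i)) = {1}" using f(2) by (simp_all add: K_def min_def)
    moreover have "step (H \<union> N) {1} {1}"
      by (rule stepI) (auto simp: subgp_trivial nrm_trivial comm_one)
    ultimately show ?thesis by simp
  qed
  have KN: "K (Suc i) \<subseteq> N" for i
  proof (induction i)
    case 0 then show ?case using K0 by simp
  next
    case (Suc i) then show ?case using stepD(3)[OF st[of i]] by blast
  qed
  have Kr: "K j = {1}" if "j > r" for j
  proof -
    obtain i where "j = Suc i" "min i r = r" using \<open>j > r\<close> by (cases j) simp_all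
    then show ?thesis by (simp add: K_def f(2))
  qed
  have sK: "subgp (K j)" for j
  proof (cases j)
    case 0 then show ?thesis using G(1) K0(1) by simp
  next
    case (Suc i) then show ?thesis using stepD(1)[OF st[of i]] by simp
  qed
  have KK: "K (Suc j) \<subseteq> K j" for j
  proof (cases j)
    case 0 then show ?thesis using N(2) K0 by simp
  next
    case (Suc i) then show ?thesis using stepD(3)[OF st[of i]] by simp
  qed
  have HK: "H \<subseteq> nrm (K j)" for j
  proof (cases j)
    case 0 then show ?thesis using H(2) K0(1) by simp
  next
    case (Suc i) then show ?thesis using stepD(4)[OF st[of i]] by simp
  qed
  have KnK: "K j \<subseteq> nrm (K (Suc j))" for j
  proof (cases j)
    case 0 then show ?thesis using N(3) K0 by simp
  next
    case (Suc i) then show ?thesis using KN[of i] stepD(5)[OF st[of i]] by blast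
  qed
  have KH: "comm a h \<in> K (Suc j)" if "a \<in> K j" "h \<in> H" for a h j
  proof (cases j)
    case 0 then show ?thesis using that N(5) K0 by simp
  next
    case (Suc i) then show ?thesis using that stepD(6)[OF st[of i]] by blast
  qed
  have "comm a x \<in> K (Suc (Suc j))" if "a \<in> K (Suc j)" "x \<in> K 1" for a x j
    using that stepD(6)[OF st[of j]] unfolding K0(2) by blast
  then show ?thesis
    using K0 N(1,3) Kr sK KK HK KnK KH by (intro exI[of _ K] exI[of _ r]) simp
qed

theorem nil_group_nilp:
  assumes G: "subgp G" "max_cond G"
    and H: "subgp H" "H \<subseteq> nrm G" "\<And>h. h \<in> H \<Longrightarrow> nil_on h G"
    and faithful: "\<And>h. h \<in> H \<Longrightarrow> (\<And>g. g \<in> G \<Longrightarrow> comm g h = 1) \<Longrightarrow> h = 1"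
  shows "nilp H"
proof -
  obtain K r where K0: "K 0 = G" and Kr: "\<forall>j>r. K j = {1}"
    and K: "\<forall>j. subgp (K j) \<and> K (Suc j) \<subseteq> K j \<and> H \<subseteq> nrm (K j) \<and> K j \<subseteq> nrm (K (Suc j))"
    and KH: "\<forall>j. \<forall>a\<in>K j. \<forall>h\<in>H. comm a h \<in> K (Suc j)"
    and KN: "\<forall>j. \<forall>a\<in>K (Suc j). \<forall>x\<in>K 1. comm a x \<in> K (Suc (Suc j))"
    using nil_group_series[OF G H] by blast
  have "d = 1" if d: "d \<in> lc H r" for d
  proof (rule faithful)
    show "d \<in> H" using d lc_subset[OF H(1)] by blast
    fix g assume "g \<in> G"
    then have g: "g \<in> K 0" by (simp add: K0)
    have "comm g d \<in> K (0 + Suc r)"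
    proof (rule lc_of_stabilizer[where K = K, OF H(1) _ _ _ _ _ d g])
      show "subgp (K j)" "K (Suc j) \<subseteq> K j" "H \<subseteq> nrm (K j)" for j using K by blast+
      show "comm a h \<in> K (Suc j)" if "a \<in> K j" "h \<in> H" for j a h using KH that by blast
      show "comm a x \<in> K (Suc (Suc j))" if "a \<in> K (Suc j)" "x \<in> K 1" for j a x using KN that by blast
    qed
    then show "comm g d = 1" using Kr by simp
  qed
  then have "lc H r = {1}" using subgp_one[OF subgp_lc[OF H(1)]] by blast
  then show ?thesis using H(1) unfolding nilp_def by blast
qed

section \<open>The holomorph inside a symmetric group\<close>

typedef 'a bijection = "{f :: 'a \<Rightarrow> 'a. bij f}"
  morphisms app Bijection
  by (auto intro: bij_id)

lemma bij_app: "bij (app f)"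
  using app by auto

lemma app_Bijection: "bij f \<Longrightarrow> app (Bijection f) = f"
  by (simp add: Bijection_inverse)

lemma bijection_eqI: "(\<And>a. app f a = app g a) \<Longrightarrow> f = g"
  by (simp add: app_inject[symmetric] fun_eq_iff)

instantiation bijection :: (type) group_mult
begin

definition times_bijection :: "'a bijection \<Rightarrow> 'a bijection \<Rightarrow> 'a bijection" where
  "f * g = Bijection (app f \<circ> app g)"

definition one_bijection :: "'a bijection" where
  "1 = Bijection id"

definition inverse_bijection :: "'a bijection \<Rightarrow> 'a bijection" where
  "inverse f = Bijection (inv_into UNIV (app f))"

definition divide_bijection :: "'a bijection \<Rightarrow> 'a bijection \<Rightarrow> 'a bijection" where
  "f div g = f * inverse (g :: 'a bijection)"

lemma app_times: "app (f * g) a = app f (app g a)"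
  by (simp add: times_bijection_def app_Bijection bij_comp bij_app)

lemma app_one: "app 1 a = a"
  by (simp add: one_bijection_def app_Bijection)

lemma app_inverse: "app (inverse f) (app f a) = a"
  by (simp add: inverse_bijection_def app_Bijection bij_imp_bij_inv bij_app bij_is_inj)

instance
  by standard (rule bijection_eqI, simp add: app_times app_one app_inverse)+

end

subsection \<open>Transfer along an injective homomorphism\<close>

definition preim :: "('a, 'b) monoid_scheme \<Rightarrow> ('a \<Rightarrow> 'q) \<Rightarrow> 'q set \<Rightarrow> 'a set" where
  "preim A \<phi> K = {a \<in> carrier A. \<phi> a \<in> K}"

lemma image_preim: "K \<subseteq> \<phi> ` carrier A \<Longrightarrow> \<phi> ` preim A \<phi> K = K"
  by (auto simp: preim_def)

context
  fixes A :: "('a, 'b) monoid_scheme" and \<phi> :: "'a \<Rightarrow> 'q::group_mult"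
  assumes grp: "group A"
    and hom: "\<And>a b. a \<in> carrier A \<Longrightarrow> b \<in> carrier A \<Longrightarrow> \<phi> (a \<otimes>\<^bsub>A\<^esub> b) = \<phi> a * \<phi> b"
    and inj: "inj_on \<phi> (carrier A)"
begin

lemma transfer_one: "\<phi> \<one>\<^bsub>A\<^esub> = 1"
proof -
  interpret group A by (rule grp)
  have "\<phi> \<one>\<^bsub>A\<^esub> * \<phi> \<one>\<^bsub>A\<^esub> = \<phi> \<one>\<^bsub>A\<^esub>" by (simp flip: hom)
  then have "inverse (\<phi> \<one>\<^bsub>A\<^esub>) * (\<phi> \<one>\<^bsub>A\<^esub> * \<phi> \<one>\<^bsub>A\<^esub>) = 1" by (simp add: gm_left_inverse)
  then show ?thesis by (simp add: gm_left_cancel)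
qed

lemma transfer_inv: "a \<in> carrier A \<Longrightarrow> \<phi> (inv\<^bsub>A\<^esub> a) = inverse (\<phi> a)"
proof -
  interpret group A by (rule grp)
  assume "a \<in> carrier A"
  then have "\<phi> a * \<phi> (inv\<^bsub>A\<^esub> a) = 1" by (simp add: transfer_one flip: hom)
  then show ?thesis using gm_inverse_unique[of "\<phi> a"] by simp
qed

lemma transfer_eq_one_iff: "a \<in> carrier A \<Longrightarrow> \<phi> a = 1 \<longleftrightarrow> a = \<one>\<^bsub>A\<^esub>"
proof -
  interpret group A by (rule grp)
  assume "a \<in> carrier A"
  then show ?thesis using inj_onD[OF inj, of a "\<one>\<^bsub>A\<^esub>"] transfer_one by auto
qed

lemma transfer_subgroup:
  assumes "subgroup K A" shows "subgp (\<phi> ` K)"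
proof -
  interpret subgroup K A by (rule assms)
  show ?thesis
  proof (rule subgpI)
    show "1 \<in> \<phi> ` K" using transfer_one one_closed by (metis image_eqI)
    show "a * b \<in> \<phi> ` K" if ab: "a \<in> \<phi> ` K" "b \<in> \<phi> ` K" for a b
    proof -
      obtain c d where cd: "c \<in> K" "a = \<phi> c" "d \<in> K" "b = \<phi> d" using ab by blast
      then have "a * b = \<phi> (c \<otimes>\<^bsub>A\<^esub> d)" by (simp add: hom)
      then show ?thesis using cd by simp
    qed
    show "inverse a \<in> \<phi> ` K" if a: "a \<in> \<phi> ` K" for a
    proof -
      obtain c where c: "c \<in> K" "a = \<phi> c" using a by blast
      then have "inverse a = \<phi> (inv\<^bsub>A\<^esub> c)" by (simp add: transfer_inv)
      then show ?thesis using c by simp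
    qed
  qed
qed

lemma preim_one: "preim A \<phi> {1} = {\<one>\<^bsub>A\<^esub>}"
proof -
  interpret group A by (rule grp)
  show ?thesis using transfer_eq_one_iff transfer_one by (auto simp: preim_def)
qed

lemma preim_subgroup:
  assumes "subgp K" shows "subgroup (preim A \<phi> K) A"
proof -
  interpret group A by (rule grp)
  show ?thesis
    by (rule subgroupI)
      (auto simp: preim_def hom transfer_inv transfer_one assms subgp_mult subgp_inv intro!: exI[of _ "\<one>\<^bsub>A\<^esub>"] subgp_one)
qed

lemma preim_normal:
  assumes "subgp K" "subgp M" "K \<subseteq> M" "M \<subseteq> nrm K"
  shows "preim A \<phi> K \<lhd> A\<lparr>carrier := preim A \<phi> M\<rparr>"
proof -
  interpret group A by (rule grp)
  have sub: "subgroup (preim A \<phi> M) A" by (rule preim_subgroup[OF assms(2)])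
  interpret M: group "A\<lparr>carrier := preim A \<phi> M\<rparr>" by (rule subgroup.subgroup_is_group[OF sub grp])
  have KM: "preim A \<phi> K \<subseteq> preim A \<phi> M" using assms(3) by (auto simp: preim_def)
  show ?thesis
    unfolding M.normal_inv_iff
  proof (intro conjI ballI)
    show "subgroup (preim A \<phi> K) (A\<lparr>carrier := preim A \<phi> M\<rparr>)"
      by (rule subgroup_incl[OF preim_subgroup[OF assms(1)] sub KM])
    fix x h assume x: "x \<in> carrier (A\<lparr>carrier := preim A \<phi> M\<rparr>)" and h: "h \<in> preim A \<phi> K"
    have xh: "x \<in> carrier A" "\<phi> x \<in> nrm K" "h \<in> carrier A" "\<phi> h \<in> K"
      using x h assms(4) by (auto simp: preim_def)
    have "\<phi> (x \<otimes>\<^bsub>A\<^esub> h \<otimes>\<^bsub>A\<^esub> inv\<^bsub>A\<^esub> x) = \<phi> x * \<phi> h * inverse (\<phi> x)"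
      using xh by (simp add: hom transfer_inv)
    then have "x \<otimes>\<^bsub>A\<^esub> h \<otimes>\<^bsub>A\<^esub> inv\<^bsub>A\<^esub> x \<in> preim A \<phi> K"
      using xh nrmD by (simp add: preim_def)
    then show "x \<otimes>\<^bsub>A\<lparr>carrier := preim A \<phi> M\<rparr>\<^esub> h \<otimes>\<^bsub>A\<lparr>carrier := preim A \<phi> M\<rparr>\<^esub> inv\<^bsub>A\<lparr>carrier := preim A \<phi> M\<rparr>\<^esub> x \<in> preim A \<phi> K"
      using m_inv_consistent[OF sub] x by simp
  qed
qed

lemma transfer_generate:
  assumes "S \<subseteq> carrier A" shows "\<phi> ` generate A S = gen (\<phi> ` S)"
proof (rule subset_antisym)
  interpret group A by (rule grp)
  have "\<phi> ` S \<subseteq> \<phi> ` generate A S" using generate.incl by (fastforce intro: image_mono)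
  then show "gen (\<phi> ` S) \<subseteq> \<phi> ` generate A S"
    using transfer_subgroup[OF generate_is_subgroup[OF assms]] by (intro gen_least)
  have "S \<subseteq> preim A \<phi> (gen (\<phi> ` S))" using assms by (auto simp: preim_def intro: gen_mem)
  then have "generate A S \<subseteq> preim A \<phi> (gen (\<phi> ` S))"
    by (rule generate_subgroup_incl[OF _ preim_subgroup[OF subgp_gen]])
  then show "\<phi> ` generate A S \<subseteq> gen (\<phi> ` S)" by (auto simp: preim_def)
qed

lemma lower_central_carrier: "lower_central A n \<subseteq> carrier A"
proof (induction n)
  case (Suc n)
  interpret group A by (rule grp)
  have "{commutator A a b | a b. a \<in> lower_central A n \<and> b \<in> carrier A} \<subseteq> carrier A"
    using Suc by (auto simp: commutator_def)
  from generate_incl[OF this] show ?case by simp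
qed simp

text \<open>The two conventions for commutators agree up to inverting the second entry, which runs over a group.\<close>

lemma transfer_lower_central: "\<phi> ` lower_central A n = lc (\<phi> ` carrier A) n"
proof (induction n)
  case (Suc n)
  interpret group A by (rule grp)
  have L: "lower_central A n \<subseteq> carrier A" by (rule lower_central_carrier)
  let ?C = "{commutator A a b | a b. a \<in> lower_central A n \<and> b \<in> carrier A}"
  have C: "?C \<subseteq> carrier A" using L by (auto simp: commutator_def)
  have com: "\<phi> (commutator A a (inv\<^bsub>A\<^esub> b)) = comm (\<phi> a) (\<phi> b)" if "a \<in> lower_central A n" "b \<in> carrier A" for a b
    using that L by (auto simp: commutator_def comm_def hom transfer_inv subsetD)
  have "\<phi> ` ?C = {comm a b | a b. a \<in> \<phi> ` lower_central A n \<and> b \<in> \<phi> ` carrier A}"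
  proof (intro subset_antisym subsetI)
    fix y assume "y \<in> \<phi> ` ?C"
    then obtain a b where ab: "a \<in> lower_central A n" "b \<in> carrier A" "y = \<phi> (commutator A a b)" by blast
    then have "y = comm (\<phi> a) (\<phi> (inv\<^bsub>A\<^esub> b))" using com[of a "inv\<^bsub>A\<^esub> b"] by simp
    moreover have "inv\<^bsub>A\<^esub> b \<in> carrier A" using ab(2) by simp
    ultimately show "y \<in> {comm a b | a b. a \<in> \<phi> ` lower_central A n \<and> b \<in> \<phi> ` carrier A}"
      using ab(1) by blast
  next
    fix y assume "y \<in> {comm a b | a b. a \<in> \<phi> ` lower_central A n \<and> b \<in> \<phi> ` carrier A}"
    then obtain a b where ab: "a \<in> lower_central A n" "b \<in> carrier A" "y = comm (\<phi> a) (\<phi> b)"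
      by blast
    have "inv\<^bsub>A\<^esub> b \<in> carrier A" using ab(2) by simp
    then have "commutator A a (inv\<^bsub>A\<^esub> b) \<in> ?C" using ab(1) by blast
    then show "y \<in> \<phi> ` ?C" unfolding ab(3) com[OF ab(1,2), symmetric] by (rule imageI)
  qed
  then show ?case using transfer_generate[OF C] by (simp add: Suc)
qed simp

lemma transfer_nilpotent: "nilpotent_group A \<longleftrightarrow> nilp (\<phi> ` carrier A)"
proof -
  interpret group A by (rule grp)
  have "lower_central A n = {\<one>\<^bsub>A\<^esub>} \<longleftrightarrow> lc (\<phi> ` carrier A) n = {1}" for n
  proof
    show "lower_central A n = {\<one>\<^bsub>A\<^esub>} \<Longrightarrow> lc (\<phi> ` carrier A) n = {1}"
      by (simp add: transfer_one flip: transfer_lower_central)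
    assume "lc (\<phi> ` carrier A) n = {1}"
    then have im: "\<phi> ` lower_central A n = {1}" by (simp add: transfer_lower_central)
    then have "lower_central A n \<subseteq> {\<one>\<^bsub>A\<^esub>}" using lower_central_carrier transfer_eq_one_iff by blast
    moreover have "lower_central A n \<noteq> {}" using im by auto
    ultimately show "lower_central A n = {\<one>\<^bsub>A\<^esub>}" by blast
  qed
  then show ?thesis
    using grp transfer_subgroup[OF subgroup_self] by (simp add: nilpotent_group_def nilp_def)
qed

lemma transfer_max:
  assumes "satisfies_max A" shows "max_cond (\<phi> ` carrier A)"
  unfolding max_cond_def
proof (intro allI impI)
  fix K assume K: "subgp K \<and> K \<subseteq> \<phi> ` carrier A"
  then have "subgroup (preim A \<phi> K) A" using preim_subgroup by simp
  from assms[unfolded satisfies_max_def, rule_format, OF this]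
  obtain S where S: "finite S" "S \<subseteq> carrier A" "generate A S = preim A \<phi> K" by (elim exE conjE)
  have "gen (\<phi> ` S) = K" using transfer_generate[OF S(2)] S(3) image_preim[of K \<phi> A] K by simp
  then show "\<exists>S. finite S \<and> gen S = K" using S(1) by blast
qed

end

lemma transfer_nilpotent_subgroup:
  assumes "group A" "\<And>a b. a \<in> carrier A \<Longrightarrow> b \<in> carrier A \<Longrightarrow> \<phi> (a \<otimes>\<^bsub>A\<^esub> b) = \<phi> a * (\<phi> b :: 'q::group_mult)"
    "inj_on \<phi> (carrier A)" "subgroup N A"
  shows "nilpotent_group (A\<lparr>carrier := N\<rparr>) \<longleftrightarrow> nilp (\<phi> ` N)"
proof -
  have N: "N \<subseteq> carrier A" using subgroup.subset[OF assms(4)] .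
  have "nilpotent_group (A\<lparr>carrier := N\<rparr>) \<longleftrightarrow> nilp (\<phi> ` carrier (A\<lparr>carrier := N\<rparr>))"
  proof (rule transfer_nilpotent)
    show "group (A\<lparr>carrier := N\<rparr>)" by (rule subgroup.subgroup_is_group[OF assms(4,1)])
    show "inj_on \<phi> (carrier (A\<lparr>carrier := N\<rparr>))" using assms(3) N by (simp add: inj_on_subset)
  qed (use assms(2) N in auto)
  then show ?thesis by simp
qed

subsection \<open>Left translations and automorphisms\<close>

text \<open>Both are extended by the identity outside the carrier, so that they permute the whole type.\<close>

definition translation :: "('a, 'b) monoid_scheme \<Rightarrow> 'a \<Rightarrow> 'a bijection" where
  "translation G g = Bijection (\<lambda>a. if a \<in> carrier G then g \<otimes>\<^bsub>G\<^esub> a else a)"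

definition extension :: "('a, 'b) monoid_scheme \<Rightarrow> ('a \<Rightarrow> 'a) \<Rightarrow> 'a bijection" where
  "extension G h = Bijection (\<lambda>a. if a \<in> carrier G then h a else a)"

lemma bij_extend:
  assumes "bij_betw f C C" shows "bij (\<lambda>a. if a \<in> C then f a else a)"
proof -
  have "bij_betw (\<lambda>a. if a \<in> C then f a else a) (C \<union> - C) (C \<union> - C)"
  proof (rule bij_betw_combine)
    show "bij_betw (\<lambda>a. if a \<in> C then f a else a) C C"
      using assms by (simp cong: bij_betw_cong)
    show "bij_betw (\<lambda>a. if a \<in> C then f a else a) (- C) (- C)"
      by (simp add: bij_betw_def inj_on_def)
  qed simp
  then show ?thesis by simp
qed

context
  fixes G :: "('a, 'b) monoid_scheme"
  assumes G: "group G"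
begin

interpretation group G by (rule G)

lemma app_translation:
  assumes "g \<in> carrier G"
  shows "app (translation G g) a = (if a \<in> carrier G then g \<otimes>\<^bsub>G\<^esub> a else a)"
proof -
  have "bij_betw (\<lambda>a. g \<otimes>\<^bsub>G\<^esub> a) (carrier G) (carrier G)"
    by (rule bij_betw_byWitness[where f' = "\<lambda>a. inv\<^bsub>G\<^esub> g \<otimes>\<^bsub>G\<^esub> a"])
      (use assms in \<open>auto simp: m_assoc[symmetric]\<close>)
  then show ?thesis by (simp add: translation_def app_Bijection bij_extend)
qed

lemma autoD:
  assumes "h \<in> auto G"
  shows "bij_betw h (carrier G) (carrier G)" "h \<in> extensional (carrier G)"
    "a \<in> carrier G \<Longrightarrow> h a \<in> carrier G"
    "a \<in> carrier G \<Longrightarrow> b \<in> carrier G \<Longrightarrow> h (a \<otimes>\<^bsub>G\<^esub> b) = h a \<otimes>\<^bsub>G\<^esub> h b"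
  using assms by (auto simp: auto_def hom_def Bij_def)

lemma app_extension:
  assumes "h \<in> auto G"
  shows "app (extension G h) a = (if a \<in> carrier G then h a else a)"
  using autoD(1)[OF assms] by (simp add: extension_def app_Bijection bij_extend)

lemma translation_mult:
  assumes "g \<in> carrier G" "h \<in> carrier G"
  shows "translation G (g \<otimes>\<^bsub>G\<^esub> h) = translation G g * translation G h"
  by (rule bijection_eqI) (use assms in \<open>simp add: app_times app_translation m_assoc\<close>)

lemma translation_inj: "inj_on (translation G) (carrier G)"
proof (rule inj_onI)
  fix g h assume gh: "g \<in> carrier G" "h \<in> carrier G" "translation G g = translation G h"
  have "app (translation G k) \<one>\<^bsub>G\<^esub> = k" if "k \<in> carrier G" for k
    using that by (simp add: app_translation)
  then show "g = h" using gh by metis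
qed

lemma group_AutoGroup: "group (AutoGroup G)"
  by (rule AutoGroup)

lemma extension_mult:
  assumes "g \<in> carrier (AutoGroup G)" "h \<in> carrier (AutoGroup G)"
  shows "extension G (g \<otimes>\<^bsub>AutoGroup G\<^esub> h) = extension G g * extension G h"
proof (rule bijection_eqI)
  fix a
  interpret Aut: group "AutoGroup G" by (rule group_AutoGroup)
  have gh: "g \<in> auto G" "h \<in> auto G" "g \<otimes>\<^bsub>AutoGroup G\<^esub> h \<in> auto G"
    using assms Aut.m_closed[OF assms] by (simp_all add: AutoGroup_def)
  have "g \<otimes>\<^bsub>AutoGroup G\<^esub> h = compose (carrier G) g h"
    using gh(1,2) by (simp add: AutoGroup_def BijGroup_def auto_def)
  then show "app (extension G (g \<otimes>\<^bsub>AutoGroup G\<^esub> h)) a = app (extension G g * extension G h) a"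
    using gh autoD(3)[OF gh(2)] by (simp add: app_times app_extension compose_def)
qed

lemma extension_inj: "inj_on (extension G) (carrier (AutoGroup G))"
proof (rule inj_onI)
  fix g h assume gh: "g \<in> carrier (AutoGroup G)" "h \<in> carrier (AutoGroup G)" "extension G g = extension G h"
  then have au: "g \<in> auto G" "h \<in> auto G" by (simp_all add: AutoGroup_def)
  show "g = h"
  proof (rule extensionalityI[OF autoD(2)[OF au(1)] autoD(2)[OF au(2)]])
    fix a assume "a \<in> carrier G"
    moreover have "app (extension G g) a = app (extension G h) a" using gh(3) by simp
    ultimately show "g a = h a" using au by (simp add: app_extension)
  qed
qed

text \<open>This is the relation that makes translations and automorphisms generate the holomorph.\<close>

lemma extension_conj:
  assumes h: "h \<in> auto G" and g: "g \<in> carrier G"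
  shows "extension G h * translation G g * inverse (extension G h) = translation G (h g)"
proof -
  have "extension G h * translation G g = translation G (h g) * extension G h"
    by (rule bijection_eqI)
      (use autoD(3,4)[OF h] g in \<open>simp add: app_times app_extension[OF h] app_translation\<close>)
  then show ?thesis by (simp add: gm_simps)
qed

lemma translation_inv: "g \<in> carrier G \<Longrightarrow> translation G (inv\<^bsub>G\<^esub> g) = inverse (translation G g)"
  by (rule transfer_inv[OF G translation_mult translation_inj])

lemma aut_commutator_closed: "h \<in> auto G \<Longrightarrow> g \<in> carrier G \<Longrightarrow> aut_commutator G g h \<in> carrier G"
  using autoD(3) by (simp add: aut_commutator_def)

lemma translation_aut_commutator:
  assumes "h \<in> auto G" "g \<in> carrier G"
  shows "translation G (aut_commutator G g h) = comm (translation G g) (extension G h)"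
proof -
  have "translation G (aut_commutator G g h) = inverse (translation G g) * translation G (h g)"
    using assms autoD(3) by (simp add: aut_commutator_def translation_mult translation_inv)
  then show ?thesis by (simp add: comm_def mult.assoc flip: extension_conj[OF assms])
qed

lemma translation_iter_aut_commutator:
  assumes "h \<in> auto G" "g \<in> carrier G"
  shows "iter_aut_commutator G g n h \<in> carrier G \<and>
    translation G (iter_aut_commutator G g n h) = ((\<lambda>a. comm a (extension G h)) ^^ n) (translation G g)"
  by (induction n) (auto simp: assms aut_commutator_closed translation_aut_commutator)

lemma extension_nrm:
  assumes "subgroup H (AutoGroup G)"
  shows "extension G ` H \<subseteq> nrm (translation G ` carrier G)"
proof -
  interpret H: subgroup H "AutoGroup G" by (rule assms)
  have conj: "extension G h * k * inverse (extension G h) \<in> translation G ` carrier G"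
    if h: "h \<in> H" and k: "k \<in> translation G ` carrier G" for h k
  proof -
    have "h \<in> auto G" using h H.subset by (auto simp: AutoGroup_def)
    then show ?thesis using k extension_conj autoD(3) by fastforce
  qed
  show ?thesis
  proof (rule image_subsetI, rule nrmI)
    fix h k assume h: "h \<in> H" and k: "k \<in> translation G ` carrier G"
    show "extension G h * k * inverse (extension G h) \<in> translation G ` carrier G" by (rule conj[OF h k])
    have "extension G (inv\<^bsub>AutoGroup G\<^esub> h) = inverse (extension G h)"
      by (rule transfer_inv[OF group_AutoGroup extension_mult extension_inj H.mem_carrier[OF h]])
    then show "inverse (extension G h) * k * extension G h \<in> translation G ` carrier G"
      using conj[OF H.m_inv_closed[OF h] k] by (simp add: gm_inverse_inverse)
  qed
qed

end

section \<open>Groups of nil-automorphisms\<close>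

theorem theoremA:
  fixes G :: "('a, 'b) monoid_scheme" and H :: "('a \<Rightarrow> 'a) set"
  assumes "group G"
    and "satisfies_max G"
    and "nil_automorphism_group G H"
  shows "aut_commutator_subgroup G (carrier G) H \<subseteq> fitting_radical G
    \<and> (\<exists>K r. subnormal_series G K r \<and> stabilizes_series G H K r)
    \<and> nilpotent_group (AutoGroup G\<lparr>carrier := H\<rparr>)"
proof -
  note G = assms(1)
  interpret group G by (rule G)
  let ?\<tau> = "translation G" let ?\<epsilon> = "extension G"
  note tau = G translation_mult[OF G] translation_inj[OF G]
  note eps = group_AutoGroup[OF G] extension_mult[OF G] extension_inj[OF G]
  define G' where "G' = ?\<tau> ` carrier G"
  define H' where "H' = ?\<epsilon> ` H"
  have subH: "subgroup H (AutoGroup G)" and nilH: "\<And>h. h \<in> H \<Longrightarrow> nil_automorphism G h"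
    using assms(3) by (auto simp: nil_automorphism_group_def)
  have aut: "h \<in> auto G" if "h \<in> H" for h using nilH[OF that] by (simp add: nil_automorphism_def)
  have sG: "subgp G'" unfolding G'_def by (rule transfer_subgroup[OF tau subgroup_self])
  have mG: "max_cond G'" unfolding G'_def by (rule transfer_max[OF tau assms(2)])
  have sH: "subgp H'" unfolding H'_def by (rule transfer_subgroup[OF eps subH])
  have HG: "H' \<subseteq> nrm G'" unfolding H'_def G'_def by (rule extension_nrm[OF G subH])
  have nil: "nil_on h' G'" if h': "h' \<in> H'" for h'
    unfolding nil_on_def G'_def
  proof
    obtain h where h: "h \<in> H" "h' = ?\<epsilon> h" using h' by (auto simp: H'_def)
    fix k assume "k \<in> ?\<tau> ` carrier G"
    then obtain g where g: "g \<in> carrier G" "k = ?\<tau> g" by blast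
    obtain n where "iter_aut_commutator G g n h = \<one>\<^bsub>G\<^esub>"
      using nilH[OF h(1)] g(1) by (auto simp: nil_automorphism_def)
    then have "((\<lambda>a. comm a h') ^^ n) k = 1"
      using translation_iter_aut_commutator[OF G aut[OF h(1)] g(1), of n] transfer_one[OF tau] g(2) h(2)
      by simp
    then show "\<exists>n. ((\<lambda>a. comm a h') ^^ n) k = 1" by blast
  qed
  have commutator_iff: "aut_commutator G g h \<in> preim G ?\<tau> M \<longleftrightarrow> comm (?\<tau> g) (?\<epsilon> h) \<in> M"
    if "g \<in> carrier G" "h \<in> H" for g h M
    using translation_aut_commutator[OF G aut[OF that(2)] that(1)]
      aut_commutator_closed[OF G aut[OF that(2)] that(1)]
    by (simp add: preim_def)
  obtain K r where K1: "nilp (K 1)" "G' \<subseteq> nrm (K 1)" and K0: "K 0 = G'" and Kr: "\<forall>j>r. K j = {1}"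
    and K: "\<forall>j. subgp (K j) \<and> K (Suc j) \<subseteq> K j \<and> H' \<subseteq> nrm (K j) \<and> K j \<subseteq> nrm (K (Suc j))"
    and KH: "\<forall>j. \<forall>a\<in>K j. \<forall>h\<in>H'. comm a h \<in> K (Suc j)"
    using nil_group_series[OF sG mG sH HG nil] by blast
  define L where "L j = preim G ?\<tau> (K j)" for j
  have L: "subgroup (L j) G" "L (Suc j) \<lhd> G\<lparr>carrier := L j\<rparr>" for j
    unfolding L_def using K by (auto intro!: preim_subgroup[OF tau] preim_normal[OF tau])
  have L0: "L 0 = carrier G" by (auto simp: L_def K0 G'_def preim_def)
  have Lr: "L (Suc r) = {\<one>\<^bsub>G\<^esub>}" using Kr preim_one[OF tau] by (simp add: L_def)
  have stab: "aut_commutator_subgroup G (L j) H \<subseteq> L (Suc j)" for j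
    unfolding aut_commutator_subgroup_def
  proof (rule generate_subgroup_incl[OF _ L(1)])
    show "{aut_commutator G g h |g h. g \<in> L j \<and> h \<in> H} \<subseteq> L (Suc j)"
    proof clarify
      fix g h assume gh: "g \<in> L j" "h \<in> H"
      then have "g \<in> carrier G" "?\<tau> g \<in> K j" by (simp_all add: L_def preim_def)
      moreover have "?\<epsilon> h \<in> H'" using gh(2) by (simp add: H'_def)
      ultimately show "aut_commutator G g h \<in> L (Suc j)"
        unfolding L_def using commutator_iff[OF _ gh(2)] KH by blast
    qed
  qed
  have "subnormal_series G L (Suc r)" "stabilizes_series G H L (Suc r)"
    using L L0 Lr stab by (auto simp: subnormal_series_def stabilizes_series_def)
  moreover have "aut_commutator_subgroup G (carrier G) H \<subseteq> fitting_radical G"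
  proof -
    have "L 1 \<lhd> G" using L(2)[of 0] by (simp add: L0)
    moreover have "K 1 \<subseteq> G'" using K[rule_format, of 0] K0 by simp
    then have "?\<tau> ` L 1 = K 1" unfolding L_def G'_def by (rule image_preim)
    then have "nilpotent_group (G\<lparr>carrier := L 1\<rparr>)"
      using transfer_nilpotent_subgroup[OF tau L(1)] K1(1) by simp
    ultimately have "L 1 \<subseteq> \<Union>{N. N \<lhd> G \<and> nilpotent_group (G\<lparr>carrier := N\<rparr>)}"
      by (intro Union_upper CollectI conjI)
    then have "L 1 \<subseteq> fitting_radical G"
      unfolding fitting_radical_def by (auto intro: generate.incl)
    then show ?thesis using stab[of 0] L0 by auto
  qed
  moreover have "nilpotent_group (AutoGroup G\<lparr>carrier := H\<rparr>)"
  proof -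
    have "nilp H'"
    proof (rule nil_group_nilp[OF sG mG sH HG nil])
      fix h' assume "h' \<in> H'" and triv: "\<And>k. k \<in> G' \<Longrightarrow> comm k h' = 1"
      then obtain h where h: "h \<in> H" "h' = ?\<epsilon> h" by (auto simp: H'_def)
      show "h' = 1"
      proof (rule bijection_eqI)
        fix a
        have "h a = a" if a: "a \<in> carrier G"
        proof -
          have "?\<tau> (h a) = ?\<tau> a * comm (?\<tau> a) (?\<epsilon> h)"
            by (simp only: conj_eq_comm[symmetric] extension_conj[OF G aut[OF h(1)] a])
          then have "?\<tau> (h a) = ?\<tau> a" using triv a h(2) by (simp add: G'_def)
          then show ?thesis
            using inj_onD[OF translation_inj[OF G]] autoD(3)[OF G aut[OF h(1)] a] a by blast
        qed
        then show "app h' a = app 1 a"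
          by (simp add: h(2) app_extension[OF G aut[OF h(1)]] app_one)
      qed
    qed
    then show ?thesis using transfer_nilpotent_subgroup[OF eps subH] by (simp add: H'_def)
  qed
  ultimately show ?thesis by blast
qed

end
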